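(* Assume $\mathbf{H}_1$, $\mathbf{H}_2$ and $\mathbf{H}_3$ (stated in the context), and let $$\theta(s)=\frac{2h'(s)-2r(s)e^{\int_0^{s}r(t)\,\mathrm{d}t}}{h(s)-e^{\int_0^{s}r(t)\,\mathrm{d}t}},\qquad s\ge0 .$$ For each deterministic $\tau\in(0,+\infty)$ let $\bar\pi_\tau$ be the strategy $$\bar\pi_\tau(t)=\beta(t)[\sigma(t)\sigma(t)^{\top}]^{-1}\Big(\gamma(\tau)e^{-\int_t^{\tau}r(s)\,\mathrm{d}s}-X^{\bar\pi_\tau}(t)\Big),\qquad t\le\tau .$$ (i) If there is a constant $\delta>0$ such that $\theta(s)>\phi(s)+\delta$ for all $s\ge0$, let $\tau^*\in(0,+\infty)$ be a time with $\mathrm{Var}(X^{\bar\pi_{\tau^*}}(\tau^* ))=\min_{\tau\in(0,+\infty)}\mathrm{Var}(X^{\bar\pi_\tau}(\tau))$ (such a time exists) and let $\pi^*=\bar\pi_{\tau^*}$. Then $(\pi^*(\cdot),\tau^* )$ solves the varying terminal time mean-variance model, i.e. it is an optimal strategy, in the sense defined in the context, for minimizing $J(\pi(\cdot))=\mathrm{Var}(X^{\pi}(\tau^{\pi}))$ subject to the varying terminal time constraint $$\tau^{\pi}=\inf\{t\in[0,\tau]:\ \mathbb{E}[X^{\pi}(t)]\ge xh(\tau)\}.$$ (ii) If $\theta(s)\le\phi(s)$ for all $s\ge0$, then along the pairs $(\bar\pi_\tau,\tau)$ the cost $J(\bar\pi_\tau)=\mathrm{Var}(X^{\bar\pi_\tau}(\tau))$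 is decreasing in $\tau\in(0,+\infty)$; consequently the varying terminal time mean-variance model does not admit an optimal strategy with finite terminal time.
   Context: Market. $W$ is a $d$-dimensional standard Brownian motion on a complete filtered probability space $(\Omega,\mathcal{F},P;\{\mathcal{F}(t)\}_{t\ge0})$, where $\{\mathcal{F}(t)\}$ is the $P$-augmentation of the natural filtration of $W$. The functions $r(\cdot)$ (real valued), $b(\cdot)=(b_1(\cdot),\dots,b_n(\cdot))$ and $\sigma(\cdot)\in\mathbb{R}^{n\times d}$ are defined on $[0,+\infty)$; $\beta(\cdot)=(\beta_1(\cdot),\dots,\beta_n(\cdot))$ is the row vector with $\beta_i=b_i-r$. The initial capital is $x>0$. For a row-vector-valued strategy $\pi(\cdot)\in\mathbb{R}^n$, the wealth $X^{\pi}(\cdot)$ solves $$\mathrm{d}X^{\pi}(t)=\big[r(t)X^{\pi}(t)+\beta(t)\pi(t)^{\top}\big]\mathrm{d}t+\pi(t)\sigma(t)\,\mathrm{d}W(t),\qquad X^{\pi}(0)=x .$$ When $\pi$ is given in feedback form, $X^\pi$ is the solution of the resulting closed-loop equation. $\mathrm{Var}(Y)=\mathbb{E}(Y-\mathbb{E}[Y])^2$. Assumptions. $\mathbf{H}_1$: $r(\cdot),b(\cdot),\sigma(\cdot)$ are bounded deterministic continuous functions. $\mathbf{H}_2$: $r(\cdot)>0$, $\beta(\cdot)>0$ (componentwise), and $\sigma(\cdot)\sigma(\cdot)^{\top}>\varepsilon\mathbf{I}$ for a given constant $\varepsilon>0$, with $\mathbf{I}$ the $n\times n$ identity matrix. $\mathbf{H}_3$: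 $h(\cdot)$ is a real function that is increasing and differentiable on $[0,+\infty)$, with $h(0)>1$ and $h(t)>e^{\int_0^t r(s)\,\mathrm{d}s}$ for all $t\ge0$. Notation. For $\tau>0$: $$\phi(t)=\beta(t)[\sigma(t)\sigma(t)^{\top}]^{-1}\beta(t)^{\top},\qquad \mu(\tau)=\frac{e^{\int_0^{\tau}\phi(t)\,\mathrm{d}t}-1}{x h(\tau)-x e^{\int_0^{\tau}r(t)\,\mathrm{d}t}},\qquad \gamma(\tau)=\frac{1}{\mu(\tau)}e^{\int_0^{\tau}\phi(t)\,\mathrm{d}t}+x\,e^{\int_0^{\tau}r(t)\,\mathrm{d}t}.$$ The strategy $\bar\pi_\tau$ is the optimal strategy of the classical mean-variance problem with terminal time $\tau$, namely minimizing $-\mathbb{E}[X^{\pi}(\tau)]+\frac{\mu(\tau)}{2}\mathrm{Var}(X^{\pi}(\tau))$, and $\mu(\tau)$ is chosen so that $\mathbb{E}[X^{\bar\pi_\tau}(\tau)]=xh(\tau)$. The varying terminal time model. Given a deterministic $\tau>0$ and a strategy $\pi$, put $\tau^{\pi}=\inf\{t\in[0,\tau]:\mathbb{E}[X^{\pi}(t)]\ge xh(\tau)\}$ (with $\inf\varnothing=+\infty$; $\tau^{\pi}$ depends on $\tau$). $L^2_{\mathcal{F}}[0,T;\mathbb{R}^n]$ is the set of $\mathbb{R}^n$-valued measurable $\{\mathcal{F}(t)\}$-adapted processes $f$ with $\mathbb{E}\int_0^{T}|f(t)|^2\mathrm{d}t<+\infty$. The admissible set is $\mathcal{A}=\{\pi(\cdot):\pi(\cdot)\in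 L^2_{\mathcal{F}}[0,\tau^{\pi};\mathbb{R}^n],\ \tau\in(0,+\infty)\}$, where both $\tau$ and $\pi$ are free and $\tau^\pi$ is required to be finite. The cost is $J(\pi(\cdot))=\mathbb{E}\big(X^{\pi}(\tau^{\pi})-\mathbb{E}[X^{\pi}(\tau^{\pi})]\big)^2$. A pair $(\pi^*,\tau^* )$ with $\tau^*\in(0,+\infty)$ is an optimal strategy of the model (solves the model) if $\pi^*\in\mathcal{A}$, $\tau^*$ satisfies the constraint (that is, $\tau^{\pi^*}=\tau^*$ when the given time is $\tau=\tau^*$), and $\mathrm{Var}(X^{\pi^*}(\tau^* ))\le\mathrm{Var}(X^{\pi}(\tau^{\pi}))$ for every given time $\tau\in(0,+\infty)$ and every admissible $\pi$ for that $\tau$ (i.e. $\tau^{\pi}<+\infty$ and $\pi\in L^2_{\mathcal{F}}[0,\tau^{\pi};\mathbb{R}^n]$). *)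

theory Defs
  imports "HOL-Probability.Probability"
begin

section \<open>Brownian motion and its filtration\<close>

text \<open>Only \<open>borel_measurable\<close> and \<open>sets\<close> of the following measure are used; for a complete
  probability space \<open>M\<close> its sets form the augmentation by the null sets of \<open>M\<close> of the natural
  filtration of \<open>W\<close>.\<close>

definition filt :: "'w measure \<Rightarrow> (real \<Rightarrow> 'w \<Rightarrow> real^'d) \<Rightarrow> real \<Rightarrow> 'w measure" where
  "filt M W t =
     sigma (space M) ({W s -` B \<inter> space M | s B. 0 \<le> s \<and> s \<le> t \<and> B \<in> sets borel} \<union> null_sets M)"

definition brownian_motion :: "'w measure \<Rightarrow> (real \<Rightarrow> 'w \<Rightarrow> real^'d) \<Rightarrow> bool" where
  "brownian_motion M W \<longleftrightarrow>
     (\<forall>t\<ge>0. W t \<in> borel_measurable M) \<and>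
     (AE \<omega> in M. W 0 \<omega> = 0) \<and>
     (AE \<omega> in M. continuous_on {0..} (\<lambda>t. W t \<omega>)) \<and>
     (\<forall>s t. 0 \<le> s \<and> s < t \<longrightarrow>
        prob_space.indep_set M (sets (filt M W s))
          {(\<lambda>\<omega>. W t \<omega> - W s \<omega>) -` B \<inter> space M | B. B \<in> sets borel} \<and>
        prob_space.indep_vars M (\<lambda>_. borel) (\<lambda>i \<omega>. (W t \<omega> - W s \<omega>) $ i) UNIV \<and>
        (\<forall>i. distributed M lborel (\<lambda>\<omega>. (W t \<omega> - W s \<omega>) $ i) (normal_density 0 (sqrt (t - s)))))"

definition L2_adapted ::
  "'w measure \<Rightarrow> (real \<Rightarrow> 'w \<Rightarrow> real^'d) \<Rightarrow> real \<Rightarrow> (real \<Rightarrow> 'w \<Rightarrow> 'a::euclidean_space) \<Rightarrow> bool" where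
  "L2_adapted M W T f \<longleftrightarrow>
     (\<lambda>(t, \<omega>). f t \<omega>) \<in> borel_measurable (restrict_space borel {0..T} \<Otimes>\<^sub>M M) \<and>
     (\<forall>t\<in>{0..T}. f t \<in> borel_measurable (filt M W t)) \<and>
     (\<integral>\<^sup>+ \<omega>. (\<integral>\<^sup>+ t\<in>{0..T}. ennreal ((norm (f t \<omega>))\<^sup>2) \<partial>lborel) \<partial>M) < \<infinity>"

section \<open>The Ito integral of square-integrable integrands\<close>

text \<open>A simple integrand on \<open>[0,T]\<close> takes the bounded value \<open>\<xi> i\<close>, known at time \<open>p i\<close>, on the
  interval \<open>(p i, p (i+1)]\<close>, for \<open>i < k\<close>.\<close>

definition simple_integrand ::
  "'w measure \<Rightarrow> (real \<Rightarrow> 'w \<Rightarrow> real^'d) \<Rightarrow> real \<Rightarrow> nat \<Rightarrow> (nat \<Rightarrow> real) \<Rightarrow> (nat \<Rightarrow> 'w \<Rightarrow> real^'d) \<Rightarrow> bool"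
  where
  "simple_integrand M W T k p \<xi> \<longleftrightarrow>
     p 0 = 0 \<and> p k = T \<and> (\<forall>i<k. p i \<le> p (Suc i)) \<and>
     (\<forall>i<k. \<xi> i \<in> borel_measurable (filt M W (p i)) \<and> bounded (\<xi> i ` space M))"

definition simple_process ::
  "nat \<Rightarrow> (nat \<Rightarrow> real) \<Rightarrow> (nat \<Rightarrow> 'w \<Rightarrow> real^'d) \<Rightarrow> real \<Rightarrow> 'w \<Rightarrow> real^'d" where
  "simple_process k p \<xi> t \<omega> = (\<Sum>i<k. indicator {p i<..p (Suc i)} t *\<^sub>R \<xi> i \<omega>)"

definition simple_integral ::
  "(real \<Rightarrow> 'w \<Rightarrow> real^'d) \<Rightarrow> nat \<Rightarrow> (nat \<Rightarrow> real) \<Rightarrow> (nat \<Rightarrow> 'w \<Rightarrow> real^'d) \<Rightarrow> 'w \<Rightarrow> real" where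
  "simple_integral W k p \<xi> \<omega> = (\<Sum>i<k. \<xi> i \<omega> \<bullet> (W (p (Suc i)) \<omega> - W (p i) \<omega>))"

text \<open>\<open>I\<close> is a version of \<open>\<integral>\<^sub>0\<^sup>T g(t) dW(t)\<close>, which is determined up to null sets.\<close>

definition has_ito_integral ::
  "'w measure \<Rightarrow> (real \<Rightarrow> 'w \<Rightarrow> real^'d) \<Rightarrow> real \<Rightarrow> (real \<Rightarrow> 'w \<Rightarrow> real^'d) \<Rightarrow> ('w \<Rightarrow> real) \<Rightarrow> bool" where
  "has_ito_integral M W T g I \<longleftrightarrow>
     L2_adapted M W T g \<and> I \<in> borel_measurable M \<and>
     (\<exists>k p \<xi>. (\<forall>m. simple_integrand M W T (k m) (p m) (\<xi> m)) \<and>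
        (\<lambda>m. \<integral>\<^sup>+ \<omega>. (\<integral>\<^sup>+ t\<in>{0..T}.
             ennreal ((norm (g t \<omega> - simple_process (k m) (p m) (\<xi> m) t \<omega>))\<^sup>2) \<partial>lborel) \<partial>M)
          \<longlonglongrightarrow> 0 \<and>
        (\<lambda>m. \<integral>\<^sup>+ \<omega>. ennreal ((I \<omega> - simple_integral W (k m) (p m) (\<xi> m) \<omega>)\<^sup>2) \<partial>M)
          \<longlonglongrightarrow> 0)"

section \<open>The market and the wealth equation\<close>

definition pos_def :: "real^'n^'n \<Rightarrow> bool" where
  "pos_def A \<longleftrightarrow> transpose A = A \<and> (\<forall>v. v \<noteq> 0 \<longrightarrow> v \<bullet> (A *v v) > 0)"

definition excess :: "(real \<Rightarrow> real) \<Rightarrow> (real \<Rightarrow> real^'n) \<Rightarrow> real \<Rightarrow> real^'n" where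
  "excess r b t = (\<chi> i. b t $ i - r t)"

definition cov :: "(real \<Rightarrow> real^'d^'n) \<Rightarrow> real \<Rightarrow> real^'n^'n" where
  "cov \<sigma> t = \<sigma> t ** transpose (\<sigma> t)"

definition accum :: "(real \<Rightarrow> real) \<Rightarrow> real \<Rightarrow> real" where
  "accum r t = exp (integral {0..t} r)"

text \<open>\<open>X\<close> solves the wealth equation for the strategy \<open>\<pi>\<close> on \<open>[0,T]\<close>. Strategies are row vectors,
  so \<open>\<beta> \<pi>\<^sup>T\<close> is an inner product and \<open>\<pi> \<sigma>\<close> is \<open>\<pi> v* \<sigma>\<close>. For square-integrable \<open>\<pi>\<close> and bounded
  coefficients every continuous adapted solution is square-integrable up to null sets, so
  requiring this of \<open>X\<close> loses no solutions.\<close>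

definition wealth_solution ::
  "'w measure \<Rightarrow> (real \<Rightarrow> 'w \<Rightarrow> real^'d) \<Rightarrow> (real \<Rightarrow> real) \<Rightarrow> (real \<Rightarrow> real^'n) \<Rightarrow>
   (real \<Rightarrow> real^'d^'n) \<Rightarrow> real \<Rightarrow> real \<Rightarrow> (real \<Rightarrow> 'w \<Rightarrow> real^'n) \<Rightarrow> (real \<Rightarrow> 'w \<Rightarrow> real) \<Rightarrow> bool" where
  "wealth_solution M W r b \<sigma> x T \<pi> X \<longleftrightarrow>
     L2_adapted M W T \<pi> \<and> L2_adapted M W T X \<and>
     (AE \<omega> in M. continuous_on {0..T} (\<lambda>t. X t \<omega>)) \<and>
     (\<forall>t\<in>{0..T}. \<exists>I. has_ito_integral M W t (\<lambda>s \<omega>. \<pi> s \<omega> v* \<sigma> s) I \<and>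
        (AE \<omega> in M. X t \<omega> =
           x + (LINT s:{0..t}|lborel. r s * X s \<omega> + excess r b s \<bullet> \<pi> s \<omega>) + I \<omega>))"

section \<open>The varying terminal time model\<close>

text \<open>The terminal time \<open>\<tau>\<^sup>\<pi>\<close>, with value \<open>\<infinity>\<close> if the infimum is over the empty set. Since
  \<open>X\<^sup>\<pi>\<close> makes sense at time \<open>t\<close> only if \<open>\<pi>\<close> is square-integrable on \<open>[0,t]\<close>, and strategies are
  only required to be so up to \<open>\<tau>\<^sup>\<pi>\<close>, the infimum is over those \<open>t\<close> at which \<open>X\<^sup>\<pi>\<close> is defined.
  The solution \<open>X\<close> is unique up to null sets, so its expectation does not depend on the choice.\<close>

definition hitting_time ::
  "'w measure \<Rightarrow> (real \<Rightarrow> 'w \<Rightarrow> real^'d) \<Rightarrow> (real \<Rightarrow> real) \<Rightarrow> (real \<Rightarrow> real^'n) \<Rightarrow>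
   (real \<Rightarrow> real^'d^'n) \<Rightarrow> real \<Rightarrow> (real \<Rightarrow> real) \<Rightarrow> real \<Rightarrow> (real \<Rightarrow> 'w \<Rightarrow> real^'n) \<Rightarrow> ereal" where
  "hitting_time M W r b \<sigma> x h \<tau> \<pi> =
     Inf (ereal ` {t \<in> {0..\<tau>}. \<exists>X. wealth_solution M W r b \<sigma> x t \<pi> X \<and>
                                  prob_space.expectation M (X t) \<ge> x * h \<tau>})"

definition admissible ::
  "'w measure \<Rightarrow> (real \<Rightarrow> 'w \<Rightarrow> real^'d) \<Rightarrow> (real \<Rightarrow> real) \<Rightarrow> (real \<Rightarrow> real^'n) \<Rightarrow>
   (real \<Rightarrow> real^'d^'n) \<Rightarrow> real \<Rightarrow> (real \<Rightarrow> real) \<Rightarrow> real \<Rightarrow> (real \<Rightarrow> 'w \<Rightarrow> real^'n) \<Rightarrow> bool" where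
  "admissible M W r b \<sigma> x h \<tau> \<pi> \<longleftrightarrow>
     hitting_time M W r b \<sigma> x h \<tau> \<pi> < \<infinity> \<and>
     L2_adapted M W (real_of_ereal (hitting_time M W r b \<sigma> x h \<tau> \<pi>)) \<pi>"

text \<open>\<open>J(\<pi>) = Var(X\<^sup>\<pi>(\<tau>\<^sup>\<pi>))\<close>, meaningful for admissible \<open>\<pi>\<close>; the value does not depend on the
  version \<open>X\<close> of the wealth process.\<close>

definition cost ::
  "'w measure \<Rightarrow> (real \<Rightarrow> 'w \<Rightarrow> real^'d) \<Rightarrow> (real \<Rightarrow> real) \<Rightarrow> (real \<Rightarrow> real^'n) \<Rightarrow>
   (real \<Rightarrow> real^'d^'n) \<Rightarrow> real \<Rightarrow> (real \<Rightarrow> real) \<Rightarrow> real \<Rightarrow> (real \<Rightarrow> 'w \<Rightarrow> real^'n) \<Rightarrow> real" where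
  "cost M W r b \<sigma> x h \<tau> \<pi> =
     (let T = real_of_ereal (hitting_time M W r b \<sigma> x h \<tau> \<pi>)
      in THE v. \<exists>X. wealth_solution M W r b \<sigma> x T \<pi> X \<and> v = prob_space.variance M (X T))"

definition optimal_strategy ::
  "'w measure \<Rightarrow> (real \<Rightarrow> 'w \<Rightarrow> real^'d) \<Rightarrow> (real \<Rightarrow> real) \<Rightarrow> (real \<Rightarrow> real^'n) \<Rightarrow>
   (real \<Rightarrow> real^'d^'n) \<Rightarrow> real \<Rightarrow> (real \<Rightarrow> real) \<Rightarrow> (real \<Rightarrow> 'w \<Rightarrow> real^'n) \<Rightarrow> real \<Rightarrow> bool" where
  "optimal_strategy M W r b \<sigma> x h \<pi>' \<tau>' \<longleftrightarrow>
     0 < \<tau>' \<and> admissible M W r b \<sigma> x h \<tau>' \<pi>' \<and>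
     hitting_time M W r b \<sigma> x h \<tau>' \<pi>' = ereal \<tau>' \<and>
     (\<forall>\<tau>>0. \<forall>\<pi>. admissible M W r b \<sigma> x h \<tau> \<pi> \<longrightarrow>
        cost M W r b \<sigma> x h \<tau>' \<pi>' \<le> cost M W r b \<sigma> x h \<tau> \<pi>)"

section \<open>The mean-variance strategies\<close>

definition phi :: "(real \<Rightarrow> real) \<Rightarrow> (real \<Rightarrow> real^'n) \<Rightarrow> (real \<Rightarrow> real^'d^'n) \<Rightarrow> real \<Rightarrow> real" where
  "phi r b \<sigma> t = (excess r b t v* matrix_inv (cov \<sigma> t)) \<bullet> excess r b t"

definition mu ::
  "(real \<Rightarrow> real) \<Rightarrow> (real \<Rightarrow> real^'n) \<Rightarrow> (real \<Rightarrow> real^'d^'n) \<Rightarrow> real \<Rightarrow> (real \<Rightarrow> real) \<Rightarrow> real \<Rightarrow> real" where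
  "mu r b \<sigma> x h \<tau> = (exp (integral {0..\<tau>} (phi r b \<sigma>)) - 1) / (x * h \<tau> - x * accum r \<tau>)"

definition gamma ::
  "(real \<Rightarrow> real) \<Rightarrow> (real \<Rightarrow> real^'n) \<Rightarrow> (real \<Rightarrow> real^'d^'n) \<Rightarrow> real \<Rightarrow> (real \<Rightarrow> real) \<Rightarrow> real \<Rightarrow> real" where
  "gamma r b \<sigma> x h \<tau> =
     1 / mu r b \<sigma> x h \<tau> * exp (integral {0..\<tau>} (phi r b \<sigma>)) + x * accum r \<tau>"

text \<open>\<open>\<pi>\<close> is the strategy \<open>\<pi>\<^sub>\<tau>\<close> given in feedback form and \<open>X\<close> its wealth process on \<open>[0,\<tau>]\<close>,
  that is, \<open>X\<close> solves the closed-loop equation.\<close>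

definition feedback_solution ::
  "'w measure \<Rightarrow> (real \<Rightarrow> 'w \<Rightarrow> real^'d) \<Rightarrow> (real \<Rightarrow> real) \<Rightarrow> (real \<Rightarrow> real^'n) \<Rightarrow>
   (real \<Rightarrow> real^'d^'n) \<Rightarrow> real \<Rightarrow> (real \<Rightarrow> real) \<Rightarrow> real \<Rightarrow>
   (real \<Rightarrow> 'w \<Rightarrow> real^'n) \<Rightarrow> (real \<Rightarrow> 'w \<Rightarrow> real) \<Rightarrow> bool" where
  "feedback_solution M W r b \<sigma> x h \<tau> \<pi> X \<longleftrightarrow>
     wealth_solution M W r b \<sigma> x \<tau> \<pi> X \<and>
     (\<forall>t\<in>{0..\<tau>}. \<forall>\<omega>\<in>space M. \<pi> t \<omega> =
        (gamma r b \<sigma> x h \<tau> * exp (- integral {t..\<tau>} r) - X t \<omega>) *\<^sub>R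
          (excess r b t v* matrix_inv (cov \<sigma> t)))"

text \<open>\<open>h'\<close> is the derivative of \<open>h\<close> on \<open>[0,\<infinity>)\<close>.\<close>

definition theta :: "(real \<Rightarrow> real) \<Rightarrow> (real \<Rightarrow> real) \<Rightarrow> (real \<Rightarrow> real) \<Rightarrow> real \<Rightarrow> real" where
  "theta r h h' s = (2 * h' s - 2 * r s * accum r s) / (h s - accum r s)"

end

theory Submission
  imports Defs
begin

text \<open>
  Write \<open>A = accum r\<close> and \<open>\<Phi>(t)\<close> for the integral of \<open>\<phi>\<close> over \<open>[0,t]\<close>, and let
  \<open>v(t) = (x h(t) - x A(t))\<^sup>2 / (e\<^bsup>\<Phi>(t)\<^esup> - 1)\<close>. The varying terminal time model reduces to the minimization of
  this function of one real variable, for the following reasons.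

  Let \<open>N\<close> be the exponential martingale with \<open>N(0) = 1\<close> and \<open>dN = N \<lambda> dW\<close>, where \<open>\<lambda>\<close> is minus the
  market price of risk, so that \<open>|\<lambda>|\<^sup>2 = \<phi>\<close>. Along any wealth process the gain \<open>\<beta> \<pi>\<close> in the drift of
  \<open>N X\<close> cancels against the covariation of \<open>N\<close> and \<open>X\<close>, and \<open>E(N(t) X(t)) = x A(t)\<close> remains, whatever
  the strategy (\<open>wealth_density_pairing\<close>). As \<open>E N = 1\<close> and \<open>E N\<^sup>2 = e\<^bsup>\<Phi>\<^esup>\<close>, the Cauchy-Schwarz inequality
  bounds \<open>(E X(T) - x A(T))\<^sup>2\<close> by \<open>Var X(T) (e\<^bsup>\<Phi>(T)\<^esup> - 1)\<close> (\<open>variance_lower_bound\<close>). An admissible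
  strategy that is stopped at \<open>T \<le> \<tau>\<close> has mean wealth at least \<open>x h(\<tau>) \<ge> x h(T)\<close> there, because the
  mean is continuous and \<open>h\<close> is increasing, and so its cost is at least \<open>v(T)\<close>
  (\<open>admissible_cost_lower_bound\<close>).

  Equality in Cauchy-Schwarz requires wealth that is affine in \<open>N\<close>, and this is what the feedback
  strategies produce: their wealth is \<open>G + c N\<close> with deterministic \<open>G\<close> and \<open>c\<close>
  (\<open>closed_loop_solution\<close>), hence of variance \<open>v(\<tau>)\<close> at \<open>\<tau>\<close> (\<open>feedback_variance\<close>). Its mean increases
  strictly and reaches \<open>x h(\<tau>)\<close> exactly at \<open>\<tau>\<close>, so these strategies are stopped at \<open>\<tau>\<close>
  (\<open>feedback_hitting\<close>). Finally \<open>(log v)' = \<theta> - \<phi> e\<^bsup>\<Phi>\<^esup> / (e\<^bsup>\<Phi>\<^esup> - 1)\<close>. If \<open>\<theta> \<le> \<phi>\<close>, then \<open>v\<close> decreases strictly and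
  no finite time is optimal; if \<open>\<theta> > \<phi> + \<delta>\<close>, then \<open>v\<close> tends to infinity at \<open>0\<close> and at infinity, and
  attains its minimum.

  The stochastic calculus behind this is an \<open>L\<^sup>2\<close> theory. A process and its Ito integral are a pair in
  the closure of the elementary pairs (\<open>ito\<close>), and everything rests on two properties that pass to the
  closure: the polarized isometry (\<open>ito_isometry\<close>) and the orthogonality of the integral of a process
  that vanishes up to time \<open>s\<close> to the variables known at time \<open>s\<close> (\<open>ito_orthogonal_past\<close>). The
  martingale \<open>N\<close> is the limit of Euler products. Isometry and Gronwall make them Cauchy in \<open>L\<^sup>2\<close>, and
  the maximal inequality with the Borel-Cantelli lemma makes a subsequence converge uniformly on
  almost every path, so that \<open>N\<close> is continuous (\<open>exp_martingale_exists\<close>). An integration by parts, in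
  the form of Abel summation, gives the equation for \<open>c N\<close> (\<open>weighted_N_ito\<close>), and Gronwall's
  inequality gives the uniqueness of wealth processes (\<open>ws_unique\<close>).
\<close>

section \<open>Square-integrable functions\<close>

definition sqint :: "'a measure \<Rightarrow> ('a \<Rightarrow> 'b::euclidean_space) \<Rightarrow> bool" where
  "sqint m f \<longleftrightarrow> f \<in> borel_measurable m \<and> integrable m (\<lambda>x. (norm (f x))\<^sup>2)"

definition sqnorm :: "'a measure \<Rightarrow> ('a \<Rightarrow> 'b::euclidean_space) \<Rightarrow> real" where
  "sqnorm m f = (\<integral>x. (norm (f x))\<^sup>2 \<partial>m)"

lemma sqint_measurable [measurable_dest]: "sqint m f \<Longrightarrow> f \<in> borel_measurable m"
  by (simp add: sqint_def)

lemma sqnorm_nonneg [simp]: "0 \<le> sqnorm m f"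
  by (simp add: sqnorm_def)

lemma sqint_inner:
  assumes "sqint m f" "sqint m g"
  shows "integrable m (\<lambda>x. f x \<bullet> g x)"
proof (rule Bochner_Integration.integrable_bound)
  show "integrable m (\<lambda>x. (norm (f x))\<^sup>2 + (norm (g x))\<^sup>2)"
    using assms by (auto simp: sqint_def)
  show "(\<lambda>x. f x \<bullet> g x) \<in> borel_measurable m"
    using assms by (auto simp: sqint_def)
  have "norm (f x \<bullet> g x) \<le> norm ((norm (f x))\<^sup>2 + (norm (g x))\<^sup>2)" for x
  proof -
    have "\<bar>f x \<bullet> g x\<bar> \<le> norm (f x) * norm (g x)" by (rule Cauchy_Schwarz_ineq2)
    also have "\<dots> \<le> (norm (f x))\<^sup>2 + (norm (g x))\<^sup>2"
      using sum_squares_bound[of "norm (f x)" "norm (g x)"]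
        mult_nonneg_nonneg[OF norm_ge_zero norm_ge_zero, of "f x" "g x"] by linarith
    finally show ?thesis by simp
  qed
  then show "AE x in m. norm (f x \<bullet> g x) \<le> norm ((norm (f x))\<^sup>2 + (norm (g x))\<^sup>2)" by simp
qed

lemma sqint_mult:
  fixes f g :: "'a \<Rightarrow> real"
  assumes "sqint m f" "sqint m g"
  shows "integrable m (\<lambda>x. f x * g x)"
  using sqint_inner[OF assms] by simp

lemma sqint_bound:
  assumes "sqint m f" "g \<in> borel_measurable m" "AE x in m. norm (g x) \<le> C * norm (f x)"
  shows "sqint m g"
proof -
  have "integrable m (\<lambda>x. (norm (g x))\<^sup>2)"
  proof (rule Bochner_Integration.integrable_bound)
    show "integrable m (\<lambda>x. C\<^sup>2 * (norm (f x))\<^sup>2)"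
      using assms by (auto simp: sqint_def)
    show "AE x in m. norm ((norm (g x))\<^sup>2) \<le> norm (C\<^sup>2 * (norm (f x))\<^sup>2)"
      using assms(3)
    proof eventually_elim
      fix x assume "norm (g x) \<le> C * norm (f x)"
      then have "(norm (g x))\<^sup>2 \<le> (C * norm (f x))\<^sup>2" by (intro power_mono) auto
      then show "norm ((norm (g x))\<^sup>2) \<le> norm (C\<^sup>2 * (norm (f x))\<^sup>2)"
        by (simp add: power_mult_distrib)
    qed
  qed (use assms in auto)
  then show ?thesis using assms by (simp add: sqint_def)
qed

lemma sqint_zero [simp]: "sqint m (\<lambda>x. 0)"
  by (simp add: sqint_def)

lemma sqint_scaleR:
  assumes "sqint m f" shows "sqint m (\<lambda>x. c *\<^sub>R f x)"
  by (rule sqint_bound[OF assms, where C="\<bar>c\<bar>"]) (use assms in \<open>auto simp: sqint_def\<close>)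

lemma sqint_cmult:
  fixes f :: "'a \<Rightarrow> real"
  assumes "sqint m f" shows "sqint m (\<lambda>x. c * f x)"
  using sqint_scaleR[OF assms, of c] by simp

lemma norm_add_sq_le: "(norm (a + b))\<^sup>2 \<le> 2 * (norm a)\<^sup>2 + 2 * (norm (b::'a::real_normed_vector))\<^sup>2"
proof -
  have "(norm (a + b))\<^sup>2 \<le> (norm a + norm b)\<^sup>2" by (intro power_mono norm_triangle_ineq) auto
  also have "\<dots> \<le> 2 * (norm a)\<^sup>2 + 2 * (norm b)\<^sup>2"
    using sum_squares_bound[of "norm a" "norm b"] by (simp add: power2_sum)
  finally show ?thesis .
qed

lemma sqint_add:
  assumes "sqint m f" "sqint m g" shows "sqint m (\<lambda>x. f x + g x)"
proof -
  have "integrable m (\<lambda>x. (norm (f x + g x))\<^sup>2)"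
  proof (rule Bochner_Integration.integrable_bound)
    show "integrable m (\<lambda>x. 2 * (norm (f x))\<^sup>2 + 2 * (norm (g x))\<^sup>2)"
      using assms by (auto simp: sqint_def)
    show "AE x in m. norm ((norm (f x + g x))\<^sup>2) \<le> norm (2 * (norm (f x))\<^sup>2 + 2 * (norm (g x))\<^sup>2)"
      using norm_add_sq_le by (intro AE_I2) auto
  qed (use assms in \<open>auto simp: sqint_def\<close>)
  then show ?thesis using assms by (auto simp add: sqint_def)
qed

lemma sqint_minus: "sqint m f \<Longrightarrow> sqint m (\<lambda>x. - f x)"
  using sqint_scaleR[of m f "-1"] by simp

lemma sqint_diff:
  assumes "sqint m f" "sqint m g" shows "sqint m (\<lambda>x. f x - g x)"
  using sqint_add[OF assms(1) sqint_minus[OF assms(2)]] by simp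

lemma sqint_sum:
  assumes "\<And>i. i \<in> A \<Longrightarrow> sqint m (f i)" shows "sqint m (\<lambda>x. \<Sum>i\<in>A. f i x)"
  using assms by (induction A rule: infinite_finite_induct) (auto intro: sqint_add)

lemma sqnorm_add_le:
  assumes "sqint m f" "sqint m g"
  shows "sqnorm m (\<lambda>x. f x + g x) \<le> 2 * sqnorm m f + 2 * sqnorm m g"
proof -
  have "sqnorm m (\<lambda>x. f x + g x) \<le> (\<integral>x. 2 * (norm (f x))\<^sup>2 + 2 * (norm (g x))\<^sup>2 \<partial>m)"
    unfolding sqnorm_def using assms sqint_add[OF assms]
    by (intro integral_mono norm_add_sq_le) (auto simp: sqint_def)
  also have "\<dots> = 2 * sqnorm m f + 2 * sqnorm m g"
    using assms by (simp add: sqnorm_def sqint_def)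
  finally show ?thesis .
qed

lemma sqnorm_minus_commute: "sqnorm m (\<lambda>x. f x - g x) = sqnorm m (\<lambda>x. g x - f x)"
  by (simp add: sqnorm_def norm_minus_commute)

lemma sqnorm_triangle_le:
  assumes "sqint m f" "sqint m g" "sqint m k"
  shows "sqnorm m (\<lambda>x. f x - k x) \<le> 2 * sqnorm m (\<lambda>x. f x - g x) + 2 * sqnorm m (\<lambda>x. g x - k x)"
  using sqnorm_add_le[OF sqint_diff[OF assms(1,2)] sqint_diff[OF assms(2,3)]] by simp

lemma sqnorm_mono:
  assumes "sqint m f" "sqint m g" "AE x in m. norm (f x) \<le> norm (g x)"
  shows "sqnorm m f \<le> sqnorm m g"
  unfolding sqnorm_def
  using assms by (intro integral_mono_AE) (auto simp: sqint_def elim: AE_mp)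

lemma sqnorm_diff:
  assumes "sqint m f" "sqint m g"
  shows "sqnorm m (\<lambda>x. f x - g x) = sqnorm m f - 2 * (\<integral>x. f x \<bullet> g x \<partial>m) + sqnorm m g"
proof -
  have "(norm (f x - g x))\<^sup>2 = (norm (f x))\<^sup>2 - 2 * (f x \<bullet> g x) + (norm (g x))\<^sup>2" for x
    by (simp add: power2_norm_eq_inner inner_diff inner_commute)
  then show ?thesis using assms sqint_inner[OF assms] by (simp add: sqnorm_def sqint_def)
qed

lemma sqnorm_eq_inner: "sqnorm m f = (\<integral>x. f x \<bullet> f x \<partial>m)"
  by (simp add: sqnorm_def power2_norm_eq_inner)

lemma sqnorm_scaleR: "sqnorm m (\<lambda>x. c *\<^sub>R f x) = c\<^sup>2 * sqnorm m f"
  by (simp add: sqnorm_def power_mult_distrib)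

text \<open>
  The quadratic polynomial \<open>sqnorm m (f - c g)\<close> in \<open>c\<close> is nonnegative. Its value at the minimum
  \<open>c = \<langle>f,g\<rangle> / \<langle>g,g\<rangle>\<close> is the claim; if \<open>\<langle>g,g\<rangle> = 0\<close> the polynomial is affine, hence constant.
\<close>
lemma integral_Cauchy_Schwarz:
  assumes "sqint m f" "sqint m g"
  shows "(\<integral>x. f x \<bullet> g x \<partial>m)\<^sup>2 \<le> sqnorm m f * sqnorm m g"
proof -
  let ?B = "\<integral>x. f x \<bullet> g x \<partial>m"
  have q: "0 \<le> sqnorm m f - 2 * (c * ?B) + c\<^sup>2 * sqnorm m g" for c
  proof -
    have "0 \<le> sqnorm m (\<lambda>x. f x - c *\<^sub>R g x)" by simp
    also have "\<dots> = sqnorm m f - 2 * (\<integral>x. f x \<bullet> (c *\<^sub>R g x) \<partial>m) + c\<^sup>2 * sqnorm m g"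
      by (subst sqnorm_diff) (auto simp: assms sqint_scaleR sqnorm_scaleR)
    finally show ?thesis by simp
  qed
  show ?thesis
  proof (cases "sqnorm m g = 0")
    case True
    have "?B = 0"
    proof (rule ccontr)
      assume "?B \<noteq> 0"
      then show False using q[of "(sqnorm m f + 1) / (2 * ?B)"] True sqnorm_nonneg[of m f]
        by (simp add: field_simps)
    qed
    then show ?thesis using True by simp
  next
    case False
    then have "sqnorm m g > 0" using sqnorm_nonneg[of m g] by linarith
    then show ?thesis using q[of "?B / sqnorm m g"]
      by (simp add: field_simps power2_eq_square)
  qed
qed

text \<open>
  The device by which identities between inner products pass from approximations to their limits.
\<close>
lemma sqint_tendsto_inner:
  assumes f: "\<And>n. sqint m (f n)" "sqint m f'" "(\<lambda>n. sqnorm m (\<lambda>x. f n x - f' x)) \<longlonglongrightarrow> 0"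
    and g: "\<And>n. sqint m (g n)" "sqint m g'" "(\<lambda>n. sqnorm m (\<lambda>x. g n x - g' x)) \<longlonglongrightarrow> 0"
  shows "(\<lambda>n. \<integral>x. f n x \<bullet> g n x \<partial>m) \<longlonglongrightarrow> (\<integral>x. f' x \<bullet> g' x \<partial>m)"
proof -
  let ?a = "\<lambda>n x. f n x - f' x" and ?b = "\<lambda>n x. g n x - g' x"
  have a: "sqint m (?a n)" and b: "sqint m (?b n)" for n
    using f g by (auto intro: sqint_diff)
  have eq: "(\<integral>x. f n x \<bullet> g n x \<partial>m) = (\<integral>x. ?a n x \<bullet> ?b n x \<partial>m) + (\<integral>x. ?a n x \<bullet> g' x \<partial>m)
      + (\<integral>x. f' x \<bullet> ?b n x \<partial>m) + (\<integral>x. f' x \<bullet> g' x \<partial>m)" for n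
  proof -
    have "(\<integral>x. f n x \<bullet> g n x \<partial>m) = (\<integral>x. ?a n x \<bullet> ?b n x + ?a n x \<bullet> g' x + f' x \<bullet> ?b n x + f' x \<bullet> g' x \<partial>m)"
      by (rule Bochner_Integration.integral_cong) (auto simp: inner_diff)
    also have "\<dots> = (\<integral>x. ?a n x \<bullet> ?b n x \<partial>m) + (\<integral>x. ?a n x \<bullet> g' x \<partial>m)
      + (\<integral>x. f' x \<bullet> ?b n x \<partial>m) + (\<integral>x. f' x \<bullet> g' x \<partial>m)"
      using sqint_inner[OF a b, of n n] sqint_inner[OF a g(2), of n] sqint_inner[OF f(2) b, of n]
        sqint_inner[OF f(2) g(2)]
      by (subst Bochner_Integration.integral_add; simp?)+
    finally show ?thesis .
  qed
  have null: "(\<lambda>n. \<integral>x. u n x \<bullet> v n x \<partial>m) \<longlonglongrightarrow> 0"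
    if u: "\<And>n. sqint m (u n)" and v: "\<And>n. sqint m (v n)"
      and lim: "(\<lambda>n. sqnorm m (u n) * sqnorm m (v n)) \<longlonglongrightarrow> 0" for u v :: "nat \<Rightarrow> 'a \<Rightarrow> 'b"
  proof -
    have "(\<lambda>n. (\<integral>x. u n x \<bullet> v n x \<partial>m)\<^sup>2) \<longlonglongrightarrow> 0"
      by (rule tendsto_sandwich[OF _ _ tendsto_const lim])
        (use integral_Cauchy_Schwarz[OF u v] in auto)
    then have "(\<lambda>n. sqrt ((\<integral>x. u n x \<bullet> v n x \<partial>m)\<^sup>2)) \<longlonglongrightarrow> sqrt 0" by (rule tendsto_real_sqrt)
    then show ?thesis by (simp add: tendsto_rabs_zero_iff)
  qed
  have "(\<lambda>n. \<integral>x. ?a n x \<bullet> ?b n x \<partial>m) \<longlonglongrightarrow> 0"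
    using tendsto_mult[OF f(3) g(3)] by (intro null a b) simp
  moreover have "(\<lambda>n. \<integral>x. ?a n x \<bullet> g' x \<partial>m) \<longlonglongrightarrow> 0"
    using tendsto_mult[OF f(3) tendsto_const] by (intro null a g) simp
  moreover have "(\<lambda>n. \<integral>x. f' x \<bullet> ?b n x \<partial>m) \<longlonglongrightarrow> 0"
    using tendsto_mult[OF tendsto_const g(3)] by (intro null b f) simp
  ultimately show ?thesis
    unfolding eq by (auto intro!: tendsto_eq_intros)
qed

lemma sqint_nn_integralD:
  assumes "sqint m f" shows "(\<integral>\<^sup>+x. ennreal ((norm (f x))\<^sup>2) \<partial>m) = ennreal (sqnorm m f)"
  unfolding sqnorm_def using assms by (intro nn_integral_eq_integral) (auto simp: sqint_def)

lemma sqint_nn_integralI: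
  assumes "f \<in> borel_measurable m" "(\<integral>\<^sup>+x. ennreal ((norm (f x))\<^sup>2) \<partial>m) < \<infinity>"
  shows "sqint m f"
  unfolding sqint_def using assms by (intro conjI integrableI_bounded) auto

lemma sqnorm_zero_AE:
  assumes "sqint m f" "sqnorm m f = 0" shows "AE x in m. f x = 0"
proof -
  have "AE x in m. (norm (f x))\<^sup>2 = 0"
    using assms integral_nonneg_eq_0_iff_AE[of m "\<lambda>x. (norm (f x))\<^sup>2"]
    by (auto simp: sqnorm_def sqint_def)
  then show ?thesis by auto
qed

lemma sqint_cong_AE:
  assumes "sqint m f" "g \<in> borel_measurable m" "AE x in m. f x = g x" shows "sqint m g"
  by (rule sqint_bound[OF assms(1,2), where C=1]) (use assms(3) in \<open>auto elim: AE_mp\<close>)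

lemma sqnorm_cong_AE:
  assumes "AE x in m. f x = g x" "f \<in> borel_measurable m" "g \<in> borel_measurable m"
  shows "sqnorm m f = sqnorm m g"
  unfolding sqnorm_def by (rule integral_cong_AE) (use assms in \<open>auto elim: AE_mp\<close>)

lemma (in finite_measure) sqint_bounded:
  assumes "f \<in> borel_measurable M" "\<And>x. x \<in> space M \<Longrightarrow> norm (f x) \<le> B"
  shows "sqint M f"
proof -
  have "integrable M (\<lambda>x. (norm (f x))\<^sup>2)"
    by (rule integrable_const_bound[where B="B\<^sup>2"]) (use assms in \<open>auto intro!: AE_I2 power_mono\<close>)
  then show ?thesis using assms by (simp add: sqint_def)
qed

lemma (in finite_measure) sqint_const: "sqint M (\<lambda>x. c)"
  by (rule sqint_bounded[where B="norm c"]) auto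

lemma (in finite_measure) sqint_integrable:
  assumes "sqint M f" shows "integrable M f"
proof (rule Bochner_Integration.integrable_bound)
  show "integrable M (\<lambda>x. 1 + (norm (f x))\<^sup>2)" using assms by (simp add: sqint_def)
  have "norm (f x) \<le> 1 + (norm (f x))\<^sup>2" for x
    using sum_squares_bound[of 1 "norm (f x)"] norm_ge_zero[of "f x"]
    by (simp only: one_power2 mult_1_right)
  then show "AE x in M. norm (f x) \<le> norm (1 + (norm (f x))\<^sup>2)" by (auto intro!: AE_I2)
qed (use assms in \<open>simp add: sqint_def\<close>)

lemma sqint_component:
  fixes f :: "'a \<Rightarrow> real^'d" assumes "sqint m f" shows "sqint m (\<lambda>x. f x $ i)"
  by (rule sqint_bound[OF assms, where C=1]) (use assms in \<open>auto simp: sqint_def component_le_norm_cart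
        intro: borel_measurable_continuous_on[OF continuous_on_component]\<close>)

lemma sqnorm_add_tendsto_0:
  assumes "\<And>n. sqint m (f n)" "\<And>n. sqint m (g n)"
    "(\<lambda>n. sqnorm m (f n)) \<longlonglongrightarrow> 0" "(\<lambda>n. sqnorm m (g n)) \<longlonglongrightarrow> 0"
  shows "(\<lambda>n. sqnorm m (\<lambda>x. f n x + g n x)) \<longlonglongrightarrow> 0"
proof (rule tendsto_sandwich[OF _ _ tendsto_const])
  show "(\<lambda>n. 2 * sqnorm m (f n) + 2 * sqnorm m (g n)) \<longlonglongrightarrow> 0"
    using assms(3,4) by (auto intro!: tendsto_eq_intros)
  show "\<forall>\<^sub>F n in sequentially. sqnorm m (\<lambda>x. f n x + g n x) \<le> 2 * sqnorm m (f n) + 2 * sqnorm m (g n)"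
    by (intro always_eventually allI sqnorm_add_le assms)
qed auto

lemma sqnorm_sum_tendsto_0:
  assumes "finite A" "\<And>i n. i \<in> A \<Longrightarrow> sqint m (f i n)" "\<And>i. i \<in> A \<Longrightarrow> (\<lambda>n. sqnorm m (f i n)) \<longlonglongrightarrow> 0"
  shows "(\<lambda>n. sqnorm m (\<lambda>x. \<Sum>i\<in>A. f i n x)) \<longlonglongrightarrow> 0"
  using assms
proof (induction A rule: finite_induct)
  case empty then show ?case by (simp add: sqnorm_def)
next
  case (insert a A)
  then have "(\<lambda>n. sqnorm m (\<lambda>x. f a n x + (\<Sum>i\<in>A. f i n x))) \<longlonglongrightarrow> 0"
    by (intro sqnorm_add_tendsto_0) (auto intro!: sqint_sum)
  then show ?case using insert by simp
qed

text \<open>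
  Fatou's lemma, which turns almost sure convergence of a Cauchy sequence of \<open>L\<^sup>2\<close> into convergence in
  \<open>L\<^sup>2\<close>.
\<close>
lemma sqnorm_limit:
  fixes f :: "nat \<Rightarrow> 'a \<Rightarrow> real"
  assumes f: "\<And>l. sqint m (f l)" and g: "sqint m g"
    and le: "\<And>l. K \<le> l \<Longrightarrow> sqnorm m (\<lambda>x. g x - f l x) \<le> e"
    and lim: "AE x in m. (\<lambda>l. f l x) \<longlonglongrightarrow> f' x" and f': "f' \<in> borel_measurable m"
  shows "sqint m f'" "sqnorm m (\<lambda>x. g x - f' x) \<le> e"
proof -
  have e: "0 \<le> e" using le[of K] sqnorm_nonneg order_trans by blast
  have [measurable]: "g \<in> borel_measurable m" "\<And>l. f l \<in> borel_measurable m" using f g by (auto simp: sqint_def)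
  have "(\<integral>\<^sup>+x. ennreal ((norm (g x - f' x))\<^sup>2) \<partial>m) = (\<integral>\<^sup>+x. liminf (\<lambda>l. ennreal ((norm (g x - f l x))\<^sup>2)) \<partial>m)"
  proof (rule nn_integral_cong_AE)
    show "AE x in m. ennreal ((norm (g x - f' x))\<^sup>2) = liminf (\<lambda>l. ennreal ((norm (g x - f l x))\<^sup>2))"
      using lim
    proof eventually_elim
      fix x assume "(\<lambda>l. f l x) \<longlonglongrightarrow> f' x"
      then have "(\<lambda>l. ennreal ((norm (g x - f l x))\<^sup>2)) \<longlonglongrightarrow> ennreal ((norm (g x - f' x))\<^sup>2)"
        by (intro tendsto_intros tendsto_ennrealI)
      then show "ennreal ((norm (g x - f' x))\<^sup>2) = liminf (\<lambda>l. ennreal ((norm (g x - f l x))\<^sup>2))"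
        using lim_imp_Liminf[OF sequentially_bot] by force
    qed
  qed
  also have "\<dots> \<le> liminf (\<lambda>l. \<integral>\<^sup>+x. ennreal ((norm (g x - f l x))\<^sup>2) \<partial>m)"
    by (rule nn_integral_liminf) measurable
  also have "\<dots> \<le> ennreal e"
  proof (rule Liminf_le)
    show "\<forall>\<^sub>F l in sequentially. (\<integral>\<^sup>+x. ennreal ((norm (g x - f l x))\<^sup>2) \<partial>m) \<le> ennreal e"
      by (rule eventually_sequentiallyI[of K])
        (simp only: sqint_nn_integralD[OF sqint_diff[OF g f]], rule ennreal_leI, rule le)
  qed simp
  finally have nn: "(\<integral>\<^sup>+x. ennreal ((norm (g x - f' x))\<^sup>2) \<partial>m) \<le> ennreal e" .
  then have s: "sqint m (\<lambda>x. g x - f' x)"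
    using f' by (intro sqint_nn_integralI) (auto intro: le_less_trans)
  from sqint_diff[OF g this] show "sqint m f'" by simp
  show "sqnorm m (\<lambda>x. g x - f' x) \<le> e"
    using nn e unfolding sqint_nn_integralD[OF s] by simp
qed

section \<open>Gronwall and Volterra inequalities, calculus on intervals\<close>

lemma set_integral_power:
  assumes "0 \<le> (t::real)"
  shows "(LINT s:{0..t}|lborel. s ^ n) = t ^ Suc n / Suc n" "set_integrable lborel {0..t} (\<lambda>s. s ^ n)"
proof -
  have "has_bochner_integral lborel (\<lambda>x. x ^ n * indicator {0..t} x) (t ^ Suc n / Suc n - 0 ^ Suc n / Suc n)"
  proof (rule has_bochner_integral_FTC_Icc_real[OF assms])
    show "((\<lambda>x. x ^ Suc n / Suc n) has_real_derivative x ^ n) (at x)" for x :: real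
      by (rule DERIV_cong[OF DERIV_cdivide[OF DERIV_pow]]) (simp del: of_nat_Suc)
    show "isCont (\<lambda>x. x ^ n) x" for x :: real by (intro continuous_intros)
  qed
  then show "(LINT s:{0..t}|lborel. s ^ n) = t ^ Suc n / Suc n" "set_integrable lborel {0..t} (\<lambda>s. s ^ n)"
    by (auto simp: set_lebesgue_integral_def set_integrable_def has_bochner_integral_iff mult.commute)
qed

lemma set_integral_exp:
  assumes "0 \<le> (t::real)"
  shows "C * (LINT s:{0..t}|lborel. exp (C * s)) = exp (C * t) - 1" "set_integrable lborel {0..t} (\<lambda>s. exp (C * s))"
proof -
  have "has_bochner_integral lborel (\<lambda>x. (C * exp (C * x)) * indicator {0..t} x) (exp (C * t) - exp (C * 0))"
    by (rule has_bochner_integral_FTC_Icc_real[OF assms, where F="\<lambda>x. exp (C * x)"])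
      (auto intro!: derivative_eq_intros continuous_intros)
  then have "(LINT s|lborel. C * (exp (C * s) * indicator {0..t} s)) = exp (C * t) - 1"
    by (auto simp: has_bochner_integral_iff mult.assoc)
  then show "C * (LINT s:{0..t}|lborel. exp (C * s)) = exp (C * t) - 1"
    by (simp add: set_lebesgue_integral_def mult.commute)
  show "set_integrable lborel {0..t} (\<lambda>s. exp (C * s))"
    unfolding set_integrable_def
    by (intro borel_integrable_compact continuous_intros) auto
qed

text \<open>
  Iterating the hypothesis \<open>n\<close> times leaves the first terms of the exponential series and a remainder
  \<open>B (C t)\<^sup>n / n!\<close>. Continuity of \<open>u\<close> is not at hand for second moments of processes, so the argument
  avoids the differentiation of the integral.
\<close>
lemma gronwall:
  fixes u :: "real \<Rightarrow> real"
  assumes int: "set_integrable lborel {0..T} u" and C: "0 \<le> C" and \<epsilon>: "0 \<le> \<epsilon>"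
    and le: "\<And>t. 0 \<le> t \<Longrightarrow> t \<le> T \<Longrightarrow> u t \<le> \<epsilon> + C * (LINT s:{0..t}|lborel. u s)"
    and t: "0 \<le> t" "t \<le> T"
  shows "u t \<le> \<epsilon> * exp (C * t)"
proof -
  \<comment> \<open>a bound for \<open>u\<close>, the start of the iteration\<close>
  define B where "B = \<epsilon> + C * (LINT s:{0..T}|lborel. \<bar>u s\<bar>)"
  have intt: "set_integrable lborel {0..t} u" if "t \<le> T" for t
    by (rule set_integrable_subset[OF int]) (use that in auto)
  have "0 \<le> (LINT s:{0..T}|lborel. \<bar>u s\<bar>)"
    unfolding set_lebesgue_integral_def by (intro integral_nonneg_AE AE_I2) auto
  then have B0: "0 \<le> B" unfolding B_def using C \<epsilon> by simp
  have bound: "u t \<le> B" if "0 \<le> t" "t \<le> T" for t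
  proof -
    have "(LINT s:{0..t}|lborel. u s) \<le> (LINT s:{0..T}|lborel. \<bar>u s\<bar>)"
      unfolding set_lebesgue_integral_def
      using intt[OF that(2)] set_integrable_abs[OF int] that
      by (intro integral_mono) (auto simp: set_integrable_def indicator_def abs_mult)
    then show ?thesis using le[OF that] mult_left_mono[OF _ C] by (fastforce simp: B_def)
  qed
  have key: "\<forall>t\<in>{0..T}. u t \<le> \<epsilon> * exp (C * t) + B * ((C * t) ^ n / fact n)" for n
  proof (induction n)
    case 0
    have "\<epsilon> * exp (C * t) \<ge> 0" for t using \<epsilon> by simp
    then show ?case using bound by (auto intro: add_increasing)
  next
    case (Suc n)
    show ?case
    proof
      fix t assume t: "t \<in> {0..T}"
      then have t0: "0 \<le> t" "t \<le> T" by auto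
      let ?g = "\<lambda>s. \<epsilon> * exp (C * s) + B * C ^ n / fact n * s ^ n"
      have i1: "set_integrable lborel {0..t} (\<lambda>s. \<epsilon> * exp (C * s))"
        by (intro set_integrable_mult_right set_integral_exp t0)
      have i2: "set_integrable lborel {0..t} (\<lambda>s. B * C ^ n / fact n * s ^ n)"
        by (intro set_integrable_mult_right set_integral_power t0)
      have "(LINT s:{0..t}|lborel. u s) \<le> (LINT s:{0..t}|lborel. ?g s)"
      proof (rule set_integral_mono[OF intt[OF t0(2)] set_integral_add(1)[OF i1 i2]])
        fix s assume "s \<in> {0..t}"
        then have "u s \<le> \<epsilon> * exp (C * s) + B * ((C * s) ^ n / fact n)" using Suc t0 by auto
        then show "u s \<le> ?g s" by (simp add: power_mult_distrib mult.assoc)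
      qed
      also have "\<dots> = \<epsilon> * (LINT s:{0..t}|lborel. exp (C * s)) + B * C ^ n / fact n * (t ^ Suc n / Suc n)"
        using set_integral_power(1)[OF t0(1), of n] by (subst set_integral_add(2)[OF i1 i2]) simp
      finally have "u t \<le> \<epsilon> + C * (\<epsilon> * (LINT s:{0..t}|lborel. exp (C * s)) + B * C ^ n / fact n * (t ^ Suc n / Suc n))"
        using le[OF t0] mult_left_mono[OF _ C] by fastforce
      also have "\<dots> = \<epsilon> + \<epsilon> * (C * (LINT s:{0..t}|lborel. exp (C * s))) + B * ((C * t) ^ Suc n / fact (Suc n))"
        by (simp add: field_simps power_mult_distrib)
      also have "\<dots> = \<epsilon> * exp (C * t) + B * ((C * t) ^ Suc n / fact (Suc n))"
        unfolding set_integral_exp(1)[OF t0(1)] by (simp add: algebra_simps)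
      finally show "u t \<le> \<epsilon> * exp (C * t) + B * ((C * t) ^ Suc n / fact (Suc n))" .
    qed
  qed
  have "(\<lambda>n. (C * t) ^ n / fact n) \<longlonglongrightarrow> 0"
    using summable_LIMSEQ_zero[OF summable_exp[of "C * t"]] by (simp add: field_simps)
  then have "(\<lambda>n. \<epsilon> * exp (C * t) + B * ((C * t) ^ n / fact n)) \<longlonglongrightarrow> \<epsilon> * exp (C * t) + B * 0"
    by (intro tendsto_intros)
  then have "u t \<le> \<epsilon> * exp (C * t) + B * 0"
    by (rule LIMSEQ_le_const) (use key t in auto)
  then show ?thesis by simp
qed

text \<open>
  Gronwall's inequality for \<open>|u - v|\<close>. Moments of processes are found by exhibiting a solution of the
  integral equation that they satisfy.
\<close>
lemma volterra_unique:
  fixes u v a :: "real \<Rightarrow> real"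
  assumes int: "set_integrable lborel {0..T} u" "set_integrable lborel {0..T} v"
    and a: "set_borel_measurable lborel {0..T} a" "\<And>t. 0 \<le> t \<Longrightarrow> t \<le> T \<Longrightarrow> \<bar>a t\<bar> \<le> C"
    and u: "\<And>t. 0 \<le> t \<Longrightarrow> t \<le> T \<Longrightarrow> u t = c + (LINT s:{0..t}|lborel. a s * u s)"
    and v: "\<And>t. 0 \<le> t \<Longrightarrow> t \<le> T \<Longrightarrow> v t = c + (LINT s:{0..t}|lborel. a s * v s)"
    and t: "0 \<le> t" "t \<le> T"
  shows "u t = v t"
proof -
  define d where "d s = \<bar>u s - v s\<bar>" for s
  have C: "0 \<le> C" using a(2)[of t] t by simp
  have intd: "set_integrable lborel {0..T} d"
    unfolding d_def by (intro set_integrable_abs set_integral_diff(1) int)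
  have aw: "set_integrable lborel {0..t} (\<lambda>s. a s * w s)" if w: "set_integrable lborel {0..T} w" and "t \<le> T" for w t
  proof -
    have "set_integrable lborel {0..T} (\<lambda>s. a s * w s)"
      unfolding set_integrable_def
    proof (rule Bochner_Integration.integrable_bound)
      show "integrable lborel (\<lambda>s. C * (indicator {0..T} s *\<^sub>R w s))"
        using w by (auto simp: set_integrable_def)
      have "(\<lambda>s. (indicator {0..T} s *\<^sub>R a s) * (indicator {0..T} s *\<^sub>R w s)) \<in> borel_measurable lborel"
        using w a(1) by (intro borel_measurable_times) (auto simp: set_integrable_def set_borel_measurable_def)
      also have "(\<lambda>s. (indicator {0..T} s *\<^sub>R a s) * (indicator {0..T} s *\<^sub>R w s)) = (\<lambda>s. indicator {0..T} s *\<^sub>R (a s * w s))"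
        by (auto simp: indicator_def)
      finally show "(\<lambda>s. indicator {0..T} s *\<^sub>R (a s * w s)) \<in> borel_measurable lborel" .
      show "AE s in lborel. norm (indicator {0..T} s *\<^sub>R (a s * w s)) \<le> norm (C * (indicator {0..T} s *\<^sub>R w s))"
        using a(2) C by (intro AE_I2) (auto simp: indicator_def abs_mult intro!: mult_right_mono)
    qed
    then show ?thesis by (rule set_integrable_subset) (use that in auto)
  qed
  have "d t \<le> 0 * exp (C * t)"
  proof (rule gronwall[OF intd C order_refl _ t])
    fix t assume t: "0 \<le> t" "t \<le> T"
    have it: "set_integrable lborel {0..t} (\<lambda>s. a s * u s - a s * v s)"
      by (intro set_integral_diff aw int t)
    have "u t - v t = (LINT s:{0..t}|lborel. a s * u s - a s * v s)"
      using u[OF t] v[OF t] set_integral_diff(2)[OF aw[OF int(1) t(2)] aw[OF int(2) t(2)]] by simp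
    then have "d t \<le> (LINT s:{0..t}|lborel. \<bar>a s * u s - a s * v s\<bar>)"
      unfolding d_def using integral_abs_bound[of lborel "\<lambda>s. indicator {0..t} s *\<^sub>R (a s * u s - a s * v s)"]
      by (simp add: set_lebesgue_integral_def abs_mult)
    also have "\<dots> \<le> (LINT s:{0..t}|lborel. C * d s)"
    proof (rule set_integral_mono[OF set_integrable_abs[OF it]])
      show "set_integrable lborel {0..t} (\<lambda>s. C * d s)"
        by (intro set_integrable_mult_right set_integrable_subset[OF intd]) (use t in auto)
      fix s assume "s \<in> {0..t}"
      then show "\<bar>a s * u s - a s * v s\<bar> \<le> C * d s"
        using a(2)[of s] t by (auto simp: d_def right_diff_distrib[symmetric] abs_mult intro!: mult_right_mono)
    qed
    finally show "d t \<le> 0 + C * (LINT s:{0..t}|lborel. d s)" by simp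
  qed
  then show ?thesis by (simp add: d_def)
qed

lemma set_integral_FTC:
  fixes f Fn :: "real \<Rightarrow> real"
  assumes "0 \<le> t" "continuous_on {0..t} f"
    "\<And>s. 0 \<le> s \<Longrightarrow> s \<le> t \<Longrightarrow> (Fn has_real_derivative f s) (at s within {0..t})"
  shows "(LINT s:{0..t}|lborel. f s) = Fn t - Fn 0"
  unfolding set_lebesgue_integral_def
  using integral_FTC_atLeastAtMost[OF assms(1) _ assms(2), of Fn] assms(3)
  by (simp add: has_real_derivative_iff_has_vector_derivative)

lemma set_integrable_continuous:
  fixes f :: "real \<Rightarrow> real"
  assumes "continuous_on {0..t} f" shows "set_integrable lborel {0..t} f"
  unfolding set_integrable_def by (rule borel_integrable_compact[OF compact_Icc assms])

lemma continuous_Icc_bound: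
  fixes a :: "real \<Rightarrow> 'b::real_normed_vector"
  assumes "continuous_on {0..T} a" shows "\<exists>A. \<forall>s. 0 \<le> s \<longrightarrow> s \<le> T \<longrightarrow> norm (a s) \<le> A"
proof -
  have "bounded (a ` {0..T})"
    by (rule compact_imp_bounded[OF compact_continuous_image[OF assms compact_Icc]])
  then obtain A where "\<forall>y\<in>a ` {0..T}. norm y \<le> A" unfolding bounded_iff by blast
  then show ?thesis by (intro exI[of _ A]) auto
qed

lemma exp_integral_has_derivative:
  assumes "continuous_on {0..T} A" "0 \<le> s" "s \<le> T"
  shows "((\<lambda>t. exp (integral {0..t} A)) has_real_derivative A s * exp (integral {0..s} A)) (at s within {0..T})"
  using integral_has_real_derivative[OF assms(1), of s] assms(2,3) by (auto intro!: derivative_eq_intros)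

section \<open>Processes as functions of time and outcome\<close>

text \<open>
  Processes on different time intervals become functions on one measure space when they are extended
  by zero; inner products of integrands with different horizons then need no bookkeeping.
\<close>
definition cutoff :: "real \<Rightarrow> (real \<Rightarrow> 'w \<Rightarrow> 'b::euclidean_space) \<Rightarrow> real \<times> 'w \<Rightarrow> 'b" where
  "cutoff T g = (\<lambda>(u, \<omega>). indicator {0..T} u *\<^sub>R g u \<omega>)"

lemma cutoff_measurable:
  assumes "(\<lambda>(t, \<omega>). g t \<omega>) \<in> borel_measurable (restrict_space borel {0..T} \<Otimes>\<^sub>M M)"
  shows "cutoff T g \<in> borel_measurable (lborel \<Otimes>\<^sub>M M)"
proof -
  let ?\<Omega> = "{0..T} \<times> space M"
  let ?R = "restrict_space (borel \<Otimes>\<^sub>M M) ?\<Omega>"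
  have fst: "fst \<in> measurable ?R (restrict_space borel {0..T})"
    by (rule measurable_restrict_space2) (auto simp: space_restrict_space intro: measurable_restrict_space1)
  have snd: "snd \<in> measurable ?R M"
    by (intro measurable_restrict_space1 measurable_snd)
  have "(\<lambda>z. (fst z, snd z)) \<in> measurable ?R (restrict_space borel {0..T} \<Otimes>\<^sub>M M)"
    by (rule measurable_Pair[OF fst snd])
  from measurable_compose[OF this assms]
  have "(\<lambda>z. g (fst z) (snd z)) \<in> borel_measurable ?R" by (simp add: split_beta')
  then have "(\<lambda>z. indicator ?\<Omega> z *\<^sub>R g (fst z) (snd z)) \<in> borel_measurable (borel \<Otimes>\<^sub>M M)"
    by (subst (asm) borel_measurable_restrict_space_iff) auto
  then have "(\<lambda>z. indicator ?\<Omega> z *\<^sub>R g (fst z) (snd z)) \<in> borel_measurable (lborel \<Otimes>\<^sub>M M)"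
    by (simp cong: measurable_cong_sets sets_pair_measure_cong)
  then show ?thesis
    by (rule measurable_cong[THEN iffD1, rotated]) (auto simp: cutoff_def indicator_def space_pair_measure)
qed

lemma restrict_measurable_mono:
  assumes "(\<lambda>(t, \<omega>). g t \<omega>) \<in> borel_measurable (restrict_space borel {0..T} \<Otimes>\<^sub>M M)" "S \<le> T"
  shows "(\<lambda>(t, \<omega>). g t \<omega>) \<in> borel_measurable (restrict_space borel {0..S::real} \<Otimes>\<^sub>M M)"
proof -
  let ?R = "restrict_space borel {0..S} \<Otimes>\<^sub>M M"
  have "(\<lambda>z. (fst z, snd z)) \<in> measurable ?R (restrict_space borel {0..T} \<Otimes>\<^sub>M M)"
  proof (rule measurable_Pair)
    show "fst \<in> measurable ?R (restrict_space borel {0..T})"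
    proof (rule measurable_restrict_space2)
      show "fst \<in> space ?R \<rightarrow> {0..T}"
        using assms(2) by (auto simp: space_pair_measure space_restrict_space)
      show "fst \<in> borel_measurable ?R"
        by (rule measurable_compose[OF measurable_fst]) (rule measurable_restrict_space1, simp)
    qed
  qed simp
  from measurable_compose[OF this assms(1)] show ?thesis by (simp add: split_beta')
qed

text \<open>
  The process is the limit of its values at the grid points below \<open>t\<close>, and a function of a countable
  parameter is measurable as soon as each of its sections is.
\<close>
lemma continuous_process_measurable:
  fixes X :: "real \<Rightarrow> 'w \<Rightarrow> 'b::{metric_space}"
  assumes T: "0 \<le> T" and c: "\<And>\<omega>. \<omega> \<in> space M \<Longrightarrow> continuous_on {0..T} (\<lambda>t. X t \<omega>)"
    and m: "\<And>t. 0 \<le> t \<Longrightarrow> t \<le> T \<Longrightarrow> X t \<in> borel_measurable M"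
  shows "(\<lambda>(t, \<omega>). X t \<omega>) \<in> borel_measurable (restrict_space borel {0..T} \<Otimes>\<^sub>M M)"
proof -
  let ?R = "restrict_space borel {0..T} \<Otimes>\<^sub>M M"
  define j where "j n t = nat \<lfloor>t * real (Suc n)\<rfloor>" for n :: nat and t :: real
  define d where "d n t = min T (real (j n t) / real (Suc n))" for n t
  have lim: "(\<lambda>n. d n t) \<longlonglongrightarrow> t" if t: "0 \<le> t" "t \<le> T" for t
  proof (rule tendsto_sandwich)
    have *: "t - 1 / real (Suc n) \<le> d n t \<and> d n t \<le> t" for n
    proof -
      have j: "real (j n t) = of_int \<lfloor>t * real (Suc n)\<rfloor>" using t by (simp add: j_def)
      have "of_int \<lfloor>t * real (Suc n)\<rfloor> \<le> t * real (Suc n)" "t * real (Suc n) - 1 \<le> of_int \<lfloor>t * real (Suc n)\<rfloor>" by linarith+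
      then have "real (j n t) / real (Suc n) \<le> t" "t - 1 / real (Suc n) \<le> real (j n t) / real (Suc n)"
        unfolding j
      proof -
        assume a: "of_int \<lfloor>t * real (Suc n)\<rfloor> \<le> t * real (Suc n)" "t * real (Suc n) - 1 \<le> of_int \<lfloor>t * real (Suc n)\<rfloor>"
        have "t = t * real (Suc n) / real (Suc n)" "t - 1 / real (Suc n) = (t * real (Suc n) - 1) / real (Suc n)"
          by (simp_all add: diff_divide_distrib del: of_nat_Suc)
        then show "of_int \<lfloor>t * real (Suc n)\<rfloor> / real (Suc n) \<le> t"
          "t - 1 / real (Suc n) \<le> of_int \<lfloor>t * real (Suc n)\<rfloor> / real (Suc n)"
          using divide_right_mono[OF a(1), of "real (Suc n)"] divide_right_mono[OF a(2), of "real (Suc n)"]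
          by (simp_all del: of_nat_Suc)
      qed
      moreover have "t - 1 / real (Suc n) \<le> T" using t by (smt (verit) divide_nonneg_nonneg of_nat_0_le_iff)
      ultimately show ?thesis using t by (simp add: d_def)
    qed
    show "\<forall>\<^sub>F n in sequentially. t - 1 / real (Suc n) \<le> d n t" "\<forall>\<^sub>F n in sequentially. d n t \<le> t"
      using * by (auto intro: always_eventually)
    show "(\<lambda>n. t - 1 / real (Suc n)) \<longlonglongrightarrow> t"
      using tendsto_diff[OF tendsto_const LIMSEQ_inverse_real_of_nat, of t] by (simp add: inverse_eq_divide)
  qed auto
  have fst: "fst \<in> borel_measurable ?R"
    by (rule measurable_compose[OF measurable_fst]) (rule measurable_restrict_space1, simp)
  show ?thesis
  proof (rule borel_measurable_LIMSEQ_metric)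
    fix n
    have "(\<lambda>z. X (min T (real i / real (Suc n))) (snd z)) \<in> borel_measurable ?R" for i
      by (rule measurable_compose[OF measurable_snd m]) (use T in auto)
    moreover have "(\<lambda>z. j n (fst z)) \<in> measurable ?R (count_space UNIV)"
      unfolding j_def using fst by measurable
    ultimately have "(\<lambda>z. X (min T (real (j n (fst z)) / real (Suc n))) (snd z)) \<in> borel_measurable ?R"
      by (rule measurable_compose_countable)
    then show "(\<lambda>z. X (d n (fst z)) (snd z)) \<in> borel_measurable ?R" by (simp add: d_def)
  next
    fix z assume "z \<in> space ?R"
    then have z: "0 \<le> fst z" "fst z \<le> T" "snd z \<in> space M" by (auto simp: space_pair_measure space_restrict_space)
    have "(\<lambda>n. X (d n (fst z)) (snd z)) \<longlonglongrightarrow> X (fst z) (snd z)"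
      by (rule continuous_on_tendsto_compose[OF c[OF z(3)] lim[OF z(1,2)]])
        (use z T in \<open>auto simp: d_def intro!: always_eventually\<close>)
    then show "(\<lambda>n. X (d n (fst z)) (snd z)) \<longlonglongrightarrow> (case z of (t, \<omega>) \<Rightarrow> X t \<omega>)" by (simp add: split_beta')
  qed
qed

section \<open>Brownian increments\<close>

locale brownian = prob_space M for M :: "'w measure" +
  fixes W :: "real \<Rightarrow> 'w \<Rightarrow> real^'d"
  assumes BM: "brownian_motion M W"
begin

abbreviation F :: "real \<Rightarrow> 'w measure" where "F \<equiv> filt M W"

lemma W_measurable [measurable]: "0 \<le> t \<Longrightarrow> W t \<in> borel_measurable M"
  using BM by (auto simp: brownian_motion_def)

lemma filt_generators: "{W s -` B \<inter> space M | s B. 0 \<le> s \<and> s \<le> t \<and> B \<in> sets borel} \<union> null_sets M \<subseteq> sets M"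
  by (auto intro: measurable_sets)

lemma sets_filt: "sets (F t) = sigma_sets (space M)
    ({W s -` B \<inter> space M | s B. 0 \<le> s \<and> s \<le> t \<and> B \<in> sets borel} \<union> null_sets M)"
  unfolding filt_def
  by (rule sets_measure_of) (use filt_generators[of t] sets.sets_into_space in blast)

lemma space_filt [simp]: "space (F t) = space M"
  unfolding filt_def by (rule space_measure_of_conv)

lemma sets_filt_subset: "sets (F t) \<subseteq> sets M"
  unfolding sets_filt by (rule sets.sigma_sets_subset[OF filt_generators])

lemma sets_filt_mono: "s \<le> t \<Longrightarrow> sets (F s) \<subseteq> sets (F t)"
  unfolding sets_filt by (rule sigma_sets_mono') fastforce

text \<open>
  Null sets belong to the filtration at every time, hence redefining a process on a null set keeps it
  adapted.
\<close>
lemma null_sets_filt: "N \<in> null_sets M \<Longrightarrow> N \<in> sets (F t)"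
  unfolding sets_filt by (auto intro: sigma_sets.Basic)

lemma filt_measurable: "f \<in> borel_measurable (F t) \<Longrightarrow> f \<in> borel_measurable M"
  using sets_filt_subset by (auto simp: measurable_def)

lemma filt_measurable_mono: "f \<in> borel_measurable (F s) \<Longrightarrow> s \<le> t \<Longrightarrow> f \<in> borel_measurable (F t)"
  using sets_filt_mono by (fastforce simp: measurable_def)

lemma W_filt_measurable: "0 \<le> s \<Longrightarrow> s \<le> t \<Longrightarrow> W s \<in> borel_measurable (F t)"
  unfolding measurable_def sets_filt by (auto intro!: sigma_sets.Basic)

text \<open>
  Independence is given for the sigma algebra \<open>F s\<close> and the preimages of Borel sets under the
  increment; functions of either side generate smaller families.
\<close>
lemma indep_var_increment:
  fixes Z :: "'w \<Rightarrow> real" and g :: "real^'d \<Rightarrow> real"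
  assumes "0 \<le> s" "s < t" "Z \<in> borel_measurable (F s)" "g \<in> borel_measurable borel"
  shows "indep_var borel Z borel (\<lambda>\<omega>. g (W t \<omega> - W s \<omega>))"
proof -
  have ind: "indep_set (sets (F s)) {(\<lambda>\<omega>. W t \<omega> - W s \<omega>) -` B \<inter> space M | B. B \<in> sets borel}"
    using BM assms(1,2) by (auto simp: brownian_motion_def)
  have [measurable]: "Z \<in> borel_measurable M" "g \<in> borel_measurable borel"
    using filt_measurable assms by auto
  have [measurable]: "W t \<in> borel_measurable M" "W s \<in> borel_measurable M"
    using assms by auto
  have sub1: "sigma_sets (space M) {Z -` A \<inter> space M |A. A \<in> sets borel} \<subseteq> sets (F s)"
  proof -
    have "{Z -` A \<inter> space M |A. A \<in> sets borel} \<subseteq> sets (F s)"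
      using measurable_sets[OF assms(3)] by auto
    from sets.sigma_sets_subset[OF this] show ?thesis by simp
  qed
  let ?D = "\<lambda>\<omega>. W t \<omega> - W s \<omega>"
  have sub2: "sigma_sets (space M) {(\<lambda>\<omega>. g (?D \<omega>)) -` A \<inter> space M |A. A \<in> sets borel}
      \<subseteq> {?D -` B \<inter> space M | B. B \<in> sets borel}"
  proof -
    have "{(\<lambda>\<omega>. g (?D \<omega>)) -` A \<inter> space M |A. A \<in> sets borel} \<subseteq> {?D -` B \<inter> space M | B. B \<in> sets borel}"
    proof safe
      fix A :: "real set" assume "A \<in> sets borel"
      then have "g -` A \<in> sets borel" using measurable_sets[OF assms(4)] by simp
      then show "\<exists>B. (\<lambda>\<omega>. g (?D \<omega>)) -` A \<inter> space M = ?D -` B \<inter> space M \<and> B \<in> sets borel"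
        by (intro exI[of _ "g -` A"]) auto
    qed
    moreover have "{?D -` B \<inter> space M | B. B \<in> sets borel} = sets (vimage_algebra (space M) ?D borel)"
      by (simp add: sets_vimage_algebra2)
    ultimately show ?thesis
      using sets.sigma_sets_subset[of _ "vimage_algebra (space M) ?D borel"] by (simp only: space_vimage_algebra)
  qed
  show ?thesis
    unfolding indep_var_eq
  proof (intro conjI)
    show "indep_set (sigma_sets (space M) {Z -` A \<inter> space M |A. A \<in> sets borel})
     (sigma_sets (space M) {(\<lambda>\<omega>. g (W t \<omega> - W s \<omega>)) -` A \<inter> space M |A. A \<in> sets borel})"
      using ind unfolding indep_set_def
      by (rule indep_sets_mono_sets) (use sub1 sub2 in \<open>auto split: bool.split\<close>)
  qed measurable
qed

lemma increment_moments:
  assumes "0 \<le> s" "s < t"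
  defines "D \<equiv> \<lambda>i \<omega>. (W t \<omega> - W s \<omega>) $ i"
  shows "integrable M (D i)" "expectation (D i) = 0"
    "integrable M (\<lambda>\<omega>. D i \<omega> * D j \<omega>)"
    "expectation (\<lambda>\<omega>. D i \<omega> * D j \<omega>) = (if i = j then t - s else 0)"
proof -
  have pos: "0 < sqrt (t - s)" using assms by simp
  have dist: "distributed M lborel (D i) (normal_density 0 (sqrt (t - s)))" for i
    using BM assms unfolding brownian_motion_def D_def by blast
  have int: "integrable M (D i)" for i
    using distributed_integrable[OF dist, of "\<lambda>x. x"] integrable_normal_moment_nz_1[OF pos] by simp
  then show "integrable M (D i)" .
  have E: "expectation (D i) = 0" for i
    using distributed_integral[OF dist, of "\<lambda>x. x"] integral_normal_moment_nz_1[OF pos] by simp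
  then show "expectation (D i) = 0" .
  have ii: "integrable M (\<lambda>\<omega>. D i \<omega> * D i \<omega>)" for i
    using distributed_integrable[OF dist, of "\<lambda>x. x * x"] integrable_normal_moment[OF pos, of 0 2]
    by (simp add: power2_eq_square)
  have Eii: "expectation (\<lambda>\<omega>. D i \<omega> * D i \<omega>) = t - s" for i
    using distributed_integral[OF dist, of "\<lambda>x. x * x"] integral_normal_moment_even[OF pos, of 0 1] assms
    by (simp add: power2_eq_square)
  have ind: "indep_vars (\<lambda>_. borel) D UNIV"
    using BM assms unfolding brownian_motion_def D_def by blast
  have neq: "integrable M (\<lambda>\<omega>. D i \<omega> * D j \<omega>) \<and> expectation (\<lambda>\<omega>. D i \<omega> * D j \<omega>) = 0" if "i \<noteq> j"
  proof -
    have "indep_vars (\<lambda>_. borel) D {i, j}"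
      using ind by (rule indep_vars_subset) simp
    then show ?thesis
      using indep_vars_integrable[of "{i, j}" D] indep_vars_lebesgue_integral[of "{i, j}" D] int E that
      by simp
  qed
  show "integrable M (\<lambda>\<omega>. D i \<omega> * D j \<omega>)"
    "expectation (\<lambda>\<omega>. D i \<omega> * D j \<omega>) = (if i = j then t - s else 0)"
    using neq ii Eii by auto
qed

definition L2F :: "real \<Rightarrow> ('w \<Rightarrow> 'b::euclidean_space) \<Rightarrow> bool" where
  "L2F s \<xi> \<longleftrightarrow> \<xi> \<in> borel_measurable (F s) \<and> sqint M \<xi>"

lemma L2F_mono: "L2F s \<xi> \<Longrightarrow> s \<le> t \<Longrightarrow> L2F t \<xi>"
  using filt_measurable_mono by (auto simp: L2F_def)

lemma L2F_sqint: "L2F s \<xi> \<Longrightarrow> sqint M \<xi>"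
  by (simp add: L2F_def)

lemma L2F_add: "L2F s \<xi> \<Longrightarrow> L2F s \<eta> \<Longrightarrow> L2F s (\<lambda>\<omega>. \<xi> \<omega> + \<eta> \<omega>)"
  by (auto simp: L2F_def sqint_add)

lemma L2F_scaleR: "L2F s \<xi> \<Longrightarrow> L2F s (\<lambda>\<omega>. c *\<^sub>R \<xi> \<omega>)"
  by (auto simp: L2F_def sqint_scaleR)

lemma L2F_scaleR_const: "L2F s \<xi> \<Longrightarrow> L2F s (\<lambda>\<omega>. \<xi> \<omega> *\<^sub>R (v::'b::euclidean_space))"
  unfolding L2F_def by (auto intro: sqint_bound[where C="norm v" and f=\<xi>] simp: mult.commute sqint_measurable)

lemma L2F_diff: "L2F s \<xi> \<Longrightarrow> L2F s \<eta> \<Longrightarrow> L2F s (\<lambda>\<omega>. \<xi> \<omega> - \<eta> \<omega>)"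
  by (auto simp: L2F_def sqint_diff)

lemma L2F_const: "L2F s (\<lambda>\<omega>. c)"
  by (simp add: L2F_def sqint_const)

lemma L2F_component: "L2F s (\<xi> :: 'w \<Rightarrow> real^'k) \<Longrightarrow> L2F s (\<lambda>\<omega>. \<xi> \<omega> $ i)"
  unfolding L2F_def
  using sqint_component[of M \<xi> i]
    borel_measurable_continuous_on[OF continuous_on_component[OF continuous_on_id], of \<xi> "F s" i]
  by simp

definition incr :: "real \<Rightarrow> real \<Rightarrow> ('w \<Rightarrow> real^'d) \<Rightarrow> 'w \<Rightarrow> real" where
  "incr s t \<xi> \<omega> = \<xi> \<omega> \<bullet> (W t \<omega> - W s \<omega>)"

definition step :: "real \<Rightarrow> real \<Rightarrow> ('w \<Rightarrow> real^'d) \<Rightarrow> real \<times> 'w \<Rightarrow> real^'d" where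
  "step s t \<xi> = (\<lambda>(u, \<omega>). indicator {s<..t} u *\<^sub>R \<xi> \<omega>)"

abbreviation P :: "(real \<times> 'w) measure" where "P \<equiv> lborel \<Otimes>\<^sub>M M"

sublocale P: pair_sigma_finite lborel M ..

lemma expectation_mult_increment:
  fixes Z :: "'w \<Rightarrow> real"
  assumes "0 \<le> s" "s \<le> t" "Z \<in> borel_measurable (F s)" "integrable M Z"
  shows "integrable M (\<lambda>\<omega>. Z \<omega> * (W t \<omega> - W s \<omega>) $ i)"
    "expectation (\<lambda>\<omega>. Z \<omega> * (W t \<omega> - W s \<omega>) $ i) = 0"
    "integrable M (\<lambda>\<omega>. Z \<omega> * ((W t \<omega> - W s \<omega>) $ i * (W t \<omega> - W s \<omega>) $ j))"
    "expectation (\<lambda>\<omega>. Z \<omega> * ((W t \<omega> - W s \<omega>) $ i * (W t \<omega> - W s \<omega>) $ j))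
       = (if i = j then t - s else 0) * expectation Z"
proof -
  have comp: "(\<lambda>v::real^'d. v $ i) \<in> borel_measurable borel" for i
    by (intro borel_measurable_continuous_onI continuous_intros)
  have "integrable M (\<lambda>\<omega>. Z \<omega> * (W t \<omega> - W s \<omega>) $ i) \<and>
    expectation (\<lambda>\<omega>. Z \<omega> * (W t \<omega> - W s \<omega>) $ i) = 0 \<and>
    integrable M (\<lambda>\<omega>. Z \<omega> * ((W t \<omega> - W s \<omega>) $ i * (W t \<omega> - W s \<omega>) $ j)) \<and>
    expectation (\<lambda>\<omega>. Z \<omega> * ((W t \<omega> - W s \<omega>) $ i * (W t \<omega> - W s \<omega>) $ j))
       = (if i = j then t - s else 0) * expectation Z"
  proof (cases "s = t")
    case False
    then have st: "s < t" using assms by simp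
    note mom = increment_moments[OF assms(1) st]
    have i1: "indep_var borel Z borel (\<lambda>\<omega>. (W t \<omega> - W s \<omega>) $ i)"
      by (rule indep_var_increment[OF assms(1) st assms(3) comp])
    have i2: "indep_var borel Z borel (\<lambda>\<omega>. (W t \<omega> - W s \<omega>) $ i * (W t \<omega> - W s \<omega>) $ j)"
      by (rule indep_var_increment[OF assms(1) st assms(3) borel_measurable_times[OF comp comp]])
    show ?thesis
      using indep_var_integrable[OF i1 assms(4) mom(1)] indep_var_lebesgue_integral[OF i1 assms(4) mom(1)]
        indep_var_integrable[OF i2 assms(4) mom(3)] indep_var_lebesgue_integral[OF i2 assms(4) mom(3)]
        mom(2) mom(4)
      by simp
  qed simp
  then show "integrable M (\<lambda>\<omega>. Z \<omega> * (W t \<omega> - W s \<omega>) $ i)"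
    "expectation (\<lambda>\<omega>. Z \<omega> * (W t \<omega> - W s \<omega>) $ i) = 0"
    "integrable M (\<lambda>\<omega>. Z \<omega> * ((W t \<omega> - W s \<omega>) $ i * (W t \<omega> - W s \<omega>) $ j))"
    "expectation (\<lambda>\<omega>. Z \<omega> * ((W t \<omega> - W s \<omega>) $ i * (W t \<omega> - W s \<omega>) $ j))
       = (if i = j then t - s else 0) * expectation Z" by auto
qed

lemma incr_measurable [measurable]:
  assumes "0 \<le> s" "s \<le> t" "L2F s \<xi>" shows "incr s t \<xi> \<in> borel_measurable (F t)"
proof -
  have "\<xi> \<in> borel_measurable (F t)" using L2F_mono[OF assms(3,2)] by (simp add: L2F_def)
  then show ?thesis unfolding incr_def[abs_def]
    using W_filt_measurable assms(1,2) by auto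
qed

text \<open>
  Expand both inner products in coordinates. The products of coordinates of the increment are
  independent of the past and have mean \<open>t - s\<close> on the diagonal and \<open>0\<close> elsewhere.
\<close>
lemma incr_mult_incr_same:
  assumes "0 \<le> s" "s \<le> t" "L2F s \<xi>" "L2F s \<eta>"
  shows "integrable M (\<lambda>\<omega>. incr s t \<xi> \<omega> * incr s t \<eta> \<omega>)"
    "expectation (\<lambda>\<omega>. incr s t \<xi> \<omega> * incr s t \<eta> \<omega>) = (t - s) * expectation (\<lambda>\<omega>. \<xi> \<omega> \<bullet> \<eta> \<omega>)"
proof -
  let ?D = "\<lambda>i \<omega>. (W t \<omega> - W s \<omega>) $ i"
  let ?Z = "\<lambda>i j \<omega>. \<xi> \<omega> $ i * \<eta> \<omega> $ j"
  have eq: "incr s t \<xi> \<omega> * incr s t \<eta> \<omega> = (\<Sum>i\<in>UNIV. \<Sum>j\<in>UNIV. ?Z i j \<omega> * (?D i \<omega> * ?D j \<omega>))" for \<omega>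
    unfolding incr_def inner_vec_def sum_product
    by (intro sum.cong refl) (simp add: mult_ac)
  have Z: "?Z i j \<in> borel_measurable (F s)" "integrable M (?Z i j)" for i j
    using L2F_component[OF assms(3)] L2F_component[OF assms(4)]
    by (auto simp: L2F_def sqint_mult intro!: borel_measurable_times)
  note m = expectation_mult_increment(3,4)[OF assms(1,2) Z]
  show "integrable M (\<lambda>\<omega>. incr s t \<xi> \<omega> * incr s t \<eta> \<omega>)"
    unfolding eq using m by auto
  have "expectation (\<lambda>\<omega>. incr s t \<xi> \<omega> * incr s t \<eta> \<omega>)
      = (\<Sum>i\<in>UNIV. \<Sum>j\<in>UNIV. expectation (\<lambda>\<omega>. ?Z i j \<omega> * (?D i \<omega> * ?D j \<omega>)))"
    unfolding eq using m(1) by (simp del: vector_minus_component)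
  also have "\<dots> = (\<Sum>i\<in>UNIV. (t - s) * expectation (?Z i i))"
    unfolding m(2) by (simp add: if_distrib[of "\<lambda>x. x * _"] sum.delta' cong: if_cong)
  also have "\<dots> = (t - s) * expectation (\<lambda>\<omega>. \<xi> \<omega> \<bullet> \<eta> \<omega>)"
    unfolding inner_vec_def using Z(2) by (simp add: sum_distrib_left)
  finally show "expectation (\<lambda>\<omega>. incr s t \<xi> \<omega> * incr s t \<eta> \<omega>) = (t - s) * expectation (\<lambda>\<omega>. \<xi> \<omega> \<bullet> \<eta> \<omega>)" .
qed

lemma L2F_incr:
  assumes "0 \<le> s" "s \<le> t" "L2F s \<xi>" shows "L2F t (incr s t \<xi>)"
  using incr_mult_incr_same(1)[OF assms assms(3)] incr_measurable[OF assms]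
  by (auto simp: L2F_def sqint_def power2_eq_square filt_measurable)

lemma sqint_incr: "0 \<le> s \<Longrightarrow> s \<le> t \<Longrightarrow> L2F s \<xi> \<Longrightarrow> sqint M (incr s t \<xi>)"
  using L2F_incr L2F_sqint by blast

lemma expectation_mult_incr:
  fixes Z :: "'w \<Rightarrow> real"
  assumes "0 \<le> s" "s \<le> t" "L2F s \<xi>" "L2F s Z"
  shows "expectation (\<lambda>\<omega>. Z \<omega> * incr s t \<xi> \<omega>) = 0"
proof -
  have eq: "Z \<omega> * incr s t \<xi> \<omega> = (\<Sum>i\<in>UNIV. (Z \<omega> * \<xi> \<omega> $ i) * (W t \<omega> - W s \<omega>) $ i)" for \<omega>
    unfolding incr_def inner_vec_def sum_distrib_left by (simp add: mult_ac)
  have Z: "(\<lambda>\<omega>. Z \<omega> * \<xi> \<omega> $ i) \<in> borel_measurable (F s)" "integrable M (\<lambda>\<omega>. Z \<omega> * \<xi> \<omega> $ i)" for i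
    using L2F_component[OF assms(3)] assms(4)
    by (auto simp: L2F_def sqint_mult intro!: borel_measurable_times)
  show ?thesis
    unfolding eq using expectation_mult_increment(1,2)[OF assms(1,2) Z]
    by (simp del: vector_minus_component)
qed

lemma incr_split: "incr s u \<xi> \<omega> = incr s t \<xi> \<omega> + incr t u \<xi> \<omega>"
  by (simp add: incr_def inner_diff)

lemma step_split: "s \<le> t \<Longrightarrow> t \<le> u \<Longrightarrow> step s u \<xi> z = step s t \<xi> z + step t u \<xi> z"
  by (auto simp: step_def indicator_def split: prod.split)

lemma integrable_indicator_times:
  fixes f :: "'w \<Rightarrow> real"
  assumes "integrable M f" "s \<le> t"
  shows "integrable P (\<lambda>(u, \<omega>). indicator {s<..t} u * f \<omega>)"
    "(\<integral>(u, \<omega>). indicator {s<..t} u * f \<omega> \<partial>P) = (t - s) * expectation f"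
proof -
  have [measurable]: "f \<in> borel_measurable M" using assms by auto
  show i: "integrable P (\<lambda>(u, \<omega>). indicator {s<..t} u * f \<omega>)"
  proof (rule P.Fubini_integrable)
    have "integrable lborel (indicat_real {s<..t})"
      by (rule integrable_real_indicator) (use assms(2) in auto)
    then show "integrable lborel (\<lambda>x. expectation (\<lambda>y. norm (case (x, y) of (u, \<omega>) \<Rightarrow> indicator {s<..t} u * f \<omega>)))"
      by (simp add: abs_mult)
  qed (use assms in auto)
  show "(\<integral>(u, \<omega>). indicator {s<..t} u * f \<omega> \<partial>P) = (t - s) * expectation f"
    using P.integral_fst[OF i] assms(2) by simp
qed

lemma sqint_step:
  assumes "s \<le> t" "L2F s \<xi>" shows "sqint P (step s t \<xi>)"
proof -
  have [measurable]: "\<xi> \<in> borel_measurable M" using assms by (auto simp: L2F_def sqint_def)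
  have eq: "(\<lambda>z. (norm (step s t \<xi> z))\<^sup>2) = (\<lambda>(u, \<omega>). indicator {s<..t} u * (norm (\<xi> \<omega>))\<^sup>2)"
    by (auto simp: step_def indicator_def)
  have "integrable P (\<lambda>z. (norm (step s t \<xi> z))\<^sup>2)"
    unfolding eq using assms by (intro integrable_indicator_times) (auto simp: L2F_def sqint_def)
  then show ?thesis by (auto simp: sqint_def step_def)
qed

lemma step_inner_same:
  assumes "s \<le> t" "L2F s \<xi>" "L2F s \<eta>"
  shows "(\<integral>z. step s t \<xi> z \<bullet> step s t \<eta> z \<partial>P) = (t - s) * expectation (\<lambda>\<omega>. \<xi> \<omega> \<bullet> \<eta> \<omega>)"
proof -
  have "(\<lambda>z. step s t \<xi> z \<bullet> step s t \<eta> z) = (\<lambda>(u, \<omega>). indicator {s<..t} u * (\<xi> \<omega> \<bullet> \<eta> \<omega>))"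
    by (auto simp: step_def indicator_def)
  then show ?thesis
    using integrable_indicator_times(2)[OF sqint_inner[OF L2F_sqint L2F_sqint, OF assms(2,3)] assms(1)] by simp
qed

text \<open>
  The Ito isometry for a pair of integrands and a pair of integrals, as a relation that is additive
  in each argument.
\<close>
definition isometric :: "(real \<times> 'w \<Rightarrow> real^'d) \<Rightarrow> ('w \<Rightarrow> real) \<Rightarrow> (real \<times> 'w \<Rightarrow> real^'d) \<Rightarrow> ('w \<Rightarrow> real) \<Rightarrow> bool" where
  "isometric f I g J \<longleftrightarrow> expectation (\<lambda>\<omega>. I \<omega> * J \<omega>) = (\<integral>z. f z \<bullet> g z \<partial>P)"

lemma isometric_add:
  assumes "sqint P f" "sqint P f'" "sqint P g" "sqint M I" "sqint M I'" "sqint M J"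
    "isometric f I g J" "isometric f' I' g J"
  shows "isometric (\<lambda>z. f z + f' z) (\<lambda>\<omega>. I \<omega> + I' \<omega>) g J"
proof -
  have "expectation (\<lambda>\<omega>. (I \<omega> + I' \<omega>) * J \<omega>) = expectation (\<lambda>\<omega>. I \<omega> * J \<omega>) + expectation (\<lambda>\<omega>. I' \<omega> * J \<omega>)"
    using sqint_mult[OF assms(4,6)] sqint_mult[OF assms(5,6)] by (simp add: algebra_simps)
  moreover have "(\<integral>z. (f z + f' z) \<bullet> g z \<partial>P) = (\<integral>z. f z \<bullet> g z \<partial>P) + (\<integral>z. f' z \<bullet> g z \<partial>P)"
    using sqint_inner[OF assms(1,3)] sqint_inner[OF assms(2,3)] by (simp add: inner_add)
  ultimately show ?thesis using assms(7,8) by (simp add: isometric_def)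
qed

lemma isometric_sym: "isometric f I g J \<Longrightarrow> isometric g J f I"
  by (simp add: isometric_def mult.commute inner_commute)

text \<open>
  The earlier integral is known when the later interval begins, and the later increment is centered
  given that information.
\<close>
lemma isometric_step_disjoint:
  assumes "0 \<le> s" "s \<le> t" "t \<le> u" "u \<le> v" "L2F s \<xi>" "L2F u \<eta>"
  shows "isometric (step s t \<xi>) (incr s t \<xi>) (step u v \<eta>) (incr u v \<eta>)"
proof -
  have "(\<lambda>z. step s t \<xi> z \<bullet> step u v \<eta> z) = (\<lambda>z. 0)"
    using assms by (auto simp: step_def indicator_def)
  moreover have "expectation (\<lambda>\<omega>. incr s t \<xi> \<omega> * incr u v \<eta> \<omega>) = 0"
    using assms by (intro expectation_mult_incr L2F_mono[OF L2F_incr[of s t]]) auto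
  ultimately show ?thesis by (simp add: isometric_def)
qed

lemma isometric_step_same_start:
  assumes "0 \<le> s" "s \<le> t" "t \<le> v" "L2F s \<xi>" "L2F s \<eta>"
  shows "isometric (step s t \<xi>) (incr s t \<xi>) (step s v \<eta>) (incr s v \<eta>)"
proof -
  have "isometric (\<lambda>z. step s t \<eta> z + step t v \<eta> z) (\<lambda>\<omega>. incr s t \<eta> \<omega> + incr t v \<eta> \<omega>)
      (step s t \<xi>) (incr s t \<xi>)"
  proof (rule isometric_add)
    show "isometric (step s t \<eta>) (incr s t \<eta>) (step s t \<xi>) (incr s t \<xi>)"
      using assms by (simp add: isometric_def step_inner_same incr_mult_incr_same)
    show "isometric (step t v \<eta>) (incr t v \<eta>) (step s t \<xi>) (incr s t \<xi>)"
      using assms by (intro isometric_sym[OF isometric_step_disjoint] L2F_mono[of s \<eta> t]) auto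
  qed (use assms L2F_mono[of s \<eta> t] in \<open>auto intro: sqint_step sqint_incr\<close>)
  also have "(\<lambda>\<omega>. incr s t \<eta> \<omega> + incr t v \<eta> \<omega>) = incr s v \<eta>"
    by (rule ext) (rule incr_split[symmetric])
  also have "(\<lambda>z. step s t \<eta> z + step t v \<eta> z) = step s v \<eta>"
    by (rule ext, rule step_split[symmetric]) (use assms in auto)
  finally show ?thesis by (rule isometric_sym)
qed

text \<open>
  By symmetry \<open>s \<le> u\<close>. Cutting \<open>(s,t]\<close> at \<open>u\<close> and the longer of the remaining intervals at the earlier
  right end reduces overlapping intervals to equal and disjoint ones.
\<close>
lemma isometric_step:
  assumes "0 \<le> s" "s \<le> t" "0 \<le> u" "u \<le> v" "L2F s \<xi>" "L2F u \<eta>"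
  shows "isometric (step s t \<xi>) (incr s t \<xi>) (step u v \<eta>) (incr u v \<eta>)"
proof -
  have *: "isometric (step s t \<xi>) (incr s t \<xi>) (step u v \<eta>) (incr u v \<eta>)"
    if "0 \<le> s" "s \<le> t" "s \<le> u" "u \<le> v" "L2F s \<xi>" "L2F u \<eta>" for s t u v \<xi> \<eta>
  proof (cases "t \<le> u")
    case True
    then show ?thesis using that by (intro isometric_step_disjoint) auto
  next
    case False
    have \<xi>: "L2F u \<xi>" using that by (intro L2F_mono[of s \<xi> u])
    have "isometric (\<lambda>z. step s u \<xi> z + step u t \<xi> z) (\<lambda>\<omega>. incr s u \<xi> \<omega> + incr u t \<xi> \<omega>)
      (step u v \<eta>) (incr u v \<eta>)"
    proof (rule isometric_add)
      show "isometric (step s u \<xi>) (incr s u \<xi>) (step u v \<eta>) (incr u v \<eta>)"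
        using that by (intro isometric_step_disjoint) auto
      show "isometric (step u t \<xi>) (incr u t \<xi>) (step u v \<eta>) (incr u v \<eta>)"
        using that \<xi> False isometric_step_same_start[of u t v \<xi> \<eta>]
          isometric_sym[OF isometric_step_same_start[of u v t \<eta> \<xi>]] by (cases "t \<le> v") auto
    qed (use that \<xi> False in \<open>auto intro: sqint_step sqint_incr\<close>)
    also have "(\<lambda>\<omega>. incr s u \<xi> \<omega> + incr u t \<xi> \<omega>) = incr s t \<xi>"
      by (rule ext) (rule incr_split[symmetric])
    also have "(\<lambda>z. step s u \<xi> z + step u t \<xi> z) = step s t \<xi>"
      by (rule ext, rule step_split[symmetric]) (use that False in auto)
    finally show ?thesis .
  qed
  show ?thesis
    using *[of s t u v \<xi> \<eta>] isometric_sym[OF *[of u v s t \<eta> \<xi>]] assms by (cases "s \<le> u") auto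
qed

section \<open>The Ito integral as an isometry\<close>

text \<open>
  Sums of steps over arbitrary intervals. No common partition is imposed, which makes sums and
  differences immediate.
\<close>
inductive elementary :: "(real \<times> 'w \<Rightarrow> real^'d) \<Rightarrow> ('w \<Rightarrow> real) \<Rightarrow> bool" where
  elementary_step: "0 \<le> s \<Longrightarrow> s \<le> t \<Longrightarrow> L2F s \<xi> \<Longrightarrow> elementary (step s t \<xi>) (incr s t \<xi>)"
| elementary_add: "elementary f I \<Longrightarrow> elementary g J \<Longrightarrow> elementary (\<lambda>z. f z + g z) (\<lambda>\<omega>. I \<omega> + J \<omega>)"

lemma elementary_sqint: assumes "elementary f I" shows "sqint P f" "sqint M I"
  using assms by (induction) (auto intro: sqint_step sqint_incr sqint_add)

lemma elementary_scaleR: "elementary f I \<Longrightarrow> elementary (\<lambda>z. c *\<^sub>R f z) (\<lambda>\<omega>. c * I \<omega>)"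
proof (induction rule: elementary.induct)
  case (elementary_step s t \<xi>)
  have "(\<lambda>z. c *\<^sub>R step s t \<xi> z) = step s t (\<lambda>\<omega>. c *\<^sub>R \<xi> \<omega>)" "(\<lambda>\<omega>. c * incr s t \<xi> \<omega>) = incr s t (\<lambda>\<omega>. c *\<^sub>R \<xi> \<omega>)"
    by (auto simp: step_def incr_def)
  then show ?case using elementary_step by (auto intro!: elementary.elementary_step L2F_scaleR)
next
  case (elementary_add f I g J)
  then show ?case using elementary.elementary_add[OF elementary_add.IH] by (simp add: algebra_simps)
qed

lemma elementary_zero: "elementary (\<lambda>z. 0) (\<lambda>\<omega>. 0)"
proof -
  have "elementary (step 0 0 (\<lambda>_. 0)) (incr 0 0 (\<lambda>_. 0))" by (intro elementary_step L2F_const) auto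
  moreover have "step 0 0 (\<lambda>_. 0) = (\<lambda>z. 0)" "incr 0 0 (\<lambda>_. 0) = (\<lambda>\<omega>. 0)"
    by (auto simp: step_def incr_def)
  ultimately show ?thesis by simp
qed

lemma elementary_sum:
  assumes "\<And>i. i \<in> A \<Longrightarrow> elementary (f i) (I i)"
  shows "elementary (\<lambda>z. \<Sum>i\<in>A. f i z) (\<lambda>\<omega>. \<Sum>i\<in>A. I i \<omega>)"
  using assms by (induction A rule: infinite_finite_induct) (auto intro: elementary_zero elementary_add)

lemma elementary_isometric:
  assumes "elementary f I" "elementary g J" shows "isometric f I g J"
  using assms(1)
proof (induction)
  case (elementary_step s t \<xi>)
  show ?case using assms(2)
  proof (induction)
    case s2: (elementary_step u v \<eta>)
    then show ?case using elementary_step by (intro isometric_step) auto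
  next
    case (elementary_add f I g J)
    then show ?case using elementary_step elementary_sqint
      by (intro isometric_sym[OF isometric_add] isometric_sym[of "step s t \<xi>"] sqint_step sqint_incr) auto
  qed
next
  case (elementary_add f I f' I')
  then show ?case using elementary_sqint elementary_sqint[OF assms(2)] by (intro isometric_add) auto
qed

text \<open>
  Restricting an elementary integrand to times after \<open>s\<close> cuts its intervals at \<open>s\<close>; what is left has
  integrals that are orthogonal to everything known at \<open>s\<close>.
\<close>
lemma elementary_cut:
  assumes "elementary f I" "0 \<le> s"
  shows "\<exists>J. elementary (\<lambda>z. indicator {s<..} (fst z) *\<^sub>R f z) J \<and> (\<forall>Z. L2F s Z \<longrightarrow> expectation (\<lambda>\<omega>. Z \<omega> * J \<omega>) = 0)"
  using assms(1)
proof (induction)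
  case (elementary_step a b \<xi>)
  show ?case
  proof (cases "b \<le> s")
    case True
    then have eq: "(\<lambda>z. indicator {s<..} (fst z) *\<^sub>R step a b \<xi> z) = (\<lambda>z. 0)"
      by (auto simp: step_def indicator_def)
    show ?thesis unfolding eq using elementary_zero by (intro exI[of _ "\<lambda>_. 0"]) auto
  next
    case False
    have eq: "(\<lambda>z. indicator {s<..} (fst z) *\<^sub>R step a b \<xi> z) = step (max a s) b \<xi>"
      by (intro ext) (simp add: step_def split_beta' indicator_def)
    have L: "L2F (max a s) \<xi>" by (rule L2F_mono[OF elementary_step(3) max.cobounded1])
    have "expectation (\<lambda>\<omega>. Z \<omega> * incr (max a s) b \<xi> \<omega>) = 0" if "L2F s Z" for Z
      using L elementary_step False assms(2) L2F_mono[OF that, of "max a s"] by (intro expectation_mult_incr) auto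
    then show ?thesis unfolding eq using L elementary_step False assms(2)
      by (intro exI[of _ "incr (max a s) b \<xi>"]) (auto intro!: elementary.elementary_step)
  qed
next
  case (elementary_add f I g J)
  then obtain I' J' where I': "elementary (\<lambda>z. indicator {s<..} (fst z) *\<^sub>R f z) I'" "\<And>Z. L2F s Z \<Longrightarrow> expectation (\<lambda>\<omega>. Z \<omega> * I' \<omega>) = 0"
    and J': "elementary (\<lambda>z. indicator {s<..} (fst z) *\<^sub>R g z) J'" "\<And>Z. L2F s Z \<Longrightarrow> expectation (\<lambda>\<omega>. Z \<omega> * J' \<omega>) = 0"
    by blast
  have "elementary (\<lambda>z. indicator {s<..} (fst z) *\<^sub>R (f z + g z)) (\<lambda>\<omega>. I' \<omega> + J' \<omega>)"
    using elementary.elementary_add[OF I'(1) J'(1)] by (simp add: scaleR_add_right)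
  moreover have "expectation (\<lambda>\<omega>. Z \<omega> * (I' \<omega> + J' \<omega>)) = 0" if "L2F s Z" for Z
    using I'(2)[OF that] J'(2)[OF that] sqint_mult[OF L2F_sqint[OF that] elementary_sqint(2)[OF I'(1)]]
      sqint_mult[OF L2F_sqint[OF that] elementary_sqint(2)[OF J'(1)]]
    by (simp add: distrib_left)
  ultimately show ?case by blast
qed

text \<open>
  The closure of the elementary pairs in \<open>L\<^sup>2 \<times> L\<^sup>2\<close>.
\<close>
definition ito :: "(real \<times> 'w \<Rightarrow> real^'d) \<Rightarrow> ('w \<Rightarrow> real) \<Rightarrow> bool" where
  "ito f I \<longleftrightarrow> sqint P f \<and> sqint M I \<and>
     (\<forall>e>0. \<exists>g J. elementary g J \<and> sqnorm P (\<lambda>z. g z - f z) < e \<and> sqnorm M (\<lambda>\<omega>. J \<omega> - I \<omega>) < e)"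

lemma ito_sqint: "ito f I \<Longrightarrow> sqint P f" "ito f I \<Longrightarrow> sqint M I"
  by (auto simp: ito_def)

lemma elementary_ito: assumes "elementary f I" shows "ito f I"
  unfolding ito_def using assms elementary_sqint[OF assms] 
  by (auto intro!: exI[of _ f] exI[of _ I] simp: sqnorm_def)

lemma tendsto_0_of_less_inverse: "(\<And>n. 0 \<le> a n) \<Longrightarrow> (\<And>n. a n < inverse (Suc n)) \<Longrightarrow> a \<longlonglongrightarrow> (0::real)"
  by (rule tendsto_sandwich[OF _ _ tendsto_const LIMSEQ_inverse_real_of_nat]) (auto intro!: always_eventually less_imp_le)

lemma ito_sequence:
  assumes "ito f I"
  obtains g J where "\<And>n. elementary (g n) (J n)" "(\<lambda>n. sqnorm P (\<lambda>z. g n z - f z)) \<longlonglongrightarrow> 0"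
    "(\<lambda>n. sqnorm M (\<lambda>\<omega>. J n \<omega> - I \<omega>)) \<longlonglongrightarrow> 0"
proof -
  have "\<forall>n. \<exists>gJ. elementary (fst gJ) (snd gJ) \<and> sqnorm P (\<lambda>z. fst gJ z - f z) < inverse (Suc n)
      \<and> sqnorm M (\<lambda>\<omega>. snd gJ \<omega> - I \<omega>) < inverse (Suc n)"
  proof
    fix n
    have "0 < inverse (real (Suc n))" by simp
    then obtain g J where "elementary g J" "sqnorm P (\<lambda>z. g z - f z) < inverse (Suc n)"
      "sqnorm M (\<lambda>\<omega>. J \<omega> - I \<omega>) < inverse (Suc n)"
      using assms unfolding ito_def by blast
    then show "\<exists>gJ. elementary (fst gJ) (snd gJ) \<and> sqnorm P (\<lambda>z. fst gJ z - f z) < inverse (Suc n)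
      \<and> sqnorm M (\<lambda>\<omega>. snd gJ \<omega> - I \<omega>) < inverse (Suc n)"
      by (intro exI[of _ "(g, J)"]) simp
  qed
  from choice[OF this] obtain gJ where gJ: "\<And>n. elementary (fst (gJ n)) (snd (gJ n))"
    "\<And>n. sqnorm P (\<lambda>z. fst (gJ n) z - f z) < inverse (Suc n)"
    "\<And>n. sqnorm M (\<lambda>\<omega>. snd (gJ n) \<omega> - I \<omega>) < inverse (Suc n)" by auto
  show ?thesis
    by (rule that[of "\<lambda>n. fst (gJ n)" "\<lambda>n. snd (gJ n)"])
      (use gJ in \<open>auto intro!: tendsto_0_of_less_inverse simp del: of_nat_Suc\<close>)
qed

lemma itoI:
  assumes "sqint P f" "sqint M I"
    "\<And>e. 0 < e \<Longrightarrow> \<exists>g J. ito g J \<and> sqnorm P (\<lambda>z. g z - f z) < e \<and> sqnorm M (\<lambda>\<omega>. J \<omega> - I \<omega>) < e"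
  shows "ito f I"
  unfolding ito_def
proof (intro conjI allI impI assms(1,2))
  fix e :: real assume "0 < e"
  then obtain g J where g: "ito g J" "sqnorm P (\<lambda>z. g z - f z) < e/4" "sqnorm M (\<lambda>\<omega>. J \<omega> - I \<omega>) < e/4"
    using assms(3)[of "e/4"] by auto
  have "0 < e/4" using \<open>0 < e\<close> by simp
  then obtain k K where k: "elementary k K" "sqnorm P (\<lambda>z. k z - g z) < e/4" "sqnorm M (\<lambda>\<omega>. K \<omega> - J \<omega>) < e/4"
    using g(1) unfolding ito_def by blast
  have "sqnorm P (\<lambda>z. k z - f z) < e"
    using sqnorm_triangle_le[OF elementary_sqint(1)[OF k(1)] ito_sqint(1)[OF g(1)] assms(1)] k g by linarith
  moreover have "sqnorm M (\<lambda>z. K z - I z) < e"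
    using sqnorm_triangle_le[OF elementary_sqint(2)[OF k(1)] ito_sqint(2)[OF g(1)] assms(2)] k g by linarith
  ultimately show "\<exists>g J. elementary g J \<and> sqnorm P (\<lambda>z. g z - f z) < e \<and> sqnorm M (\<lambda>\<omega>. J \<omega> - I \<omega>) < e"
    using k by blast
qed

lemma ito_limit:
  assumes "sqint P f" "sqint M I" "\<And>n. ito (g n) (J n)"
    "(\<lambda>n. sqnorm P (\<lambda>z. g n z - f z)) \<longlonglongrightarrow> 0" "(\<lambda>n. sqnorm M (\<lambda>\<omega>. J n \<omega> - I \<omega>)) \<longlonglongrightarrow> 0"
  shows "ito f I"
proof (rule itoI[OF assms(1,2)])
  fix e :: real assume "0 < e"
  then have "\<forall>\<^sub>F n in sequentially. sqnorm P (\<lambda>z. g n z - f z) < e \<and> sqnorm M (\<lambda>\<omega>. J n \<omega> - I \<omega>) < e"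
    using order_tendstoD(2)[OF assms(4)] order_tendstoD(2)[OF assms(5)] by (auto intro: eventually_conj)
  then show "\<exists>g J. ito g J \<and> sqnorm P (\<lambda>z. g z - f z) < e \<and> sqnorm M (\<lambda>\<omega>. J \<omega> - I \<omega>) < e"
    using assms(3) eventually_happens'[OF sequentially_bot] by blast
qed

text \<open>
  The isometry is polarized, and because integrands are functions on all of time it covers integrals
  up to different times as well.
\<close>
lemma ito_isometry:
  assumes "ito f I" "ito g J"
  shows "expectation (\<lambda>\<omega>. I \<omega> * J \<omega>) = (\<integral>z. f z \<bullet> g z \<partial>P)"
proof -
  obtain f' I' where f: "\<And>n. elementary (f' n) (I' n)" "(\<lambda>n. sqnorm P (\<lambda>z. f' n z - f z)) \<longlonglongrightarrow> 0"
    "(\<lambda>n. sqnorm M (\<lambda>\<omega>. I' n \<omega> - I \<omega>)) \<longlonglongrightarrow> 0" using ito_sequence[OF assms(1)] by blast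
  obtain g' J' where g: "\<And>n. elementary (g' n) (J' n)" "(\<lambda>n. sqnorm P (\<lambda>z. g' n z - g z)) \<longlonglongrightarrow> 0"
    "(\<lambda>n. sqnorm M (\<lambda>\<omega>. J' n \<omega> - J \<omega>)) \<longlonglongrightarrow> 0" using ito_sequence[OF assms(2)] by blast
  have "(\<lambda>n. \<integral>z. f' n z \<bullet> g' n z \<partial>P) \<longlonglongrightarrow> (\<integral>z. f z \<bullet> g z \<partial>P)"
    by (rule sqint_tendsto_inner)
      (use f g elementary_sqint[OF f(1)] elementary_sqint[OF g(1)] ito_sqint[OF assms(1)] ito_sqint[OF assms(2)] in auto)
  moreover have "(\<lambda>n. expectation (\<lambda>\<omega>. I' n \<omega> \<bullet> J' n \<omega>)) \<longlonglongrightarrow> expectation (\<lambda>\<omega>. I \<omega> \<bullet> J \<omega>)"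
    by (rule sqint_tendsto_inner)
      (use f g elementary_sqint[OF f(1)] elementary_sqint[OF g(1)] ito_sqint[OF assms(1)] ito_sqint[OF assms(2)] in auto)
  moreover have "expectation (\<lambda>\<omega>. I' n \<omega> \<bullet> J' n \<omega>) = (\<integral>z. f' n z \<bullet> g' n z \<partial>P)" for n
    using elementary_isometric[OF f(1) g(1), of n n] by (simp add: isometric_def)
  ultimately show ?thesis using LIMSEQ_unique by simp
qed

lemma ito_norm: "ito f I \<Longrightarrow> sqnorm M I = sqnorm P f"
  using ito_isometry[of f I f I] by (simp add: sqnorm_eq_inner)

lemma ito_add:
  assumes "ito f I" "ito g J" shows "ito (\<lambda>z. f z + g z) (\<lambda>\<omega>. I \<omega> + J \<omega>)"
proof -
  obtain f' I' where f: "\<And>n. elementary (f' n) (I' n)" "(\<lambda>n. sqnorm P (\<lambda>z. f' n z - f z)) \<longlonglongrightarrow> 0"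
    "(\<lambda>n. sqnorm M (\<lambda>\<omega>. I' n \<omega> - I \<omega>)) \<longlonglongrightarrow> 0" using ito_sequence[OF assms(1)] by blast
  obtain g' J' where g: "\<And>n. elementary (g' n) (J' n)" "(\<lambda>n. sqnorm P (\<lambda>z. g' n z - g z)) \<longlonglongrightarrow> 0"
    "(\<lambda>n. sqnorm M (\<lambda>\<omega>. J' n \<omega> - J \<omega>)) \<longlonglongrightarrow> 0" using ito_sequence[OF assms(2)] by blast
  show ?thesis
  proof (rule ito_limit[where g="\<lambda>n z. f' n z + g' n z" and J="\<lambda>n \<omega>. I' n \<omega> + J' n \<omega>"])
    show "ito (\<lambda>z. f' n z + g' n z) (\<lambda>\<omega>. I' n \<omega> + J' n \<omega>)" for n
      by (intro elementary_ito elementary_add f g)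
    have "(\<lambda>n. sqnorm P (\<lambda>z. (f' n z - f z) + (g' n z - g z))) \<longlonglongrightarrow> 0"
      using f g elementary_sqint[OF f(1)] elementary_sqint[OF g(1)] ito_sqint[OF assms(1)] ito_sqint[OF assms(2)]
      by (intro sqnorm_add_tendsto_0) (auto intro!: sqint_diff)
    then show "(\<lambda>n. sqnorm P (\<lambda>z. f' n z + g' n z - (f z + g z))) \<longlonglongrightarrow> 0" by (simp add: algebra_simps)
    have "(\<lambda>n. sqnorm M (\<lambda>z. (I' n z - I z) + (J' n z - J z))) \<longlonglongrightarrow> 0"
      using f g elementary_sqint[OF f(1)] elementary_sqint[OF g(1)] ito_sqint[OF assms(1)] ito_sqint[OF assms(2)]
      by (intro sqnorm_add_tendsto_0) (auto intro!: sqint_diff)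
    then show "(\<lambda>n. sqnorm M (\<lambda>z. I' n z + J' n z - (I z + J z))) \<longlonglongrightarrow> 0" by (simp add: algebra_simps)
  qed (use ito_sqint[OF assms(1)] ito_sqint[OF assms(2)] in \<open>auto intro!: sqint_add\<close>)
qed

lemma ito_scaleR:
  assumes "ito f I" shows "ito (\<lambda>z. c *\<^sub>R f z) (\<lambda>\<omega>. c * I \<omega>)"
proof -
  obtain f' I' where f: "\<And>n. elementary (f' n) (I' n)" "(\<lambda>n. sqnorm P (\<lambda>z. f' n z - f z)) \<longlonglongrightarrow> 0"
    "(\<lambda>n. sqnorm M (\<lambda>\<omega>. I' n \<omega> - I \<omega>)) \<longlonglongrightarrow> 0" using ito_sequence[OF assms(1)] by blast
  show ?thesis
  proof (rule ito_limit[where g="\<lambda>n z. c *\<^sub>R f' n z" and J="\<lambda>n \<omega>. c * I' n \<omega>"])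
    show "ito (\<lambda>z. c *\<^sub>R f' n z) (\<lambda>\<omega>. c * I' n \<omega>)" for n
      by (intro elementary_ito elementary_scaleR f)
    have "(\<lambda>n. sqnorm P (\<lambda>z. c *\<^sub>R (f' n z - f z))) \<longlonglongrightarrow> 0"
      unfolding sqnorm_scaleR using f by (intro tendsto_mult_right_zero)
    then show "(\<lambda>n. sqnorm P (\<lambda>z. c *\<^sub>R f' n z - c *\<^sub>R f z)) \<longlonglongrightarrow> 0" by (simp add: scaleR_diff_right)
    have "(\<lambda>n. sqnorm M (\<lambda>z. c *\<^sub>R (I' n z - I z))) \<longlonglongrightarrow> 0"
      unfolding sqnorm_scaleR using f by (intro tendsto_mult_right_zero)
    then show "(\<lambda>n. sqnorm M (\<lambda>z. c * I' n z - c * I z)) \<longlonglongrightarrow> 0" by (simp add: right_diff_distrib)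
  qed (use ito_sqint[OF assms(1)] in \<open>auto intro!: sqint_scaleR sqint_cmult\<close>)
qed

lemma ito_diff:
  assumes "ito f I" "ito g J" shows "ito (\<lambda>z. f z - g z) (\<lambda>\<omega>. I \<omega> - J \<omega>)"
  using ito_add[OF assms(1) ito_scaleR[OF assms(2), of "-1"]] by simp

lemma ito_sum:
  assumes "\<And>i. i \<in> A \<Longrightarrow> ito (f i) (I i)"
  shows "ito (\<lambda>z. \<Sum>i\<in>A. f i z) (\<lambda>\<omega>. \<Sum>i\<in>A. I i \<omega>)"
  using assms by (induction A rule: infinite_finite_induct) (auto intro: elementary_ito elementary_zero ito_add)

text \<open>
  This is the martingale property in the form in which it is used. The elementary approximations
  are replaced by their restrictions to times after \<open>s\<close>. These still approximate \<open>f\<close>, and by the isometry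
  their integrals still approximate \<open>I\<close>.
\<close>
lemma ito_orthogonal_past:
  assumes "ito f I" "0 \<le> s" "L2F s Z" "AE z in P. fst z \<le> s \<longrightarrow> f z = 0"
  shows "expectation (\<lambda>\<omega>. Z \<omega> * I \<omega>) = 0"
proof -
  obtain f' I' where f: "\<And>n. elementary (f' n) (I' n)" "(\<lambda>n. sqnorm P (\<lambda>z. f' n z - f z)) \<longlonglongrightarrow> 0"
    "(\<lambda>n. sqnorm M (\<lambda>\<omega>. I' n \<omega> - I \<omega>)) \<longlonglongrightarrow> 0" using ito_sequence[OF assms(1)] by blast
  let ?g = "\<lambda>n z. indicator {s<..} (fst z) *\<^sub>R f' n z"
  have "\<forall>n. \<exists>J. elementary (?g n) J \<and> expectation (\<lambda>\<omega>. Z \<omega> * J \<omega>) = 0"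
    using elementary_cut[OF f(1) assms(2)] assms(3) by blast
  from choice[OF this] obtain J where J: "\<And>n. elementary (?g n) (J n)" "\<And>n. expectation (\<lambda>\<omega>. Z \<omega> * J n \<omega>) = 0"
    by blast
  have g0: "(\<lambda>n. sqnorm P (\<lambda>z. ?g n z - f z)) \<longlonglongrightarrow> 0"
  proof (rule tendsto_sandwich[OF _ _ tendsto_const f(2)])
    show "\<forall>\<^sub>F n in sequentially. sqnorm P (\<lambda>z. ?g n z - f z) \<le> sqnorm P (\<lambda>z. f' n z - f z)"
    proof (rule always_eventually, rule allI, rule sqnorm_mono)
      fix n
      show "AE z in P. norm (?g n z - f z) \<le> norm (f' n z - f z)"
        using assms(4) by eventually_elim (auto simp: indicator_def)
    qed (auto intro!: sqint_diff elementary_sqint[OF J(1)] elementary_sqint[OF f(1)] ito_sqint[OF assms(1)])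
  qed auto
  have "(\<lambda>n. sqnorm M (\<lambda>\<omega>. J n \<omega> - I \<omega>)) \<longlonglongrightarrow> 0"
    using g0 ito_norm[OF ito_diff[OF elementary_ito[OF J(1)] assms(1)]] by simp
  then have "(\<lambda>n. expectation (\<lambda>\<omega>. Z \<omega> \<bullet> J n \<omega>)) \<longlonglongrightarrow> expectation (\<lambda>\<omega>. Z \<omega> \<bullet> I \<omega>)"
    using assms elementary_sqint[OF J(1)] ito_sqint[OF assms(1)] L2F_sqint
    by (intro sqint_tendsto_inner) (auto simp: sqnorm_def)
  then have "(\<lambda>n::nat. 0) \<longlonglongrightarrow> expectation (\<lambda>\<omega>. Z \<omega> * I \<omega>)" using J(2) by simp
  then show ?thesis using LIMSEQ_unique[OF tendsto_const] by metis
qed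

lemma ito_expectation:
  assumes "ito f I" "AE z in P. fst z \<le> 0 \<longrightarrow> f z = 0" shows "expectation I = 0"
  using ito_orthogonal_past[OF assms(1) order_refl L2F_const[of 0 1] assms(2)] by simp

lemma nn_integral_cutoff:
  assumes "(\<lambda>(t, \<omega>). g t \<omega>) \<in> borel_measurable (restrict_space borel {0..T} \<Otimes>\<^sub>M M)"
  shows "(\<integral>\<^sup>+ \<omega>. (\<integral>\<^sup>+ t\<in>{0..T}. ennreal ((norm (g t \<omega>))\<^sup>2) \<partial>lborel) \<partial>M)
     = (\<integral>\<^sup>+ z. ennreal ((norm (cutoff T g z))\<^sup>2) \<partial>P)"
proof -
  note [measurable] = cutoff_measurable[OF assms]
  have "(\<integral>\<^sup>+ z. ennreal ((norm (cutoff T g z))\<^sup>2) \<partial>P) = (\<integral>\<^sup>+ \<omega>. (\<integral>\<^sup>+ t. ennreal ((norm (cutoff T g (t, \<omega>)))\<^sup>2) \<partial>lborel) \<partial>M)"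
    by (rule P.nn_integral_snd[symmetric]) simp
  also have "\<dots> = (\<integral>\<^sup>+ \<omega>. (\<integral>\<^sup>+ t\<in>{0..T}. ennreal ((norm (g t \<omega>))\<^sup>2) \<partial>lborel) \<partial>M)"
    by (intro nn_integral_cong) (auto simp: cutoff_def indicator_def)
  finally show ?thesis by simp
qed

lemma L2_adapted_cutoff:
  assumes "L2_adapted M W T g" shows "sqint P (cutoff T g)"
  using assms nn_integral_cutoff[of g T] cutoff_measurable[of g T M]
  by (intro sqint_nn_integralI) (auto simp: L2_adapted_def)

lemma L2_adaptedI:
  assumes "(\<lambda>(t, \<omega>). g t \<omega>) \<in> borel_measurable (restrict_space borel {0..T} \<Otimes>\<^sub>M M)"
    "\<And>t. 0 \<le> t \<Longrightarrow> t \<le> T \<Longrightarrow> g t \<in> borel_measurable (F t)" "sqint P (cutoff T g)"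
  shows "L2_adapted M W T g"
  using assms nn_integral_cutoff[OF assms(1)] sqint_nn_integralD[OF assms(3)]
  by (auto simp: L2_adapted_def)

lemma L2_adapted_mono:
  assumes "L2_adapted M W T g" "S \<le> T" shows "L2_adapted M W S g"
proof (rule L2_adaptedI)
  show m: "(\<lambda>(t, \<omega>). g t \<omega>) \<in> borel_measurable (restrict_space borel {0..S} \<Otimes>\<^sub>M M)"
    using assms restrict_measurable_mono by (auto simp: L2_adapted_def)
  show "sqint P (cutoff S g)"
    by (rule sqint_bound[OF L2_adapted_cutoff[OF assms(1)] cutoff_measurable[OF m], where C=1])
      (use assms(2) in \<open>auto intro!: AE_I2 simp: cutoff_def indicator_def\<close>)
qed (use assms in \<open>auto simp: L2_adapted_def\<close>)

lemma simple_process_eq_step: "(\<lambda>(t, \<omega>). simple_process k p \<xi> t \<omega>) = (\<lambda>z. \<Sum>i<k. step (p i) (p (Suc i)) (\<xi> i) z)"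
  by (auto simp: simple_process_def step_def)

lemma simple_integral_eq_incr: "simple_integral W k p \<xi> = (\<lambda>\<omega>. \<Sum>i<k. incr (p i) (p (Suc i)) (\<xi> i) \<omega>)"
  by (auto simp: simple_integral_def incr_def)

lemma partition_mono:
  assumes "\<And>i. i < k \<Longrightarrow> p i \<le> p (Suc i)" "i \<le> j" "j \<le> (k::nat)" shows "p i \<le> (p j :: real)"
  using assms(2,3)
proof (induction j)
  case (Suc j) then show ?case using assms(1)[of j] by (cases "i = Suc j") (auto simp: le_Suc_eq)
qed auto

lemma elementary_partition:
  assumes "\<And>i. i < k \<Longrightarrow> p i \<le> p (Suc i)" "p 0 = 0" "\<And>i. i < k \<Longrightarrow> L2F (p i) (\<xi> i)"
  shows "elementary (\<lambda>z. \<Sum>i<k. step (p i) (p (Suc i)) (\<xi> i) z) (\<lambda>\<omega>. \<Sum>i<k. incr (p i) (p (Suc i)) (\<xi> i) \<omega>)"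
proof (rule elementary_sum)
  fix i assume "i \<in> {..<k}"
  then show "elementary (step (p i) (p (Suc i)) (\<xi> i)) (incr (p i) (p (Suc i)) (\<xi> i))"
    using assms partition_mono[of k p 0 i] by (intro elementary_step) auto
qed

lemma simple_integrand_L2F:
  assumes "simple_integrand M W T k p \<xi>" "i < k" shows "L2F (p i) (\<xi> i)"
proof -
  have m: "\<xi> i \<in> borel_measurable (F (p i))" and "bounded (\<xi> i ` space M)"
    using assms by (auto simp: simple_integrand_def)
  then obtain B where "\<And>\<omega>. \<omega> \<in> space M \<Longrightarrow> norm (\<xi> i \<omega>) \<le> B" by (auto simp: bounded_iff)
  then show ?thesis using m filt_measurable by (auto simp: L2F_def intro: sqint_bounded)
qed

lemma simple_process_measurable:
  assumes "\<And>i. i < k \<Longrightarrow> \<xi> i \<in> borel_measurable M"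
  shows "(\<lambda>(t, \<omega>). simple_process k p \<xi> t \<omega>) \<in> borel_measurable (restrict_space borel {0..T} \<Otimes>\<^sub>M M)"
proof -
  have "(\<lambda>z. indicator {p i<..p (Suc i)} (fst z) *\<^sub>R \<xi> i (snd z)) \<in> borel_measurable (restrict_space borel {0..T} \<Otimes>\<^sub>M M)"
    if "i < k" for i
  proof -
    have [measurable]: "\<xi> i \<in> borel_measurable M" using assms that by simp
    have f: "fst \<in> borel_measurable (restrict_space borel {0..T} \<Otimes>\<^sub>M M)"
      by (rule measurable_compose[OF measurable_fst]) (rule measurable_restrict_space1, simp)
    have "(\<lambda>z. indicat_real {p i<..p (Suc i)} (fst z)) \<in> borel_measurable (restrict_space borel {0..T} \<Otimes>\<^sub>M M)"
      by (rule measurable_compose[OF f]) simp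
    then show ?thesis by simp
  qed
  then show ?thesis
    unfolding simple_process_def split_beta' by (intro borel_measurable_sum) auto
qed

lemma elementary_simple_integrand:
  assumes "simple_integrand M W T k p \<xi>"
  shows "elementary (\<lambda>z. \<Sum>i<k. step (p i) (p (Suc i)) (\<xi> i) z) (simple_integral W k p \<xi>)"
  unfolding simple_integral_eq_incr
  by (rule elementary_partition) (use assms simple_integrand_L2F[OF assms] in \<open>auto simp: simple_integrand_def\<close>)

lemma nn_integral_simple_process_error:
  assumes "L2_adapted M W T g" "simple_integrand M W T k p \<xi>"
  shows "(\<integral>\<^sup>+ \<omega>. (\<integral>\<^sup>+ t\<in>{0..T}. ennreal ((norm (g t \<omega> - simple_process k p \<xi> t \<omega>))\<^sup>2) \<partial>lborel) \<partial>M)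
    = ennreal (sqnorm P (\<lambda>z. (\<Sum>i<k. step (p i) (p (Suc i)) (\<xi> i) z) - cutoff T g z))"
proof -
  define f where "f = (\<lambda>z. \<Sum>i<k. step (p i) (p (Suc i)) (\<xi> i) z)"
  have p: "p 0 = 0" "p k = T" "\<And>i. i < k \<Longrightarrow> p i \<le> p (Suc i)"
    using assms(2) by (auto simp: simple_integrand_def)
  have gm: "(\<lambda>(t, \<omega>). g t \<omega>) \<in> borel_measurable (restrict_space borel {0..T} \<Otimes>\<^sub>M M)"
    using assms(1) by (auto simp: L2_adapted_def)
  have dm: "(\<lambda>(t, \<omega>). g t \<omega> - simple_process k p \<xi> t \<omega>) \<in> borel_measurable (restrict_space borel {0..T} \<Otimes>\<^sub>M M)"
    using borel_measurable_diff[OF gm simple_process_measurable[of k \<xi> p T]]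
      simple_integrand_L2F[OF assms(2)] by (auto simp: split_beta' L2F_def sqint_def)
  have cuteq: "cutoff T (\<lambda>t \<omega>. g t \<omega> - simple_process k p \<xi> t \<omega>) = (\<lambda>z. cutoff T g z - f z)"
  proof
    fix z :: "real \<times> 'w"
    obtain t \<omega> where z: "z = (t, \<omega>)" by force
    have "f z = 0" if "t \<notin> {0..T}"
    proof -
      have "step (p i) (p (Suc i)) (\<xi> i) (t, \<omega>) = 0" if "i < k" for i
        using partition_mono[of k p 0 i] partition_mono[of k p "Suc i" k] p \<open>t \<notin> {0..T}\<close> that
        by (auto simp: step_def indicator_def)
      then show ?thesis by (simp add: f_def z)
    qed
    then show "cutoff T (\<lambda>t \<omega>. g t \<omega> - simple_process k p \<xi> t \<omega>) z = cutoff T g z - f z"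
      using fun_cong[OF simple_process_eq_step[of k p \<xi>], of z]
      by (auto simp: cutoff_def z f_def indicator_def)
  qed
  have sqf: "sqint P f" using elementary_sqint(1)[OF elementary_simple_integrand[OF assms(2)]] by (simp add: f_def)
  show ?thesis
    using nn_integral_cutoff[OF dm] sqint_nn_integralD[OF sqint_diff[OF L2_adapted_cutoff[OF assms(1)] sqf]]
    unfolding cuteq by (simp add: f_def sqnorm_minus_commute[of P "cutoff T g"])
qed

text \<open>
  Only finitely many of the approximation errors can be infinite, so \<open>I\<close> is square-integrable because
  one error is finite.
\<close>
lemma has_ito_imp_ito:
  assumes "has_ito_integral M W T g I" shows "ito (cutoff T g) I"
proof -
  have ad: "L2_adapted M W T g" and Im: "I \<in> borel_measurable M"
    using assms by (auto simp: has_ito_integral_def)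
  obtain k p \<xi> where S: "\<And>m. simple_integrand M W T (k m) (p m) (\<xi> m)"
    and lim1: "(\<lambda>m. \<integral>\<^sup>+ \<omega>. (\<integral>\<^sup>+ t\<in>{0..T}.
             ennreal ((norm (g t \<omega> - simple_process (k m) (p m) (\<xi> m) t \<omega>))\<^sup>2) \<partial>lborel) \<partial>M)
          \<longlonglongrightarrow> 0"
    and lim2: "(\<lambda>m. \<integral>\<^sup>+ \<omega>. ennreal ((I \<omega> - simple_integral W (k m) (p m) (\<xi> m) \<omega>)\<^sup>2) \<partial>M)
          \<longlonglongrightarrow> 0"
    using assms unfolding has_ito_integral_def by blast
  define f where "f m = (\<lambda>z. \<Sum>i<k m. step (p m i) (p m (Suc i)) (\<xi> m i) z)" for m
  define J where "J m = simple_integral W (k m) (p m) (\<xi> m)" for m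
  have el: "elementary (f m) (J m)" for m
    unfolding f_def J_def by (rule elementary_simple_integrand[OF S])
  have sqg: "sqint P (cutoff T g)" by (rule L2_adapted_cutoff[OF ad])
  have n1: "(\<lambda>m. sqnorm P (\<lambda>z. f m z - cutoff T g z)) \<longlonglongrightarrow> 0"
  proof -
    have "(\<lambda>m. ennreal (sqnorm P (\<lambda>z. f m z - cutoff T g z))) \<longlonglongrightarrow> ennreal 0"
      using lim1 unfolding nn_integral_simple_process_error[OF ad S] by (simp add: f_def)
    then show ?thesis by (subst (asm) tendsto_ennreal_iff) auto
  qed
  have "\<forall>\<^sub>F m in sequentially. (\<integral>\<^sup>+ \<omega>. ennreal ((I \<omega> - J m \<omega>)\<^sup>2) \<partial>M) < 1"
    using order_tendstoD(2)[OF lim2, of 1] by (simp add: J_def)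
  then obtain m where "(\<integral>\<^sup>+ \<omega>. ennreal ((I \<omega> - J m \<omega>)\<^sup>2) \<partial>M) < 1"
    using eventually_happens'[OF sequentially_bot] by blast
  then have "sqint M (\<lambda>\<omega>. I \<omega> - J m \<omega>)"
    using Im sqint_measurable[OF elementary_sqint(2)[OF el]]
    by (intro sqint_nn_integralI) (auto dest: order.strict_trans[OF _ ennreal_one_less_top])
  from sqint_add[OF this elementary_sqint(2)[OF el[of m]]] have sqI: "sqint M I" by simp
  have n2: "(\<lambda>m. sqnorm M (\<lambda>\<omega>. J m \<omega> - I \<omega>)) \<longlonglongrightarrow> 0"
  proof -
    have "(\<lambda>m. ennreal (sqnorm M (\<lambda>\<omega>. I \<omega> - J m \<omega>))) \<longlonglongrightarrow> ennreal 0"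
      using lim2 sqint_nn_integralD[OF sqint_diff[OF sqI elementary_sqint(2)[OF el]]] by (simp add: J_def)
    then show ?thesis
      by (subst (asm) tendsto_ennreal_iff) (auto simp: sqnorm_minus_commute[of M I])
  qed
  show ?thesis
    by (rule ito_limit[OF sqg sqI elementary_ito[OF el] n1 n2])
qed

section \<open>Integration over time\<close>

lemma sqint_sections:
  assumes "sqint P h"
  shows "AE u in lborel. sqint M (\<lambda>\<omega>. h (u, \<omega>))" "integrable lborel (\<lambda>u. sqnorm M (\<lambda>\<omega>. h (u, \<omega>)))"
    "sqnorm P h = (LINT u|lborel. sqnorm M (\<lambda>\<omega>. h (u, \<omega>)))"
proof -
  have i: "integrable P (\<lambda>z. (norm (h z))\<^sup>2)" and [measurable]: "h \<in> borel_measurable P"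
    using assms by (auto simp: sqint_def)
  show "AE u in lborel. sqint M (\<lambda>\<omega>. h (u, \<omega>))"
    using P.AE_integrable_fst'[OF i] by eventually_elim (simp add: sqint_def)
  show "integrable lborel (\<lambda>u. sqnorm M (\<lambda>\<omega>. h (u, \<omega>)))"
    using P.integrable_fst'[OF i] by (simp add: sqnorm_def)
  show "sqnorm P h = (LINT u|lborel. sqnorm M (\<lambda>\<omega>. h (u, \<omega>)))"
    using P.integral_fst'[OF i] by (simp add: sqnorm_def)
qed

lemma sqnorm_P_le:
  assumes "sqint P h" "a \<le> b" "\<And>u \<omega>. u \<notin> {a..b} \<Longrightarrow> h (u, \<omega>) = 0"
    and "\<And>u. a < u \<Longrightarrow> u \<le> b \<Longrightarrow> sqnorm M (\<lambda>\<omega>. h (u, \<omega>)) \<le> e"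
  shows "sqnorm P h \<le> (b - a) * e"
proof -
  have "sqnorm P h \<le> (LINT u|lborel. e * indicator {a..b} u)"
    unfolding sqint_sections(3)[OF assms(1)]
  proof (rule integral_mono_AE[OF sqint_sections(2)[OF assms(1)]])
    show "integrable lborel (\<lambda>u. e * indicator {a..b} u)"
      by (intro integrable_mult_right integrable_real_indicator) (use assms(2) in auto)
    have "AE u in lborel. u \<noteq> a" by (rule AE_lborel_singleton)
    then show "AE u in lborel. sqnorm M (\<lambda>\<omega>. h (u, \<omega>)) \<le> e * indicator {a..b} u"
    proof eventually_elim
      fix u :: real assume "u \<noteq> a"
      then show "sqnorm M (\<lambda>\<omega>. h (u, \<omega>)) \<le> e * indicator {a..b} u"
        using assms(3,4)[of u] by (cases "u \<in> {a..b}") (auto simp: sqnorm_def)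
    qed
  qed
  then show ?thesis using assms(2) by (simp add: mult.commute)
qed

lemma sqint_P_I:
  assumes "h \<in> borel_measurable P" "a \<le> b" "\<And>u \<omega>. u \<notin> {a..b} \<Longrightarrow> h (u, \<omega>) = 0"
    and "\<And>u. a \<le> u \<Longrightarrow> u \<le> b \<Longrightarrow> sqint M (\<lambda>\<omega>. h (u, \<omega>)) \<and> sqnorm M (\<lambda>\<omega>. h (u, \<omega>)) \<le> e"
  shows "sqint P h"
proof -
  have "(\<integral>\<^sup>+z. ennreal ((norm (h z))\<^sup>2) \<partial>P) = (\<integral>\<^sup>+u. \<integral>\<^sup>+\<omega>. ennreal ((norm (h (u, \<omega>)))\<^sup>2) \<partial>M \<partial>lborel)"
    using assms(1) by (intro nn_integral_fst[symmetric]) simp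
  also have "\<dots> \<le> (\<integral>\<^sup>+u. ennreal e * indicator {a..b} u \<partial>lborel)"
  proof (rule nn_integral_mono)
    fix u
    show "(\<integral>\<^sup>+\<omega>. ennreal ((norm (h (u, \<omega>)))\<^sup>2) \<partial>M) \<le> ennreal e * indicator {a..b} u"
      using assms(3,4)[of u] by (cases "u \<in> {a..b}") (auto simp: sqint_nn_integralD ennreal_leI)
  qed
  also have "\<dots> < \<infinity>" using assms(2) by (simp add: nn_integral_cmult ennreal_mult_less_top)
  finally show ?thesis by (intro sqint_nn_integralI assms(1)) simp
qed

lemma sqint_P_lift:
  assumes "sqint M Z" "0 \<le> T"
  shows "sqint P (\<lambda>(u, \<omega>). indicator {0..T} u *\<^sub>R Z \<omega>)"
    "sqnorm P (\<lambda>(u, \<omega>). indicator {0..T} u *\<^sub>R Z \<omega>) = T * sqnorm M Z"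
proof -
  have [measurable]: "Z \<in> borel_measurable M" using assms by (simp add: sqint_def)
  have eq: "(\<lambda>z. (norm (case z of (u, \<omega>) \<Rightarrow> indicator {0..T} u *\<^sub>R Z \<omega>))\<^sup>2) = (\<lambda>(u, \<omega>). indicator {0..T} u * (norm (Z \<omega>))\<^sup>2)"
    by (auto simp: indicator_def)
  have i: "integrable P (\<lambda>(u, \<omega>). indicator {0..T} u * (norm (Z \<omega>))\<^sup>2)"
  proof (rule P.Fubini_integrable)
    have "integrable lborel (indicat_real {0..T})"
      by (rule integrable_real_indicator) (use assms(2) in auto)
    then show "integrable lborel (\<lambda>x. expectation (\<lambda>y. norm (case (x, y) of (u, \<omega>) \<Rightarrow> indicator {0..T} u * (norm (Z \<omega>))\<^sup>2)))"
      by (simp add: abs_mult)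
  qed (use assms in \<open>auto simp: sqint_def\<close>)
  show "sqint P (\<lambda>(u, \<omega>). indicator {0..T} u *\<^sub>R Z \<omega>)"
    using i unfolding sqint_def eq by simp
  show "sqnorm P (\<lambda>(u, \<omega>). indicator {0..T} u *\<^sub>R Z \<omega>) = T * sqnorm M Z"
    unfolding sqnorm_def eq using P.integral_fst[OF i] assms(2) by simp
qed

text \<open>
  Cauchy-Schwarz in time bounds the square of the time integral by \<open>T\<close> times the integral of the
  square; the rest is Fubini's theorem.
\<close>
lemma time_integral:
  fixes h :: "real \<times> 'w \<Rightarrow> real"
  assumes h: "sqint P h" "0 \<le> T" "\<And>u \<omega>. u \<notin> {0..T} \<Longrightarrow> h (u, \<omega>) = 0"
  shows "sqint M (\<lambda>\<omega>. LINT u|lborel. h (u, \<omega>))"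
    "sqnorm M (\<lambda>\<omega>. LINT u|lborel. h (u, \<omega>)) \<le> T * sqnorm P h"
    "sqint M Z \<Longrightarrow> expectation (\<lambda>\<omega>. Z \<omega> * (LINT u|lborel. h (u, \<omega>))) = (LINT u|lborel. expectation (\<lambda>\<omega>. Z \<omega> * h (u, \<omega>)))"
    "sqint M Z \<Longrightarrow> integrable lborel (\<lambda>u. expectation (\<lambda>\<omega>. Z \<omega> * h (u, \<omega>)))"
    "AE \<omega> in M. integrable lborel (\<lambda>u. h (u, \<omega>))"
proof -
  have [measurable]: "h \<in> borel_measurable P" using h by (simp add: sqint_def)
  have ih: "integrable P (\<lambda>z. (h z)\<^sup>2)" using h by (simp add: sqint_def)
  then have ih: "integrable P (\<lambda>(u, \<omega>). (h (u, \<omega>))\<^sup>2)" by (simp add: split_beta')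
  have sq: "AE \<omega> in M. integrable lborel (\<lambda>u. (h (u, \<omega>))\<^sup>2)"
    using P.AE_integrable_snd[of "\<lambda>u \<omega>. (h (u, \<omega>))\<^sup>2"] ih by simp
  have isq: "integrable M (\<lambda>\<omega>. LINT u|lborel. (h (u, \<omega>))\<^sup>2)"
    using P.integrable_snd[of "\<lambda>u \<omega>. (h (u, \<omega>))\<^sup>2"] ih by simp
  have Esq: "expectation (\<lambda>\<omega>. LINT u|lborel. (h (u, \<omega>))\<^sup>2) = sqnorm P h"
    using P.integral_snd[of "\<lambda>u \<omega>. (h (u, \<omega>))\<^sup>2"] ih by (simp add: sqnorm_def split_beta')
  have one: "sqint lborel (indicat_real {0..T})" "sqnorm lborel (indicat_real {0..T}) = T"
    using h(2) by (auto simp: sqint_def sqnorm_def power2_eq_square indicator_inter_arith[symmetric]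
        intro!: integrable_real_indicator)
  have hind: "indicator {0..T} u * h (u, \<omega>) = h (u, \<omega>)" for u \<omega> using h(3)[of u \<omega>] by (auto simp: indicator_def)
  have le: "AE \<omega> in M. integrable lborel (\<lambda>u. h (u, \<omega>)) \<and> (LINT u|lborel. h (u, \<omega>))\<^sup>2 \<le> T * (LINT u|lborel. (h (u, \<omega>))\<^sup>2)"
    using sq AE_space
  proof eventually_elim
    fix \<omega> assume i: "integrable lborel (\<lambda>u. (h (u, \<omega>))\<^sup>2)" and "\<omega> \<in> space M"
    then have s: "sqint lborel (\<lambda>u. h (u, \<omega>))" by (simp add: sqint_def)
    show "integrable lborel (\<lambda>u. h (u, \<omega>)) \<and> (LINT u|lborel. h (u, \<omega>))\<^sup>2 \<le> T * (LINT u|lborel. (h (u, \<omega>))\<^sup>2)"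
      using integral_Cauchy_Schwarz[OF one(1) s] sqint_mult[OF one(1) s]
      by (simp add: one(2) hind) (simp add: sqnorm_def)
  qed
  have m: "(\<lambda>\<omega>. LINT u|lborel. h (u, \<omega>)) \<in> borel_measurable M"
  proof (rule lborel.borel_measurable_lebesgue_integral)
    have "(\<lambda>z. h (snd z, fst z)) \<in> borel_measurable (M \<Otimes>\<^sub>M lborel)" by measurable
    then show "(\<lambda>(\<omega>, u). h (u, \<omega>)) \<in> borel_measurable (M \<Otimes>\<^sub>M lborel)" by (simp add: split_beta')
  qed
  show sqI: "sqint M (\<lambda>\<omega>. LINT u|lborel. h (u, \<omega>))"
    unfolding sqint_def
  proof (intro conjI m)
    show "integrable M (\<lambda>\<omega>. (norm (LINT u|lborel. h (u, \<omega>)))\<^sup>2)"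
    proof (rule Bochner_Integration.integrable_bound[OF integrable_mult_right[OF isq, of T]])
      show "AE \<omega> in M. norm ((norm (LINT u|lborel. h (u, \<omega>)))\<^sup>2) \<le> norm (T * (LINT u|lborel. (h (u, \<omega>))\<^sup>2))"
        using le by eventually_elim (use h(2) in \<open>auto simp: abs_mult\<close>)
    qed (use m in auto)
  qed
  show "sqnorm M (\<lambda>\<omega>. LINT u|lborel. h (u, \<omega>)) \<le> T * sqnorm P h"
  proof -
    have "sqnorm M (\<lambda>\<omega>. LINT u|lborel. h (u, \<omega>)) \<le> expectation (\<lambda>\<omega>. T * (LINT u|lborel. (h (u, \<omega>))\<^sup>2))"
      unfolding sqnorm_def using sqI isq le
      by (intro integral_mono_AE) (auto simp: sqint_def elim: AE_mp)
    then show ?thesis by (simp add: Esq)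
  qed
  show "AE \<omega> in M. integrable lborel (\<lambda>u. h (u, \<omega>))" using le by eventually_elim simp
  assume Z: "sqint M Z"
  have "integrable P (\<lambda>z. (case z of (u, \<omega>) \<Rightarrow> indicator {0..T} u *\<^sub>R Z \<omega>) * h z)"
    by (rule sqint_mult[OF sqint_P_lift(1)[OF Z h(2)] h(1)])
  moreover have "(\<lambda>z. (case z of (u, \<omega>) \<Rightarrow> indicator {0..T} u *\<^sub>R Z \<omega>) * h z) = (\<lambda>(u, \<omega>). Z \<omega> * h (u, \<omega>))"
    using h(3) by (fastforce simp: indicator_def)
  ultimately have i: "integrable P (\<lambda>(u, \<omega>). Z \<omega> * h (u, \<omega>))" by simp
  show "integrable lborel (\<lambda>u. expectation (\<lambda>\<omega>. Z \<omega> * h (u, \<omega>)))"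
    using P.integrable_fst[OF i] .
  show "expectation (\<lambda>\<omega>. Z \<omega> * (LINT u|lborel. h (u, \<omega>))) = (LINT u|lborel. expectation (\<lambda>\<omega>. Z \<omega> * h (u, \<omega>)))"
    using P.integral_fst[OF i] P.integral_snd[OF i] by simp
qed

section \<open>Recognising Ito integrals\<close>

lemma sqnorm_step: "s \<le> t \<Longrightarrow> L2F s \<xi> \<Longrightarrow> sqnorm P (step s t \<xi>) = (t - s) * sqnorm M \<xi>"
  using step_inner_same[of s t \<xi> \<xi>] by (simp add: sqnorm_eq_inner)

lemma truncation_tendsto:
  assumes "sqint M \<xi>"
  shows "(\<lambda>n. sqnorm M (\<lambda>\<omega>. (if norm (\<xi> \<omega>) \<le> real n then \<xi> \<omega> else 0) - \<xi> \<omega>)) \<longlonglongrightarrow> 0"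
proof -
  have [measurable]: "\<xi> \<in> borel_measurable M" and i: "integrable M (\<lambda>\<omega>. (norm (\<xi> \<omega>))\<^sup>2)"
    using assms by (auto simp: sqint_def)
  have "(\<lambda>n. expectation (\<lambda>\<omega>. (norm ((if norm (\<xi> \<omega>) \<le> real n then \<xi> \<omega> else 0) - \<xi> \<omega>))\<^sup>2)) \<longlonglongrightarrow> expectation (\<lambda>\<omega>. 0)"
  proof (rule integral_dominated_convergence[where w="\<lambda>\<omega>. (norm (\<xi> \<omega>))\<^sup>2"])
    show "AE \<omega> in M. (\<lambda>n. (norm ((if norm (\<xi> \<omega>) \<le> real n then \<xi> \<omega> else 0) - \<xi> \<omega>))\<^sup>2) \<longlonglongrightarrow> 0"
    proof (intro AE_I2 tendsto_eventually)
      fix \<omega>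
      obtain N where "norm (\<xi> \<omega>) \<le> real N" using real_arch_simple by blast
      then show "\<forall>\<^sub>F n in sequentially. (norm ((if norm (\<xi> \<omega>) \<le> real n then \<xi> \<omega> else 0) - \<xi> \<omega>))\<^sup>2 = 0"
        by (intro eventually_sequentiallyI[of N]) (auto dest: order_trans)
    qed
  qed (use i in auto)
  then show ?thesis by (simp add: sqnorm_def)
qed

text \<open>
  The converse of \<open>has_ito_imp_ito\<close>. Only the integrands have to be approximated, by the isometry the
  integrals follow. The values of a simple integrand have to be bounded, so square-integrable ones are
  truncated.
\<close>
lemma has_ito_integralI:
  assumes ad: "L2_adapted M W T g" and I: "ito (cutoff T g) I"
    and app: "\<And>e. 0 < e \<Longrightarrow> \<exists>k p \<xi>. p 0 = 0 \<and> p k = T \<and> (\<forall>i<k. p i \<le> p (Suc i)) \<and> (\<forall>i<k. L2F (p i) (\<xi> i))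
      \<and> sqnorm P (\<lambda>z. (\<Sum>i<k. step (p i) (p (Suc i)) (\<xi> i) z) - cutoff T g z) < e"
  shows "has_ito_integral M W T g I"
proof -
  have ex: "\<exists>k p \<zeta>. simple_integrand M W T k p \<zeta>
      \<and> sqnorm P (\<lambda>z. (\<Sum>i<k. step (p i) (p (Suc i)) (\<zeta> i) z) - cutoff T g z) < e" if "0 < e" for e
  proof -
    have "0 < e / 4" using that by simp
    from app[OF this] obtain k p \<xi> where p: "p 0 = 0" "p k = T" "\<And>i. i<k \<Longrightarrow> p i \<le> p (Suc i)" "\<And>i. i<k \<Longrightarrow> L2F (p i) (\<xi> i)"
      and close: "sqnorm P (\<lambda>z. (\<Sum>i<k. step (p i) (p (Suc i)) (\<xi> i) z) - cutoff T g z) < e / 4"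
      by blast
    define \<zeta> where "\<zeta> n i \<omega> = (if norm (\<xi> i \<omega>) \<le> real n then \<xi> i \<omega> else 0)" for n i \<omega>
    have S: "simple_integrand M W T k p (\<zeta> n)" for n
    proof -
      have "\<zeta> n i \<in> borel_measurable (F (p i))" if "i < k" for i
      proof -
        have [measurable]: "\<xi> i \<in> borel_measurable (F (p i))" using p(4)[OF that] by (simp add: L2F_def)
        show ?thesis unfolding \<zeta>_def[abs_def] by measurable
      qed
      moreover have "bounded (\<zeta> n i ` space M)" for i
        unfolding bounded_iff \<zeta>_def by (intro exI[of _ "real n"]) auto
      ultimately show ?thesis using p by (auto simp: simple_integrand_def)
    qed
    have L: "L2F (p i) (\<lambda>\<omega>. \<zeta> n i \<omega> - \<xi> i \<omega>)" if "i < k" for i n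
      by (intro L2F_diff simple_integrand_L2F[OF S] p that)
    have "(\<lambda>n. sqnorm P (\<lambda>z. \<Sum>i<k. step (p i) (p (Suc i)) (\<lambda>\<omega>. \<zeta> n i \<omega> - \<xi> i \<omega>) z)) \<longlonglongrightarrow> 0"
    proof (rule sqnorm_sum_tendsto_0)
      fix i assume i: "i \<in> {..<k}"
      show "sqint P (step (p i) (p (Suc i)) (\<lambda>\<omega>. \<zeta> n i \<omega> - \<xi> i \<omega>))" for n
        using i p L by (intro sqint_step) auto
      have "(\<lambda>n. (p (Suc i) - p i) * sqnorm M (\<lambda>\<omega>. \<zeta> n i \<omega> - \<xi> i \<omega>)) \<longlonglongrightarrow> (p (Suc i) - p i) * 0"
        unfolding \<zeta>_def using i p(4) by (intro tendsto_intros truncation_tendsto L2F_sqint) auto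
      then show "(\<lambda>n. sqnorm P (step (p i) (p (Suc i)) (\<lambda>\<omega>. \<zeta> n i \<omega> - \<xi> i \<omega>))) \<longlonglongrightarrow> 0"
        using i p L by (subst sqnorm_step) auto
    qed auto
    then have "\<forall>\<^sub>F n in sequentially. sqnorm P (\<lambda>z. \<Sum>i<k. step (p i) (p (Suc i)) (\<lambda>\<omega>. \<zeta> n i \<omega> - \<xi> i \<omega>) z) < e / 4"
      using that by (intro order_tendstoD(2)) auto
    then obtain n where n: "sqnorm P (\<lambda>z. \<Sum>i<k. step (p i) (p (Suc i)) (\<lambda>\<omega>. \<zeta> n i \<omega> - \<xi> i \<omega>) z) < e / 4"
      using eventually_happens'[OF sequentially_bot] by blast
    have eq: "(\<Sum>i<k. step (p i) (p (Suc i)) (\<lambda>\<omega>. \<zeta> n i \<omega> - \<xi> i \<omega>) z)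
        = (\<Sum>i<k. step (p i) (p (Suc i)) (\<zeta> n i) z) - (\<Sum>i<k. step (p i) (p (Suc i)) (\<xi> i) z)" for z
      by (simp add: step_def split_beta' scaleR_diff_right sum_subtractf)
    have "sqnorm P (\<lambda>z. (\<Sum>i<k. step (p i) (p (Suc i)) (\<zeta> n i) z) - cutoff T g z) < e"
      using sqnorm_triangle_le[OF elementary_sqint(1)[OF elementary_simple_integrand[OF S[of n]]]
          elementary_sqint(1)[OF elementary_partition[of k p \<xi>]] ito_sqint(1)[OF I]] p n close
      unfolding eq by (auto simp: algebra_simps)
    then show ?thesis using S by blast
  qed
  have "\<forall>m. \<exists>q. simple_integrand M W T (fst q) (fst (snd q)) (snd (snd q))
      \<and> sqnorm P (\<lambda>z. (\<Sum>i<fst q. step (fst (snd q) i) (fst (snd q) (Suc i)) (snd (snd q) i) z) - cutoff T g z) < inverse (Suc m)"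
  proof
    fix m
    have "0 < inverse (real (Suc m))" by simp
    from ex[OF this] obtain k p \<zeta> where "simple_integrand M W T k p \<zeta>"
      "sqnorm P (\<lambda>z. (\<Sum>i<k. step (p i) (p (Suc i)) (\<zeta> i) z) - cutoff T g z) < inverse (Suc m)" by blast
    then show "\<exists>q. simple_integrand M W T (fst q) (fst (snd q)) (snd (snd q))
      \<and> sqnorm P (\<lambda>z. (\<Sum>i<fst q. step (fst (snd q) i) (fst (snd q) (Suc i)) (snd (snd q) i) z) - cutoff T g z) < inverse (Suc m)"
      by (intro exI[of _ "(k, p, \<zeta>)"]) simp
  qed
  from choice[OF this] obtain q where q: "\<And>m. simple_integrand M W T (fst (q m)) (fst (snd (q m))) (snd (snd (q m)))"
    "\<And>m. sqnorm P (\<lambda>z. (\<Sum>i<fst (q m). step (fst (snd (q m)) i) (fst (snd (q m)) (Suc i)) (snd (snd (q m)) i) z) - cutoff T g z) < inverse (Suc m)"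
    by blast
  have l0: "(\<lambda>m. sqnorm P (\<lambda>z. (\<Sum>i<fst (q m). step (fst (snd (q m)) i) (fst (snd (q m)) (Suc i)) (snd (snd (q m)) i) z) - cutoff T g z)) \<longlonglongrightarrow> 0"
    by (rule tendsto_0_of_less_inverse) (use q(2) in auto)
  have el: "elementary (\<lambda>z. \<Sum>i<fst (q m). step (fst (snd (q m)) i) (fst (snd (q m)) (Suc i)) (snd (snd (q m)) i) z)
     (simple_integral W (fst (q m)) (fst (snd (q m))) (snd (snd (q m))))" for m
    by (rule elementary_simple_integrand[OF q(1)])
  have I2: "(\<integral>\<^sup>+ \<omega>. ennreal ((I \<omega> - simple_integral W (fst (q m)) (fst (snd (q m))) (snd (snd (q m))) \<omega>)\<^sup>2) \<partial>M)
     = ennreal (sqnorm P (\<lambda>z. (\<Sum>i<fst (q m). step (fst (snd (q m)) i) (fst (snd (q m)) (Suc i)) (snd (snd (q m)) i) z) - cutoff T g z))" for m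
    using sqint_nn_integralD[OF ito_sqint(2)[OF ito_diff[OF I elementary_ito[OF el]]], of m]
      ito_norm[OF ito_diff[OF I elementary_ito[OF el]], of m] by (simp add: sqnorm_minus_commute[of P "cutoff T g"])
  show ?thesis
    unfolding has_ito_integral_def
  proof (intro conjI ad exI)
    show "I \<in> borel_measurable M" using ito_sqint(2)[OF I] by (simp add: sqint_def)
    show "\<forall>m. simple_integrand M W T (fst (q m)) (fst (snd (q m))) (snd (snd (q m)))" using q(1) by simp
  qed (use tendsto_ennrealI[OF l0] in \<open>simp_all add: nn_integral_simple_process_error[OF ad q(1)] I2\<close>)
qed

lemma step_partition_eval:
  assumes "\<And>i. i < k \<Longrightarrow> p i \<le> p (Suc i)" "i < k" "p i < u" "u \<le> p (Suc i)"
  shows "(\<Sum>j<k. step (p j) (p (Suc j)) (\<xi> j) (u, \<omega>)) = \<xi> i \<omega>"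
proof -
  have "step (p j) (p (Suc j)) (\<xi> j) (u, \<omega>) = (if j = i then \<xi> i \<omega> else 0)" if "j < k" for j
  proof (cases j i rule: linorder_cases)
    case less
    then have "p (Suc j) \<le> p i" using assms(2) partition_mono[of k p "Suc j" i] assms(1) by auto
    then show ?thesis using less assms by (auto simp: step_def indicator_def)
  next
    case greater
    then have "p (Suc i) \<le> p j" using that partition_mono[of k p "Suc i" j] assms(1) by auto
    then show ?thesis using greater assms by (auto simp: step_def indicator_def)
  qed (use assms in \<open>auto simp: step_def\<close>)
  then have "(\<Sum>j<k. step (p j) (p (Suc j)) (\<xi> j) (u, \<omega>)) = (\<Sum>j<k. if j = i then \<xi> i \<omega> else 0)"
    by (intro sum.cong) auto
  also have "\<dots> = \<xi> i \<omega>" using assms(2) by simp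
  finally show ?thesis .
qed

lemma partition_interval:
  assumes "p 0 < (u::real)" "u \<le> p k" shows "\<exists>i<k. p i < u \<and> u \<le> p (Suc i)"
  using assms(2)
proof (induction k)
  case (Suc k)
  then show ?case using less_Suc_eq by (cases "u \<le> p k") force+
qed (use assms in auto)

lemma AE_P_fst: assumes "AE u in lborel. Q u" "Measurable.pred lborel Q" shows "AE z in P. Q (fst z)"
proof -
  from assms(1) obtain S where S: "{u \<in> space lborel. \<not> Q u} \<subseteq> S" "emeasure lborel S = 0" "S \<in> sets lborel"
    by (rule AE_E)
  have "S \<times> space M \<in> null_sets P"
    using S(2,3) by (intro null_setsI) (auto simp: emeasure_pair_measure_Times)
  then show ?thesis
    by (rule AE_I') (use S(1) in \<open>auto simp: space_pair_measure\<close>)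
qed

lemma AE_P_neq: "AE z in P. fst z \<noteq> (a::real)"
  by (rule AE_P_fst[OF AE_lborel_singleton]) simp

lemma cutoff_AE_0: "AE z in P. fst z \<le> 0 \<longrightarrow> cutoff t g z = 0"
  using AE_P_neq[of 0] by eventually_elim (auto simp: cutoff_def indicator_def)

text \<open>
  The integrals \<open>K n\<close> are Cauchy in \<open>L\<^sup>2\<close> by the isometry, so Fatou's lemma upgrades their almost sure
  limit to a limit in \<open>L\<^sup>2\<close>.
\<close>
lemma ito_pointwise_limit:
  assumes i: "\<And>n. ito (f n) (K n)" and f: "sqint P f'" "(\<lambda>n. sqnorm P (\<lambda>z. f n z - f' z)) \<longlonglongrightarrow> 0"
    and lim: "AE \<omega> in M. (\<lambda>n. K n \<omega>) \<longlonglongrightarrow> J \<omega>" and J: "J \<in> borel_measurable M"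
  shows "ito f' J"
proof -
  have est: "\<exists>N. \<forall>n\<ge>N. sqint M J \<and> sqnorm M (\<lambda>\<omega>. K n \<omega> - J \<omega>) \<le> e" if "0 < e" for e
  proof -
    have "\<forall>\<^sub>F n in sequentially. sqnorm P (\<lambda>z. f n z - f' z) < e / 4"
      using that by (intro order_tendstoD(2)[OF f(2)]) auto
    then obtain N where N: "\<And>n. N \<le> n \<Longrightarrow> sqnorm P (\<lambda>z. f n z - f' z) < e / 4"
      unfolding eventually_sequentially by blast
    have "sqint M J \<and> sqnorm M (\<lambda>\<omega>. K n \<omega> - J \<omega>) \<le> e" if n: "N \<le> n" for n
    proof -
      have "sqnorm M (\<lambda>\<omega>. K n \<omega> - K l \<omega>) \<le> e" if "N \<le> l" for l
      proof -
        have "sqnorm M (\<lambda>\<omega>. K n \<omega> - K l \<omega>) = sqnorm P (\<lambda>z. f n z - f l z)"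
          by (rule ito_norm[OF ito_diff[OF i i]])
        also have "\<dots> \<le> 2 * sqnorm P (\<lambda>z. f n z - f' z) + 2 * sqnorm P (\<lambda>z. f' z - f l z)"
          by (intro sqnorm_triangle_le ito_sqint[OF i] f)
        finally show ?thesis using N[OF n] N[OF that] by (simp add: sqnorm_minus_commute[of P f'])
      qed
      then show ?thesis
        using sqnorm_limit[of M K "K n" N e J] ito_sqint(2)[OF i] lim J by blast
    qed
    then show ?thesis by blast
  qed
  have sJ: "sqint M J" using est[of 1] by auto
  show ?thesis
  proof (rule ito_limit[OF f(1) sJ i f(2)])
    show "(\<lambda>n. sqnorm M (\<lambda>\<omega>. K n \<omega> - J \<omega>)) \<longlonglongrightarrow> 0"
    proof (rule LIMSEQ_I)
      fix e :: real assume "0 < e"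
      then obtain N where "\<forall>n\<ge>N. sqint M J \<and> sqnorm M (\<lambda>\<omega>. K n \<omega> - J \<omega>) \<le> e / 2" using est[of "e/2"] by auto
      then show "\<exists>N. \<forall>n\<ge>N. norm (sqnorm M (\<lambda>\<omega>. K n \<omega> - J \<omega>) - 0) < e"
        using \<open>0 < e\<close> by (intro exI[of _ N]) (auto intro: le_less_trans)
    qed
  qed
qed

section \<open>The maximal inequality\<close>

text \<open>
  Doob's inequality. On the event \<open>A i\<close> that the level \<open>a\<close> is reached at \<open>q i\<close> for the first time, which is
  known at \<open>q i\<close>, the second moment of \<open>S\<close> does not decrease from \<open>q i\<close> to \<open>T\<close>.
\<close>
lemma maximal_inequality_finite:
  fixes S :: "real \<Rightarrow> 'w \<Rightarrow> real" and q :: "nat \<Rightarrow> real"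
  assumes S: "\<And>t. 0 \<le> t \<Longrightarrow> t \<le> T \<Longrightarrow> L2F t (S t)"
    and mart: "\<And>s t Z. 0 \<le> s \<Longrightarrow> s \<le> t \<Longrightarrow> t \<le> T \<Longrightarrow> L2F s Z \<Longrightarrow> expectation (\<lambda>\<omega>. Z \<omega> * (S t \<omega> - S s \<omega>)) = 0"
    and q: "\<And>i. i \<le> k \<Longrightarrow> 0 \<le> q i \<and> q i \<le> T" "\<And>i j. i \<le> j \<Longrightarrow> j \<le> k \<Longrightarrow> q i \<le> q j"
    and a: "0 < a"
  shows "{\<omega>\<in>space M. \<exists>i\<le>k. a \<le> \<bar>S (q i) \<omega>\<bar>} \<in> sets M"
    "prob {\<omega>\<in>space M. \<exists>i\<le>k. a \<le> \<bar>S (q i) \<omega>\<bar>} \<le> sqnorm M (S T) / a\<^sup>2"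
proof -
  define A where "A i = {\<omega>\<in>space M. a \<le> \<bar>S (q i) \<omega>\<bar> \<and> (\<forall>j<i. \<bar>S (q j) \<omega>\<bar> < a)}" for i
  have T0: "0 \<le> T" using q(1)[of 0] by simp
  have Sm: "S (q i) \<in> borel_measurable (F (q j))" if "i \<le> j" "j \<le> k" for i j
    using S[of "q i"] q(1)[of i] q(2)[of i j] that filt_measurable_mono by (auto simp: L2F_def)
  have AF: "A i \<in> sets (F (q i))" if "i \<le> k" for i
  proof -
    have [measurable]: "S (q j) \<in> borel_measurable (F (q i))" if "j \<le> i" for j
      using Sm[OF that \<open>i \<le> k\<close>] .
    have "{\<omega>\<in>space (F (q i)). a \<le> \<bar>S (q i) \<omega>\<bar>} \<in> sets (F (q i))" by measurable
    moreover have "{\<omega>\<in>space (F (q i)). \<forall>j\<in>{..<i}. \<bar>S (q j) \<omega>\<bar> < a} \<in> sets (F (q i))"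
    proof (rule sets.sets_Collect_finite_All)
      fix j assume "j \<in> {..<i}"
      then have [measurable]: "S (q j) \<in> borel_measurable (F (q i))" using Sm[of j i] \<open>i \<le> k\<close> by auto
      show "{\<omega> \<in> space (F (q i)). \<bar>S (q j) \<omega>\<bar> < a} \<in> sets (F (q i))" by measurable
    qed auto
    ultimately have "{\<omega>\<in>space (F (q i)). a \<le> \<bar>S (q i) \<omega>\<bar>} \<inter> {\<omega>\<in>space (F (q i)). \<forall>j\<in>{..<i}. \<bar>S (q j) \<omega>\<bar> < a} \<in> sets (F (q i))"
      by (rule sets.Int)
    also have "{\<omega>\<in>space (F (q i)). a \<le> \<bar>S (q i) \<omega>\<bar>} \<inter> {\<omega>\<in>space (F (q i)). \<forall>j\<in>{..<i}. \<bar>S (q j) \<omega>\<bar> < a} = A i"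
      by (auto simp: A_def)
    finally show ?thesis .
  qed
  then have AM: "A i \<in> sets M" if "i \<le> k" for i using that sets_filt_subset by blast
  have U: "{\<omega>\<in>space M. \<exists>i\<le>k. a \<le> \<bar>S (q i) \<omega>\<bar>} = (\<Union>i\<le>k. A i)"
  proof (intro set_eqI iffI)
    fix \<omega> assume w: "\<omega> \<in> {\<omega>\<in>space M. \<exists>i\<le>k. a \<le> \<bar>S (q i) \<omega>\<bar>}"
    then obtain i where i: "i \<le> k" "a \<le> \<bar>S (q i) \<omega>\<bar>" by auto
    define m where "m = (LEAST i. a \<le> \<bar>S (q i) \<omega>\<bar>)"
    have "a \<le> \<bar>S (q m) \<omega>\<bar>" "m \<le> i" unfolding m_def by (rule LeastI[of _ i], rule i, rule Least_le, rule i)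
    moreover have "\<bar>S (q j) \<omega>\<bar> < a" if "j < m" for j
      using not_less_Least[of j "\<lambda>i. a \<le> \<bar>S (q i) \<omega>\<bar>"] that by (auto simp: m_def)
    ultimately show "\<omega> \<in> (\<Union>i\<le>k. A i)" using w i by (auto simp: A_def intro!: bexI[of _ m])
  qed (auto simp: A_def)
  show meas: "{\<omega>\<in>space M. \<exists>i\<le>k. a \<le> \<bar>S (q i) \<omega>\<bar>} \<in> sets M" unfolding U using AM by auto
  have disj: "disjoint_family_on A {..k}"
    by (auto simp: disjoint_family_on_def A_def) (metis linorder_neqE_nat not_less)
  have ST: "sqint M (S T)" using S[of T] T0 by (auto simp: L2F_def)
  have ind: "integrable M (\<lambda>\<omega>. indicator (A i) \<omega> * (S T \<omega>)\<^sup>2)" if "i \<le> k" for i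
    using ST AM[OF that] by (intro integrable_mult_indicator[of _ _ "\<lambda>\<omega>. (S T \<omega>)\<^sup>2", simplified]) (auto simp: sqint_def)
  have each: "a\<^sup>2 * prob (A i) \<le> expectation (\<lambda>\<omega>. indicator (A i) \<omega> * (S T \<omega>)\<^sup>2)" if i: "i \<le> k" for i
  proof -
    let ?s = "S (q i)"
    have qi: "0 \<le> q i" "q i \<le> T" using q(1)[OF i] by auto
    have si: "L2F (q i) ?s" by (rule S[OF qi])
    have [measurable]: "A i \<in> sets (F (q i))" "?s \<in> borel_measurable (F (q i))" using AF[OF i] si by (auto simp: L2F_def)
    have Zi: "L2F (q i) (\<lambda>\<omega>. indicator (A i) \<omega> * ?s \<omega>)"
      unfolding L2F_def
    proof
      show m: "(\<lambda>\<omega>. indicator (A i) \<omega> * ?s \<omega>) \<in> borel_measurable (F (q i))" by measurable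
      show "sqint M (\<lambda>\<omega>. indicator (A i) \<omega> * ?s \<omega>)"
        by (rule sqint_bound[OF L2F_sqint[OF si], where C=1]) (use filt_measurable[OF m] in \<open>auto simp: indicator_def\<close>)
    qed
    have D: "sqint M (\<lambda>\<omega>. S T \<omega> - ?s \<omega>)" using ST si by (auto intro: sqint_diff L2F_sqint)
    have i1: "integrable M (\<lambda>\<omega>. indicator (A i) \<omega> * (?s \<omega>)\<^sup>2)"
      using sqint_mult[OF L2F_sqint[OF Zi] L2F_sqint[OF si]] by (simp add: power2_eq_square mult_ac)
    have i2: "integrable M (\<lambda>\<omega>. (indicator (A i) \<omega> * ?s \<omega>) * (S T \<omega> - ?s \<omega>))"
      by (rule sqint_mult[OF L2F_sqint[OF Zi] D])
    have "a\<^sup>2 * prob (A i) = expectation (\<lambda>\<omega>. a\<^sup>2 * indicator (A i) \<omega>)"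
      using AM[OF i] by simp
    also have "\<dots> \<le> expectation (\<lambda>\<omega>. indicator (A i) \<omega> * (?s \<omega>)\<^sup>2 + 2 * ((indicator (A i) \<omega> * ?s \<omega>) * (S T \<omega> - ?s \<omega>)))"
    proof -
      have "expectation (\<lambda>\<omega>. a\<^sup>2 * indicator (A i) \<omega>) \<le> expectation (\<lambda>\<omega>. indicator (A i) \<omega> * (?s \<omega>)\<^sup>2)"
      proof (rule integral_mono[OF _ i1])
        fix \<omega>
        show "a\<^sup>2 * indicator (A i) \<omega> \<le> indicator (A i) \<omega> * (?s \<omega>)\<^sup>2"
          using a power_mono[of a "\<bar>?s \<omega>\<bar>" 2] by (auto simp: indicator_def A_def)
      qed (use AM[OF i] in \<open>auto intro!: integrable_mult_right integrable_real_indicator simp: emeasure_eq_measure\<close>)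
      then show ?thesis using mart[OF qi(1,2) order_refl Zi] i1 i2 by simp
    qed
    also have "\<dots> \<le> expectation (\<lambda>\<omega>. indicator (A i) \<omega> * (S T \<omega>)\<^sup>2)"
    proof (rule integral_mono[OF _ ind[OF i]])
      show "integrable M (\<lambda>\<omega>. indicator (A i) \<omega> * (?s \<omega>)\<^sup>2 + 2 * ((indicator (A i) \<omega> * ?s \<omega>) * (S T \<omega> - ?s \<omega>)))"
        using i1 i2 by auto
      fix \<omega>
      have "(?s \<omega>)\<^sup>2 + 2 * (?s \<omega> * (S T \<omega> - ?s \<omega>)) \<le> (S T \<omega>)\<^sup>2"
        using zero_le_power2[of "S T \<omega> - ?s \<omega>"] by (simp add: power2_eq_square algebra_simps)
      then show "indicator (A i) \<omega> * (?s \<omega>)\<^sup>2 + 2 * ((indicator (A i) \<omega> * ?s \<omega>) * (S T \<omega> - ?s \<omega>)) \<le> indicator (A i) \<omega> * (S T \<omega>)\<^sup>2"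
        by (auto simp: indicator_def)
    qed
    finally show ?thesis .
  qed
  have "a\<^sup>2 * prob (\<Union>i\<le>k. A i) = (\<Sum>i\<le>k. a\<^sup>2 * prob (A i))"
    using AM disj by (subst finite_measure_finite_Union) (auto simp: sum_distrib_left)
  also have "\<dots> \<le> (\<Sum>i\<le>k. expectation (\<lambda>\<omega>. indicator (A i) \<omega> * (S T \<omega>)\<^sup>2))"
    by (intro sum_mono each) auto
  also have "\<dots> = expectation (\<lambda>\<omega>. \<Sum>i\<le>k. indicator (A i) \<omega> * (S T \<omega>)\<^sup>2)"
    by (rule Bochner_Integration.integral_sum[symmetric]) (use ind in auto)
  also have "\<dots> \<le> sqnorm M (S T)"
    unfolding sqnorm_def
  proof (rule integral_mono)
    fix \<omega>
    have "(\<Sum>i\<le>k. indicator (A i) \<omega>) = (indicator (\<Union>i\<le>k. A i) \<omega> :: real)"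
      using disj by (intro indicator_UN_disjoint[symmetric]) auto
    also have "\<dots> \<le> 1" by (auto simp: indicator_def)
    finally show "(\<Sum>i\<le>k. indicator (A i) \<omega> * (S T \<omega>)\<^sup>2) \<le> (norm (S T \<omega>))\<^sup>2"
      by (simp add: sum_distrib_right[symmetric] mult_left_le_one_le sum_nonneg)
    show "integrable M (\<lambda>\<omega>. \<Sum>i\<le>k. indicator (A i) \<omega> * (S T \<omega>)\<^sup>2)"
      by (rule Bochner_Integration.integrable_sum) (use ind in auto)
  qed (use ST in \<open>auto simp: sqint_def\<close>)
  finally show "prob {\<omega>\<in>space M. \<exists>i\<le>k. a \<le> \<bar>S (q i) \<omega>\<bar>} \<le> sqnorm M (S T) / a\<^sup>2"
    unfolding U using a by (simp add: field_simps)
qed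

text \<open>
  The events of the finite inequality for dyadic grids increase. Their union has the same bound, and
  off it a continuous path does not exceed \<open>a\<close> at the dyadic times, hence nowhere.
\<close>
lemma maximal_inequality:
  fixes S :: "real \<Rightarrow> 'w \<Rightarrow> real"
  assumes T: "0 < T" and S: "\<And>t. 0 \<le> t \<Longrightarrow> t \<le> T \<Longrightarrow> L2F t (S t)"
    and mart: "\<And>s t Z. 0 \<le> s \<Longrightarrow> s \<le> t \<Longrightarrow> t \<le> T \<Longrightarrow> L2F s Z \<Longrightarrow> expectation (\<lambda>\<omega>. Z \<omega> * (S t \<omega> - S s \<omega>)) = 0"
    and a: "0 < a"
  obtains C where "C \<in> sets M" "prob C \<le> sqnorm M (S T) / a\<^sup>2"
    "\<And>\<omega> t. \<omega> \<in> space M - C \<Longrightarrow> continuous_on {0..T} (\<lambda>t. S t \<omega>) \<Longrightarrow> 0 \<le> t \<Longrightarrow> t \<le> T \<Longrightarrow> \<bar>S t \<omega>\<bar> \<le> a"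
proof -
  define q where "q n i = real i * T / 2 ^ n" for n i :: nat
  define E where "E n = {\<omega>\<in>space M. \<exists>i\<le>2^n. a \<le> \<bar>S (q n i) \<omega>\<bar>}" for n
  have qT: "0 \<le> q n i" "i \<le> 2 ^ n \<Longrightarrow> q n i \<le> T" for n i
  proof -
    show "0 \<le> q n i" using T by (simp add: q_def)
    assume "i \<le> 2 ^ n"
    then have "real i \<le> 2 ^ n" by (metis of_nat_le_iff of_nat_numeral of_nat_power)
    then show "q n i \<le> T" using T by (simp add: q_def field_simps)
  qed
  have qm: "i \<le> j \<Longrightarrow> q n i \<le> q n j" for n i j
    unfolding q_def using T by (auto intro!: divide_right_mono mult_right_mono)
  have Em: "E n \<in> sets M" "prob (E n) \<le> sqnorm M (S T) / a\<^sup>2" for n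
    unfolding E_def
    by (rule maximal_inequality_finite[where q="q n" and T=T and S=S, OF S mart _ _ a];
        (assumption | rule qm | rule conjI qT)+)+
  have inc: "incseq E"
  proof (rule incseq_SucI)
    fix n
    have "q n i = q (Suc n) (2 * i)" for i by (simp add: q_def)
    then have "\<exists>j\<le>2 ^ Suc n. a \<le> \<bar>S (q (Suc n) j) \<omega>\<bar>" if "i \<le> 2 ^ n" "a \<le> \<bar>S (q n i) \<omega>\<bar>" for i \<omega>
      using that by (intro exI[of _ "2 * i"]) auto
    then show "E n \<subseteq> E (Suc n)" unfolding E_def by blast
  qed
  show ?thesis
  proof
    show "(\<Union>n. E n) \<in> sets M" using Em by auto
    show "prob (\<Union>n. E n) \<le> sqnorm M (S T) / a\<^sup>2"
      using finite_Lim_measure_incseq[OF _ inc] Em by (intro LIMSEQ_le_const2[of "\<lambda>n. prob (E n)"]) auto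
    fix \<omega> t assume \<omega>: "\<omega> \<in> space M - (\<Union>n. E n)" and c: "continuous_on {0..T} (\<lambda>t. S t \<omega>)" and t: "0 \<le> t" "t \<le> T"
    define d where "d n = q n (nat \<lfloor>t * 2 ^ n / T\<rfloor>)" for n
    have fl: "real (nat \<lfloor>t * 2 ^ n / T\<rfloor>) = of_int \<lfloor>t * 2 ^ n / T\<rfloor>" for n
      using t T by simp
    have d: "d n \<le> t" "t - T / 2 ^ n \<le> d n" for n
    proof -
      define y where "y = t * 2 ^ n / T"
      have y: "of_int \<lfloor>y\<rfloor> \<le> y" "y - 1 \<le> of_int \<lfloor>y\<rfloor>" by linarith+
      have "t = y * T / 2 ^ n" "t - T / 2 ^ n = (y - 1) * T / 2 ^ n"
        using T by (auto simp: y_def field_simps)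
      moreover have "of_int \<lfloor>y\<rfloor> * T / 2 ^ n \<le> y * T / 2 ^ n" "(y - 1) * T / 2 ^ n \<le> of_int \<lfloor>y\<rfloor> * T / 2 ^ n"
        using y T by (auto intro!: divide_right_mono mult_right_mono)
      ultimately show "d n \<le> t" "t - T / 2 ^ n \<le> d n" unfolding d_def q_def fl by (auto simp: y_def)
    qed
    have i2: "nat \<lfloor>t * 2 ^ n / T\<rfloor> \<le> 2 ^ n" for n
    proof -
      have "t * 2 ^ n / T \<le> 2 ^ n" using t T by (simp add: field_simps)
      then have "\<lfloor>t * 2 ^ n / T\<rfloor> \<le> 2 ^ n" by (metis floor_mono floor_of_int of_int_numeral of_int_power)
      then show ?thesis by (simp add: nat_le_iff)
    qed
    have "(\<lambda>n. t - T / 2 ^ n) \<longlonglongrightarrow> t - 0"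
      by (intro tendsto_intros LIMSEQ_divide_realpow_zero) auto
    then have low: "(\<lambda>n. t - T / 2 ^ n) \<longlonglongrightarrow> t" by simp
    have lim: "d \<longlonglongrightarrow> t"
      by (rule tendsto_sandwich[OF _ _ low tendsto_const]) (use d in \<open>auto intro!: always_eventually\<close>)
    have "(\<lambda>n. S (d n) \<omega>) \<longlonglongrightarrow> S t \<omega>"
      using qT(1) qT(2)[OF i2] t by (intro continuous_on_tendsto_compose[OF c lim]) (auto simp: d_def)
    then have "(\<lambda>n. \<bar>S (d n) \<omega>\<bar>) \<longlonglongrightarrow> \<bar>S t \<omega>\<bar>" by (rule tendsto_rabs)
    moreover have le: "\<bar>S (d n) \<omega>\<bar> \<le> a" for n
    proof -
      have "\<omega> \<notin> E n" using \<omega> by blast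
      then have "\<not> a \<le> \<bar>S (d n) \<omega>\<bar>" using \<omega> i2[of n] unfolding E_def d_def by blast
      then show ?thesis by simp
    qed
    ultimately show "\<bar>S t \<omega>\<bar> \<le> a" by (intro LIMSEQ_le_const2[of "\<lambda>n. \<bar>S (d n) \<omega>\<bar>"]) auto
  qed
qed

end

section \<open>An Euler scheme for the exponential martingale\<close>

text \<open>
  The stochastic exponential \<open>dN = N \<lambda> dW\<close> with deterministic continuous \<open>\<lambda>\<close> is approximated on \<open>[0,T]\<close>
  by freezing \<open>\<lambda>\<close> and \<open>N\<close> at the points of a uniform grid.
\<close>
locale euler_scheme = brownian M W for M :: "'w measure" and W :: "real \<Rightarrow> 'w \<Rightarrow> real^'d" +
  fixes lam :: "real \<Rightarrow> real^'d" and T L :: real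
  assumes T: "0 < T" and lam_cont: "continuous_on {0..T} lam"
    and lam_bound: "\<And>t. 0 \<le> t \<Longrightarrow> t \<le> T \<Longrightarrow> norm (lam t) \<le> L"
begin

definition grid :: "nat \<Rightarrow> nat \<Rightarrow> real" where "grid n i = real i * T / real n"

text \<open>
  The Euler scheme in closed form. Increments are stopped at \<open>t\<close>, so that factors beyond \<open>t\<close> are \<open>1\<close> and
  one formula serves all times.
\<close>
definition euler_prod :: "nat \<Rightarrow> real \<Rightarrow> nat \<Rightarrow> 'w \<Rightarrow> real" where
  "euler_prod n t i \<omega> = (\<Prod>j<i. 1 + lam (grid n j) \<bullet> (W (min (grid n (Suc j)) t) \<omega> - W (min (grid n j) t) \<omega>))"

definition euler :: "nat \<Rightarrow> real \<Rightarrow> 'w \<Rightarrow> real" where "euler n t = euler_prod n t n"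

lemma grid_0 [simp]: "grid n 0 = 0" by (simp add: grid_def)

lemma grid_n [simp]: "0 < n \<Longrightarrow> grid n n = T" by (simp add: grid_def)

lemma grid_nonneg [simp]: "0 \<le> grid n i" using T by (simp add: grid_def)

lemma grid_mono: "i \<le> j \<Longrightarrow> grid n i \<le> grid n j"
  unfolding grid_def using T by (auto intro!: divide_right_mono mult_right_mono)

lemma grid_le_T: "i \<le> n \<Longrightarrow> grid n i \<le> T"
  using grid_mono[of i n n] T by (cases "n = 0") (auto simp: grid_def)

lemma grid_min_mono: "min (grid n i) t \<le> min (grid n (Suc i)) t"
  by (intro min.mono grid_mono) auto

lemma grid_Suc: "grid n (Suc i) = grid n i + T / n"
  by (simp add: grid_def field_simps add_divide_distrib)

lemma euler_prod_Suc: "euler_prod n t (Suc i) \<omega> = euler_prod n t i \<omega>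
   + incr (min (grid n i) t) (min (grid n (Suc i)) t) (\<lambda>\<omega>. euler_prod n t i \<omega> *\<^sub>R lam (grid n i)) \<omega>"
  by (simp add: euler_prod_def incr_def algebra_simps)

lemma euler_prod_0 [simp]: "euler_prod n t 0 \<omega> = 1" by (simp add: euler_prod_def)

lemma L2F_euler_prod: "0 \<le> t \<Longrightarrow> L2F (min (grid n i) t) (euler_prod n t i)"
proof (induction i)
  case 0 then show ?case using L2F_const[of _ 1] by (simp add: euler_prod_0[abs_def])
next
  case (Suc i)
  have le: "min (grid n i) t \<le> min (grid n (Suc i)) t" using grid_mono[of i "Suc i" n] by auto
  have "L2F (min (grid n (Suc i)) t) (incr (min (grid n i) t) (min (grid n (Suc i)) t) (\<lambda>\<omega>. euler_prod n t i \<omega> *\<^sub>R lam (grid n i)))"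
    using Suc le by (intro L2F_incr L2F_scaleR_const) auto
  then show ?case
    unfolding euler_prod_Suc[abs_def] using Suc le by (intro L2F_add L2F_mono[OF Suc.IH le])
qed

lemma L2F_euler: "0 \<le> t \<Longrightarrow> L2F t (euler n t)"
  unfolding euler_def by (rule L2F_mono[OF L2F_euler_prod]) auto

text \<open>
  Factors whose interval lies before \<open>grid n i\<close> agree for both stopping times, and later ones are \<open>1\<close>.
\<close>
lemma euler_prod_stable:
  assumes "grid n i \<le> t" "i \<le> j" shows "euler_prod n (grid n i) j \<omega> = euler_prod n t i \<omega>"
proof -
  have 1: "euler_prod n (grid n i) i \<omega> = euler_prod n t i \<omega>"
    unfolding euler_prod_def
  proof (rule prod.cong[OF refl])
    fix j assume "j \<in> {..<i}"
    then have "grid n (Suc j) \<le> grid n i" "grid n j \<le> grid n i" by (auto intro!: grid_mono)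
    then show "1 + lam (grid n j) \<bullet> (W (min (grid n (Suc j)) (grid n i)) \<omega> - W (min (grid n j) (grid n i)) \<omega>) =
         1 + lam (grid n j) \<bullet> (W (min (grid n (Suc j)) t) \<omega> - W (min (grid n j) t) \<omega>)"
      using assms by (simp add: min_absorb1)
  qed
  show ?thesis using assms(2)
  proof (induction j rule: dec_induct)
    case (step j)
    have "grid n i \<le> grid n j" "grid n i \<le> grid n (Suc j)" using step by (auto intro!: grid_mono)
    then have "euler_prod n (grid n i) (Suc j) \<omega> = euler_prod n (grid n i) j \<omega>" by (simp add: euler_prod_def min_absorb2)
    then show ?case using step by simp
  qed (rule 1)
qed

text \<open>
  The left end point of the half-open interval \<open>(grid n i, grid n (Suc i)]\<close> that contains the time; at
  grid points it is the previous one, in agreement with \<open>step\<close>.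
\<close>
definition grid_below :: "nat \<Rightarrow> real \<Rightarrow> real" where "grid_below n u = grid n (nat (\<lceil>u * n / T\<rceil> - 1))"

lemma grid_below_interval:
  assumes "0 < n" "grid n i < u" "u \<le> grid n (Suc i)" shows "grid_below n u = grid n i"
proof -
  have "real i < u * n / T" "u * n / T \<le> real i + 1"
    using assms T by (auto simp: grid_def field_simps)
  then have "\<lceil>u * n / T\<rceil> = int i + 1" by (intro ceiling_unique) auto
  then show ?thesis by (simp add: grid_below_def)
qed

lemma grid_below_ex:
  assumes "0 < n" "0 < u" "u \<le> T"
  obtains i where "i < n" "grid n i < u" "u \<le> grid n (Suc i)" "grid_below n u = grid n i"
proof -
  have "\<exists>i<n. grid n i < u \<and> u \<le> grid n (Suc i)"
    using assms by (intro partition_interval) auto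
  then show ?thesis using grid_below_interval[OF assms(1)] that by blast
qed

lemma grid_below_bounds:
  assumes "0 < n" "0 < u" "u \<le> T" shows "0 \<le> grid_below n u" "grid_below n u < u" "u - grid_below n u \<le> T / n"
  using grid_below_ex[OF assms] grid_Suc[of n] grid_nonneg[of n] by (metis, metis, smt (verit))

definition euler_integrand :: "nat \<Rightarrow> real \<Rightarrow> real \<times> 'w \<Rightarrow> real^'d" where
  "euler_integrand n t z = (\<Sum>i<n. step (min (grid n i) t) (min (grid n (Suc i)) t) (\<lambda>\<omega>. euler_prod n t i \<omega> *\<^sub>R lam (grid n i)) z)"

lemma elementary_euler_integrand:
  assumes "0 < n" "0 \<le> t" "t \<le> T" shows "elementary (euler_integrand n t) (\<lambda>\<omega>. euler n t \<omega> - 1)"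
proof -
  have "elementary (\<lambda>z. \<Sum>i<k. step (min (grid n i) t) (min (grid n (Suc i)) t) (\<lambda>\<omega>. euler_prod n t i \<omega> *\<^sub>R lam (grid n i)) z)
    (\<lambda>\<omega>. euler_prod n t k \<omega> - 1)" for k
  proof (induction k)
    case 0 then show ?case using elementary_zero by simp
  next
    case (Suc k)
    have "elementary (step (min (grid n k) t) (min (grid n (Suc k)) t) (\<lambda>\<omega>. euler_prod n t k \<omega> *\<^sub>R lam (grid n k)))
      (incr (min (grid n k) t) (min (grid n (Suc k)) t) (\<lambda>\<omega>. euler_prod n t k \<omega> *\<^sub>R lam (grid n k)))"
      using L2F_euler_prod[OF assms(2), of n k] grid_mono[of k "Suc k" n] assms(2)
      by (intro elementary_step L2F_scaleR_const) auto
    from elementary_add[OF Suc this] show ?case by (simp add: euler_prod_Suc algebra_simps)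
  qed
  from this[of n] show ?thesis by (simp add: euler_integrand_def[abs_def] euler_def)
qed

lemma euler_integrand_eval:
  assumes "0 < n" "0 \<le> t" "t \<le> T"
  shows "euler_integrand n t (u, \<omega>) = (if 0 < u \<and> u \<le> t then euler n (grid_below n u) \<omega> *\<^sub>R lam (grid_below n u) else 0)"
proof (cases "0 < u \<and> u \<le> t")
  case True
  then obtain i where i: "i < n" "grid n i < u" "u \<le> grid n (Suc i)" "grid_below n u = grid n i"
    using grid_below_ex[OF assms(1), of u] assms by auto
  have "euler_integrand n t (u, \<omega>) = euler_prod n t i \<omega> *\<^sub>R lam (grid n i)"
    unfolding euler_integrand_def using i True grid_min_mono
    by (intro step_partition_eval[where p="\<lambda>i. min (grid n i) t" and k=n and i=i]) auto
  also have "euler_prod n t i \<omega> = euler n (grid n i) \<omega>"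
    unfolding euler_def using i True by (subst euler_prod_stable) auto
  finally show ?thesis using True i by simp
next
  case False
  have "step (min (grid n i) t) (min (grid n (Suc i)) t) \<xi> (u, \<omega>) = 0" for i \<xi>
    using False grid_nonneg[of n i] assms(2) by (auto simp: step_def indicator_def simp del: grid_nonneg)
  then show ?thesis using False by (auto simp: euler_integrand_def)
qed

text \<open>
  Each factor of the scheme multiplies the second moment by at most \<open>1 + L\<^sup>2 T / n \<le> e\<^bsup>L\<^sup>2 T / n\<^esup>\<close>.
\<close>
definition euler_bound :: real where "euler_bound = exp (L\<^sup>2 * T)"

lemma euler_bound_nonneg: "0 \<le> euler_bound" by (simp add: euler_bound_def)

lemma sqnorm_scale_vec: "sqnorm M (\<lambda>\<omega>. f \<omega> *\<^sub>R (v::'b::euclidean_space)) = (norm v)\<^sup>2 * sqnorm M (f :: 'w \<Rightarrow> real)"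
  by (simp add: sqnorm_def power_mult_distrib mult.commute)

lemma sqnorm_euler_le:
  assumes "0 < n" "0 \<le> t" "t \<le> T" shows "sqnorm M (euler n t) \<le> euler_bound"
proof -
  have "i \<le> n \<Longrightarrow> sqnorm M (euler_prod n t i) \<le> (1 + L\<^sup>2 * T / n) ^ i" for i
  proof (induction i)
    case 0 then show ?case by (simp add: sqnorm_def prob_space)
  next
    case (Suc i)
    let ?s = "min (grid n i) t" and ?t = "min (grid n (Suc i)) t" and ?\<xi> = "\<lambda>\<omega>. euler_prod n t i \<omega> *\<^sub>R lam (grid n i)"
    have st: "0 \<le> ?s" "?s \<le> ?t" using grid_mono[of i "Suc i" n] assms by auto
    have L: "L2F ?s (euler_prod n t i)" "L2F ?s ?\<xi>" using L2F_euler_prod[OF assms(2)] by (auto intro: L2F_scaleR_const)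
    have "sqnorm M (euler_prod n t (Suc i)) = sqnorm M (\<lambda>\<omega>. incr ?s ?t ?\<xi> \<omega> - (- 1) *\<^sub>R euler_prod n t i \<omega>)"
      by (simp add: euler_prod_Suc[abs_def] add.commute)
    also have "\<dots> = sqnorm M (incr ?s ?t ?\<xi>) + 2 * expectation (\<lambda>\<omega>. euler_prod n t i \<omega> * incr ?s ?t ?\<xi> \<omega>) + sqnorm M (euler_prod n t i)"
      unfolding sqnorm_diff[OF sqint_incr[OF st L(2)] sqint_scaleR[OF L2F_sqint[OF L(1)]]] sqnorm_scaleR
      by (simp add: mult.commute)
    also have "\<dots> = (?t - ?s) * (norm (lam (grid n i)))\<^sup>2 * sqnorm M (euler_prod n t i) + sqnorm M (euler_prod n t i)"
    proof -
      have "sqnorm M (incr ?s ?t ?\<xi>) = (?t - ?s) * expectation (\<lambda>\<omega>. ?\<xi> \<omega> \<bullet> ?\<xi> \<omega>)"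
        unfolding sqnorm_eq_inner using incr_mult_incr_same(2)[OF st L(2) L(2)] by simp
      also have "expectation (\<lambda>\<omega>. ?\<xi> \<omega> \<bullet> ?\<xi> \<omega>) = (norm (lam (grid n i)))\<^sup>2 * sqnorm M (euler_prod n t i)"
        unfolding sqnorm_eq_inner[symmetric] by (rule sqnorm_scale_vec)
      finally show ?thesis using expectation_mult_incr[OF st L(2) L(1)] by (simp add: mult.assoc)
    qed
    also have "\<dots> \<le> (T / n) * L\<^sup>2 * sqnorm M (euler_prod n t i) + sqnorm M (euler_prod n t i)"
    proof -
      have "?t - ?s \<le> T / n" using grid_Suc[of n i] grid_mono[of i "Suc i" n] by linarith
      moreover have "(norm (lam (grid n i)))\<^sup>2 \<le> L\<^sup>2"
        using Suc grid_le_T[of i n] by (intro power_mono lam_bound) auto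
      ultimately show ?thesis using st T by (intro add_right_mono mult_right_mono mult_mono) auto
    qed
    also have "\<dots> = (1 + L\<^sup>2 * T / n) * sqnorm M (euler_prod n t i)" by (simp add: algebra_simps)
    also have "\<dots> \<le> (1 + L\<^sup>2 * T / n) * (1 + L\<^sup>2 * T / n) ^ i"
      using Suc T by (intro mult_left_mono) auto
    finally show ?case by simp
  qed
  from this[of n] have "sqnorm M (euler n t) \<le> (1 + L\<^sup>2 * T / n) ^ n" by (simp add: euler_def)
  also have "\<dots> \<le> exp (L\<^sup>2 * T / n) ^ n" using T by (intro power_mono exp_ge_add_one_self) auto
  also have "\<dots> = euler_bound" using assms(1) by (simp add: euler_bound_def exp_of_nat_mult[symmetric])
  finally show ?thesis .
qed

lemma sqint_euler_integrand: "0 < n \<Longrightarrow> 0 \<le> t \<Longrightarrow> t \<le> T \<Longrightarrow> sqint P (euler_integrand n t)"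
  using elementary_sqint(1)[OF elementary_euler_integrand] .

lemma sqint_euler: "0 \<le> t \<Longrightarrow> sqint M (euler n t)"
  using L2F_euler L2F_sqint by blast

lemma sqint_scale_vec: "sqint M f \<Longrightarrow> sqint M (\<lambda>\<omega>. f \<omega> *\<^sub>R (v::'b::euclidean_space))"
  by (rule sqint_bound[where C="norm v"]) (auto simp: mult.commute sqint_measurable)

lemma sqnorm_euler_increment:
  assumes "0 < n" "0 \<le> s" "s \<le> t" "t \<le> T"
  shows "sqnorm M (\<lambda>\<omega>. euler n t \<omega> - euler n s \<omega>) \<le> (t - s) * (L\<^sup>2 * euler_bound)"
proof -
  have i: "ito (\<lambda>z. euler_integrand n t z - euler_integrand n s z) (\<lambda>\<omega>. (euler n t \<omega> - 1) - (euler n s \<omega> - 1))"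
    using assms by (intro ito_diff elementary_ito elementary_euler_integrand) auto
  have "sqnorm P (\<lambda>z. euler_integrand n t z - euler_integrand n s z) \<le> (t - s) * (L\<^sup>2 * euler_bound)"
  proof (rule sqnorm_P_le)
    fix u assume u: "s < u" "u \<le> t"
    then have "(\<lambda>\<omega>. euler_integrand n t (u, \<omega>) - euler_integrand n s (u, \<omega>)) = (\<lambda>\<omega>. euler n (grid_below n u) \<omega> *\<^sub>R lam (grid_below n u))"
      using assms by (simp add: euler_integrand_eval)
    moreover have "(norm (lam (grid_below n u)))\<^sup>2 * sqnorm M (euler n (grid_below n u)) \<le> L\<^sup>2 * euler_bound"
      using grid_below_bounds[OF assms(1), of u] u assms
      by (intro mult_mono power_mono lam_bound sqnorm_euler_le) auto
    ultimately show "sqnorm M (\<lambda>\<omega>. euler_integrand n t (u, \<omega>) - euler_integrand n s (u, \<omega>)) \<le> L\<^sup>2 * euler_bound"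
      by (simp add: sqnorm_scale_vec)
  qed (use assms in \<open>auto simp: euler_integrand_eval intro!: sqint_diff sqint_euler_integrand\<close>)
  then show ?thesis using ito_norm[OF i] by simp
qed

text \<open>
  The scheme integrates \<open>N \<lambda>\<close> frozen at the grid points. Uniform continuity of \<open>\<lambda>\<close> and the increment
  bound of order \<open>T / n\<close> make the error of freezing uniformly small.
\<close>
lemma euler_frozen_error:
  assumes "0 < e"
  shows "\<exists>N>0. \<forall>n\<ge>N. \<forall>u. 0 < u \<longrightarrow> u \<le> T \<longrightarrow>
    sqnorm M (\<lambda>\<omega>. euler n (grid_below n u) \<omega> *\<^sub>R lam (grid_below n u) - euler n u \<omega> *\<^sub>R lam u) \<le> e"
proof -
  \<comment> \<open>the oscillation of \<open>\<lambda>\<close> that contributes \<open>e / 2\<close> to the error\<close>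
  define \<eta> where "\<eta> = sqrt (e / (4 * euler_bound))"
  have Bp: "0 < euler_bound" by (simp add: euler_bound_def)
  have \<eta>: "0 < \<eta>" using assms Bp by (simp add: \<eta>_def)
  have "uniformly_continuous_on {0..T} lam"
    by (rule compact_uniformly_continuous[OF lam_cont]) auto
  then obtain d where d: "0 < d" "\<And>x y. x \<in> {0..T} \<Longrightarrow> y \<in> {0..T} \<Longrightarrow> dist y x < d \<Longrightarrow> dist (lam y) (lam x) < \<eta>"
    using \<eta> unfolding uniformly_continuous_on_def by metis
  obtain N1 where N1: "T / d < real N1" using reals_Archimedean2 by blast
  obtain N2 where N2: "4 * L\<^sup>2 * (T * (L\<^sup>2 * euler_bound)) / e < real N2" using reals_Archimedean2 by blast
  show ?thesis
  proof (intro exI[of _ "Suc (max N1 N2)"] conjI allI impI)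
    fix n u assume n: "Suc (max N1 N2) \<le> n" and u: "0 < u" "u \<le> T"
    then have n0: "0 < n" and nn: "real N1 \<le> n" "real N2 \<le> n" by auto
    note f = grid_below_bounds[OF n0 u]
    have Td: "T / n < d"
    proof -
      have "T / d < n" using N1 nn by linarith
      then show ?thesis using d(1) n0 by (simp add: divide_less_eq mult.commute)
    qed
    have "dist (lam (grid_below n u)) (lam u) < \<eta>"
      using f Td u by (intro d(2)) (auto simp: dist_real_def)
    then have l1: "(norm (lam (grid_below n u) - lam u))\<^sup>2 \<le> e / (4 * euler_bound)"
      using \<eta> assms Bp power_mono[of "norm (lam (grid_below n u) - lam u)" \<eta> 2] by (auto simp: dist_norm \<eta>_def)
    have eq: "euler n (grid_below n u) \<omega> *\<^sub>R lam (grid_below n u) - euler n u \<omega> *\<^sub>R lam u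
      = euler n (grid_below n u) \<omega> *\<^sub>R (lam (grid_below n u) - lam u) + (euler n (grid_below n u) \<omega> - euler n u \<omega>) *\<^sub>R lam u" for \<omega>
      by (simp add: algebra_simps)
    have "sqnorm M (\<lambda>\<omega>. euler n (grid_below n u) \<omega> *\<^sub>R lam (grid_below n u) - euler n u \<omega> *\<^sub>R lam u)
      \<le> 2 * sqnorm M (\<lambda>\<omega>. euler n (grid_below n u) \<omega> *\<^sub>R (lam (grid_below n u) - lam u)) + 2 * sqnorm M (\<lambda>\<omega>. (euler n (grid_below n u) \<omega> - euler n u \<omega>) *\<^sub>R lam u)"
      unfolding eq using f u by (intro sqnorm_add_le sqint_scale_vec sqint_diff sqint_euler) auto
    also have "\<dots> = 2 * ((norm (lam (grid_below n u) - lam u))\<^sup>2 * sqnorm M (euler n (grid_below n u))) + 2 * ((norm (lam u))\<^sup>2 * sqnorm M (\<lambda>\<omega>. euler n u \<omega> - euler n (grid_below n u) \<omega>))"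
      by (simp add: sqnorm_scale_vec sqnorm_minus_commute[of M "euler n u"])
    also have "\<dots> \<le> 2 * (e / (4 * euler_bound) * euler_bound) + 2 * (L\<^sup>2 * ((T / n) * (L\<^sup>2 * euler_bound)))"
    proof -
      have "sqnorm M (\<lambda>\<omega>. euler n u \<omega> - euler n (grid_below n u) \<omega>) \<le> (u - grid_below n u) * (L\<^sup>2 * euler_bound)"
        using f u n0 by (intro sqnorm_euler_increment) auto
      also have "\<dots> \<le> (T / n) * (L\<^sup>2 * euler_bound)" using f euler_bound_nonneg by (intro mult_right_mono) auto
      finally show ?thesis using l1 f u n0 assms Bp
        by (intro add_mono mult_left_mono mult_mono power_mono lam_bound sqnorm_euler_le) auto
    qed
    also have "2 * (e / (4 * euler_bound) * euler_bound) = e / 2" using Bp by simp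
    also have "2 * (L\<^sup>2 * ((T / n) * (L\<^sup>2 * euler_bound))) \<le> e / 2"
    proof -
      have "4 * L\<^sup>2 * (T * (L\<^sup>2 * euler_bound)) \<le> e * n"
      proof -
        have "4 * L\<^sup>2 * (T * (L\<^sup>2 * euler_bound)) / e \<le> n" using N2 nn by linarith
        then show ?thesis using assms by (simp add: divide_le_eq mult.commute)
      qed
      then show ?thesis using n0 by (simp add: field_simps)
    qed
    finally show "sqnorm M (\<lambda>\<omega>. euler n (grid_below n u) \<omega> *\<^sub>R lam (grid_below n u) - euler n u \<omega> *\<^sub>R lam u) \<le> e" by simp
  qed simp
qed

text \<open>
  Let \<open>D\<close> be the squared distance of two schemes. The isometry expresses \<open>D t\<close> by the distance of the
  frozen integrands, which is \<open>D\<close> itself up to factors and two freezing errors; Gronwall concludes. That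
  \<open>D\<close> is measurable follows from its monotonicity.
\<close>
lemma euler_cauchy:
  assumes "0 < e"
  shows "\<exists>N>0. \<forall>n\<ge>N. \<forall>m\<ge>N. \<forall>t. 0 \<le> t \<longrightarrow> t \<le> T \<longrightarrow> sqnorm M (\<lambda>\<omega>. euler n t \<omega> - euler m t \<omega>) \<le> e"
proof -
  \<comment> \<open>chosen so that Gronwall's bound \<open>6 e' T exp (4 L\<^sup>2 T)\<close> is \<open>e\<close>\<close>
  define e' where "e' = e / (6 * T * exp (4 * L\<^sup>2 * T))"
  have e': "0 < e'" using assms T by (simp add: e'_def)
  obtain N where N: "0 < N" "\<And>n u. N \<le> n \<Longrightarrow> 0 < u \<Longrightarrow> u \<le> T \<Longrightarrow>
    sqnorm M (\<lambda>\<omega>. euler n (grid_below n u) \<omega> *\<^sub>R lam (grid_below n u) - euler n u \<omega> *\<^sub>R lam u) \<le> e'"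
    using euler_frozen_error[OF e'] by blast
  show ?thesis
  proof (intro exI[of _ N] conjI allI impI N(1))
    fix n m t assume nm: "N \<le> n" "N \<le> m" and t: "0 \<le> t" "t \<le> (T::real)"
    have n0: "0 < n" "0 < m" using nm N(1) by auto
    define D where "D t = sqnorm M (\<lambda>\<omega>. euler n t \<omega> - euler m t \<omega>)" for t
    have sq: "sqint P (\<lambda>z. euler_integrand n t z - euler_integrand m t z)" if "0 \<le> t" "t \<le> T" for t
      using that n0 by (intro sqint_diff sqint_euler_integrand)
    have D: "D t = sqnorm P (\<lambda>z. euler_integrand n t z - euler_integrand m t z)" if "0 \<le> t" "t \<le> T" for t
    proof -
      have "ito (\<lambda>z. euler_integrand n t z - euler_integrand m t z) (\<lambda>\<omega>. (euler n t \<omega> - 1) - (euler m t \<omega> - 1))"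
        using that n0 by (intro ito_diff elementary_ito elementary_euler_integrand)
      then show ?thesis using ito_norm by (fastforce simp: D_def)
    qed
    have mono: "D s \<le> D t" if "0 \<le> s" "s \<le> t" "t \<le> T" for s t
    proof -
      have "norm (euler_integrand n s z - euler_integrand m s z) \<le> norm (euler_integrand n t z - euler_integrand m t z)" for z
        using that n0 by (cases z) (simp add: euler_integrand_eval)
      then show ?thesis using that sq[of s] sq[of t] by (auto simp: D intro!: sqnorm_mono)
    qed
    have Dint: "set_integrable lborel {0..T} D"
    proof -
      have "mono_on {0..T} D" using mono by (auto intro!: mono_onI)
      then have "D \<in> borel_measurable (restrict_space borel {0..T})"
        by (rule borel_measurable_mono_on_fnc)
      then have m: "(\<lambda>s. indicator {0..T} s *\<^sub>R D s) \<in> borel_measurable lborel"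
        by (subst (asm) borel_measurable_restrict_space_iff) auto
      show ?thesis
        unfolding set_integrable_def
      proof (rule Bochner_Integration.integrable_bound)
        show "integrable lborel (\<lambda>s. D T * indicator {0..T} s)"
          by (intro integrable_mult_right integrable_real_indicator) (use T in auto)
        show "AE s in lborel. norm (indicator {0..T} s *\<^sub>R D s) \<le> norm (D T * indicator {0..T} s)"
          using mono[of _ T] by (intro AE_I2) (auto simp: indicator_def D_def)
      qed (rule m)
    qed
    have "D t \<le> (6 * e' * T) * exp ((4 * L\<^sup>2) * t)"
    proof (rule gronwall[OF Dint _ _ _ t])
      fix t assume t: "0 \<le> t" "t \<le> T"
      have it: "set_integrable lborel {0..t} D"
        by (rule set_integrable_subset[OF Dint]) (use t in auto)
      have i6: "set_integrable lborel {0..t} (\<lambda>u. 6 * e')"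
        using t by (auto simp: set_integrable_def intro!: integrable_real_indicator)
      have i4: "set_integrable lborel {0..t} (\<lambda>u. 4 * L\<^sup>2 * D u)"
        using it by (rule set_integrable_mult_right)
      have "D t = (LINT u|lborel. sqnorm M (\<lambda>\<omega>. euler_integrand n t (u, \<omega>) - euler_integrand m t (u, \<omega>)))"
        unfolding D[OF t] by (rule sqint_sections(3)[OF sq[OF t]])
      also have "\<dots> \<le> (LINT u:{0..t}|lborel. 6 * e' + 4 * L\<^sup>2 * D u)"
        unfolding set_lebesgue_integral_def
      proof (rule integral_mono_AE[OF sqint_sections(2)[OF sq[OF t]]])
        show "integrable lborel (\<lambda>u. indicator {0..t} u *\<^sub>R (6 * e' + 4 * L\<^sup>2 * D u))"
          using set_integral_add(1)[OF i6 i4] by (simp add: set_integrable_def)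
        show "AE u in lborel. sqnorm M (\<lambda>\<omega>. euler_integrand n t (u, \<omega>) - euler_integrand m t (u, \<omega>)) \<le> indicator {0..t} u *\<^sub>R (6 * e' + 4 * L\<^sup>2 * D u)"
        proof (rule AE_I2)
          fix u
          show "sqnorm M (\<lambda>\<omega>. euler_integrand n t (u, \<omega>) - euler_integrand m t (u, \<omega>)) \<le> indicator {0..t} u *\<^sub>R (6 * e' + 4 * L\<^sup>2 * D u)"
          proof (cases "0 < u \<and> u \<le> t")
            case True
            then have u: "0 < u" "u \<le> T" using t by auto
            let ?a = "\<lambda>n \<omega>. euler n (grid_below n u) \<omega> *\<^sub>R lam (grid_below n u)" and ?b = "\<lambda>n \<omega>. euler n u \<omega> *\<^sub>R lam u"
            have sa: "sqint M (?a k)" "sqint M (?b k)" if "0 < k" for k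
              using grid_below_bounds[OF that u] u by (auto intro!: sqint_scale_vec sqint_euler)
            \<comment> \<open>two triangle inequalities: freezing errors enter with weights 2 and 4\<close>
            have "sqnorm M (\<lambda>\<omega>. ?a n \<omega> - ?a m \<omega>) \<le> 2 * sqnorm M (\<lambda>\<omega>. ?a n \<omega> - ?b n \<omega>) + 2 * sqnorm M (\<lambda>\<omega>. ?b n \<omega> - ?a m \<omega>)"
              using n0 by (intro sqnorm_triangle_le sa)
            also have "sqnorm M (\<lambda>\<omega>. ?b n \<omega> - ?a m \<omega>) \<le> 2 * sqnorm M (\<lambda>\<omega>. ?b n \<omega> - ?b m \<omega>) + 2 * sqnorm M (\<lambda>\<omega>. ?b m \<omega> - ?a m \<omega>)"
              using n0 by (intro sqnorm_triangle_le sa)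
            also have "sqnorm M (\<lambda>\<omega>. ?b n \<omega> - ?b m \<omega>) = (norm (lam u))\<^sup>2 * D u"
              by (simp add: scaleR_diff_left[symmetric] sqnorm_scale_vec D_def)
            also have "\<dots> \<le> L\<^sup>2 * D u"
              using u by (intro mult_right_mono power_mono lam_bound) (auto simp: D_def)
            finally have "sqnorm M (\<lambda>\<omega>. ?a n \<omega> - ?a m \<omega>) \<le> 6 * e' + 4 * L\<^sup>2 * D u"
              using N(2)[OF nm(1) u] N(2)[OF nm(2) u] by (simp add: sqnorm_minus_commute[of M "?b m"])
            then show ?thesis using True t n0 by (simp add: euler_integrand_eval)
          next
            case False
            then have "euler_integrand n t (u, \<omega>) = 0" "euler_integrand m t (u, \<omega>) = 0" for \<omega>
              using t n0 by (auto simp: euler_integrand_eval)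
            then have "sqnorm M (\<lambda>\<omega>. euler_integrand n t (u, \<omega>) - euler_integrand m t (u, \<omega>)) = 0" by (simp add: sqnorm_def)
            then show ?thesis using e' by (simp add: D_def)
          qed
        qed
      qed
      also have "\<dots> = 6 * e' * t + 4 * L\<^sup>2 * (LINT u:{0..t}|lborel. D u)"
        using t by (subst set_integral_add(2)[OF i6 i4]) (simp add: set_lebesgue_integral_def)
      also have "\<dots> \<le> 6 * e' * T + 4 * L\<^sup>2 * (LINT u:{0..t}|lborel. D u)"
        using e' t by simp
      finally show "D t \<le> 6 * e' * T + 4 * L\<^sup>2 * (LINT u:{0..t}|lborel. D u)" .
    qed (use e' T in auto)
    also have "\<dots> \<le> (6 * e' * T) * exp (4 * L\<^sup>2 * T)"
      using t e' T by (intro mult_left_mono) (auto intro: mult_left_mono)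
    also have "\<dots> = e" using T by (simp add: e'_def)
    finally show "sqnorm M (\<lambda>\<omega>. euler n t \<omega> - euler m t \<omega>) \<le> e" by (simp add: D_def)
  qed
qed

lemma euler_martingale:
  assumes "0 < n" "0 \<le> s" "s \<le> t" "t \<le> T" "L2F s Z"
  shows "expectation (\<lambda>\<omega>. Z \<omega> * (euler n t \<omega> - euler n s \<omega>)) = 0"
proof -
  have "ito (\<lambda>z. euler_integrand n t z - euler_integrand n s z) (\<lambda>\<omega>. (euler n t \<omega> - 1) - (euler n s \<omega> - 1))"
    using assms by (intro ito_diff elementary_ito elementary_euler_integrand) auto
  then have i: "ito (\<lambda>z. euler_integrand n t z - euler_integrand n s z) (\<lambda>\<omega>. euler n t \<omega> - euler n s \<omega>)" by simp
  have "euler_integrand n t z - euler_integrand n s z = 0" if "fst z \<le> s" for z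
    using that assms by (cases z) (auto simp: euler_integrand_eval)
  then show ?thesis by (intro ito_orthogonal_past[OF i assms(2,5)]) auto
qed

end

section \<open>The exponential martingale\<close>

context euler_scheme
begin

text \<open>
  The rate \<open>8\<^sup>-\<^sup>k\<close> leaves room for the thresholds \<open>2\<^sup>-\<^sup>k\<close> in the maximal inequality, with probabilities
  \<open>8\<^sup>-\<^sup>k / 4\<^sup>-\<^sup>k = 2\<^sup>-\<^sup>k\<close> that are summable.
\<close>
lemma rapid_sequence:
  obtains nk :: "nat \<Rightarrow> nat" where "\<And>k. k < nk k"
    "\<And>k l t. k \<le> l \<Longrightarrow> 0 \<le> t \<Longrightarrow> t \<le> T \<Longrightarrow> sqnorm M (\<lambda>\<omega>. euler (nk k) t \<omega> - euler (nk l) t \<omega>) \<le> (1/8) ^ k"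
proof -
  have "\<forall>k. \<exists>N>0. \<forall>n\<ge>N. \<forall>m\<ge>N. \<forall>t. 0 \<le> t \<longrightarrow> t \<le> T \<longrightarrow> sqnorm M (\<lambda>\<omega>. euler n t \<omega> - euler m t \<omega>) \<le> (1/8) ^ k"
    by (intro allI euler_cauchy) simp
  from choice[OF this] obtain N where N: "\<And>k. 0 < N k"
    "\<And>k n m t. N k \<le> n \<Longrightarrow> N k \<le> m \<Longrightarrow> 0 \<le> t \<Longrightarrow> t \<le> T \<Longrightarrow> sqnorm M (\<lambda>\<omega>. euler n t \<omega> - euler m t \<omega>) \<le> (1/8) ^ k"
    by blast
  \<comment> \<open>summing the thresholds makes the sequence strictly increasing\<close>
  define nk where "nk k = (\<Sum>j\<le>k. N j)" for k
  have ge: "N k \<le> nk l" if "k \<le> l" for k l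
    unfolding nk_def using that by (intro member_le_sum) auto
  have "k < nk k" for k
  proof (induction k)
    case 0 then show ?case using N(1)[of 0] by (simp add: nk_def)
  next
    case (Suc k) then show ?case using N(1)[of "Suc k"] by (simp add: nk_def)
  qed
  then show ?thesis using N(2) ge by (intro that[of nk]) auto
qed

text \<open>
  By the maximal inequality and the Borel-Cantelli lemma the rapid sequence is uniformly Cauchy on
  almost every path. Its limit is set to \<open>1\<close> on the exceptional null set, where it is then continuous
  too; it is adapted because null sets are in the filtration. Convergence in \<open>L\<^sup>2\<close> carries the integral
  equation to the limit.
\<close>
lemma exp_martingale_exists:
  obtains N :: "real \<Rightarrow> 'w \<Rightarrow> real" where
    "\<And>\<omega>. continuous_on {0..T} (\<lambda>t. N t \<omega>)"
    "\<And>t. 0 \<le> t \<Longrightarrow> t \<le> T \<Longrightarrow> L2F t (N t)"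
    "\<And>t. 0 \<le> t \<Longrightarrow> t \<le> T \<Longrightarrow> ito (cutoff t (\<lambda>u \<omega>. N u \<omega> *\<^sub>R lam u)) (\<lambda>\<omega>. N t \<omega> - 1)"
proof -
  obtain nk where nk: "\<And>k. k < nk k"
    "\<And>k l t. k \<le> l \<Longrightarrow> 0 \<le> t \<Longrightarrow> t \<le> T \<Longrightarrow> sqnorm M (\<lambda>\<omega>. euler (nk k) t \<omega> - euler (nk l) t \<omega>) \<le> (1/8) ^ k"
    using rapid_sequence by blast
  have nk0: "0 < nk k" for k using nk(1)[of k] by simp
  define V where "V k = euler (nk k)" for k
  have "\<forall>k. \<exists>C. C \<in> sets M \<and> prob C \<le> (1/2) ^ k \<and>
    (\<forall>\<omega> t. \<omega> \<in> space M - C \<longrightarrow> continuous_on {0..T} (\<lambda>t. V (Suc k) t \<omega> - V k t \<omega>) \<longrightarrow> 0 \<le> t \<longrightarrow> t \<le> T \<longrightarrow>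
      \<bar>V (Suc k) t \<omega> - V k t \<omega>\<bar> \<le> (1/2) ^ k)"
  proof
    fix k
    have L2: "L2F t (\<lambda>\<omega>. V (Suc k) t \<omega> - V k t \<omega>)" if "0 \<le> t" for t
      unfolding V_def using that by (intro L2F_diff L2F_euler)
    have mart: "expectation (\<lambda>\<omega>. Z \<omega> * ((V (Suc k) t \<omega> - V k t \<omega>) - (V (Suc k) s \<omega> - V k s \<omega>))) = 0"
      if st: "0 \<le> s" "s \<le> t" "t \<le> T" and Z: "L2F s Z" for s t Z
    proof -
      have i: "integrable M (\<lambda>\<omega>. Z \<omega> * (V j t \<omega> - V j s \<omega>))" for j
        unfolding V_def using st by (intro sqint_mult L2F_sqint[OF Z] sqint_diff sqint_euler) auto
      have "expectation (\<lambda>\<omega>. Z \<omega> * (V (Suc k) t \<omega> - V (Suc k) s \<omega>) - Z \<omega> * (V k t \<omega> - V k s \<omega>)) = 0"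
        using euler_martingale[OF nk0 st Z] i by (simp add: V_def)
      then show ?thesis by (simp add: algebra_simps)
    qed
    have p2: "0 < (1/2::real) ^ k" by simp
    obtain C where C: "C \<in> sets M" "prob C \<le> sqnorm M (\<lambda>\<omega>. V (Suc k) T \<omega> - V k T \<omega>) / ((1/2) ^ k)\<^sup>2"
      "\<And>\<omega> t. \<omega> \<in> space M - C \<Longrightarrow> continuous_on {0..T} (\<lambda>t. V (Suc k) t \<omega> - V k t \<omega>) \<Longrightarrow> 0 \<le> t \<Longrightarrow> t \<le> T \<Longrightarrow> \<bar>V (Suc k) t \<omega> - V k t \<omega>\<bar> \<le> (1/2) ^ k"
      using maximal_inequality[OF T, of "\<lambda>t \<omega>. V (Suc k) t \<omega> - V k t \<omega>", OF L2 mart p2] by blast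
    have "sqnorm M (\<lambda>\<omega>. V (Suc k) T \<omega> - V k T \<omega>) / ((1/2) ^ k)\<^sup>2 \<le> (1/8) ^ k / ((1/2) ^ k)\<^sup>2"
      using nk(2)[of k "Suc k" T] T by (intro divide_right_mono) (auto simp: V_def sqnorm_minus_commute[of M "euler (nk (Suc k)) T"])
    also have "\<dots> = (1/2) ^ k" 
    proof -
      have "(1/8::real) ^ k = (1/2) ^ k * ((1/2) ^ k)\<^sup>2"
        unfolding power2_eq_square power_mult_distrib[symmetric] by simp
      then show ?thesis by simp
    qed
    finally show "\<exists>C. C \<in> sets M \<and> prob C \<le> (1/2) ^ k \<and>
    (\<forall>\<omega> t. \<omega> \<in> space M - C \<longrightarrow> continuous_on {0..T} (\<lambda>t. V (Suc k) t \<omega> - V k t \<omega>) \<longrightarrow> 0 \<le> t \<longrightarrow> t \<le> T \<longrightarrow>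
      \<bar>V (Suc k) t \<omega> - V k t \<omega>\<bar> \<le> (1/2) ^ k)"
      using C by (intro exI[of _ C]) auto
  qed
  from choice[OF this] obtain C where C: "\<And>k. C k \<in> sets M" "\<And>k. prob (C k) \<le> (1/2) ^ k"
    "\<And>k \<omega> t. \<omega> \<in> space M - C k \<Longrightarrow> continuous_on {0..T} (\<lambda>t. V (Suc k) t \<omega> - V k t \<omega>) \<Longrightarrow> 0 \<le> t \<Longrightarrow> t \<le> T \<Longrightarrow>
      \<bar>V (Suc k) t \<omega> - V k t \<omega>\<bar> \<le> (1/2) ^ k"
    by blast
  have "AE \<omega> in M. \<forall>\<^sub>F k in sequentially. \<omega> \<in> space M - C k"
  proof (rule borel_cantelli_AE1[OF C(1)])
    show "summable (\<lambda>k. prob (C k))"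
      by (rule summable_comparison_test'[where g="\<lambda>k. (1/2) ^ k" and N=0]) (use C(2) in \<open>auto intro: summable_geometric\<close>)
  qed (simp add: emeasure_eq_measure)
  moreover have "AE \<omega> in M. continuous_on {0..} (\<lambda>t. W t \<omega>)"
    using BM by (simp add: brownian_motion_def)
  ultimately have "AE \<omega> in M. (\<forall>\<^sub>F k in sequentially. \<omega> \<in> space M - C k) \<and> continuous_on {0..} (\<lambda>t. W t \<omega>)"
    by eventually_elim simp
  then obtain Q where Q:
    "\<And>\<omega>. \<omega> \<in> space M - Q \<Longrightarrow> (\<forall>\<^sub>F k in sequentially. \<omega> \<in> space M - C k) \<and> continuous_on {0..} (\<lambda>t. W t \<omega>)"
    "Q \<in> null_sets M" by (rule AE_E3) (rule that)
  define G where "G = space M - Q"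
  have AEG: "AE \<omega> in M. \<omega> \<in> G" unfolding G_def using AE_not_in[OF Q(2)] AE_space by eventually_elim auto
  have GF: "G \<in> sets (F t)" for t
    unfolding G_def using sets.top[of "F t"] null_sets_filt[OF Q(2)] by (auto intro: sets.Diff)
  have Vc: "continuous_on {0..T} (\<lambda>t. V k t \<omega>)" if "\<omega> \<in> G" for k \<omega>
  proof -
    have W: "continuous_on {0..} (\<lambda>t. W t \<omega>)" using Q(1) that by (auto simp: G_def)
    have "continuous_on {0..T} (\<lambda>t. W (min (grid n j) t) \<omega>)" for n j
      by (rule continuous_on_compose2[OF W]) (auto intro!: continuous_intros)
    then show ?thesis unfolding V_def euler_def euler_prod_def by (intro continuous_intros)
  qed
  \<comment> \<open>on the null set complementary to \<open>G\<close> the paths are constant, hence continuous\<close>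
  define N where "N t \<omega> = (if \<omega> \<in> G then lim (\<lambda>k. V k t \<omega>) else 1)" for t \<omega>
  have unif: "uniform_limit {0..T} (\<lambda>k t. V k t \<omega>) (\<lambda>t. N t \<omega>) sequentially" if \<omega>: "\<omega> \<in> G" for \<omega>
  proof -
    have "\<forall>\<^sub>F k in sequentially. \<forall>t\<in>{0..T}. norm (V (Suc k) t \<omega> - V k t \<omega>) \<le> (1/2) ^ k"
    proof -
      have "\<forall>\<^sub>F k in sequentially. \<omega> \<in> space M - C k" using Q(1) \<omega> by (auto simp: G_def)
      then show ?thesis
      proof eventually_elim
        case (elim k)
        then show ?case using C(3)[OF elim continuous_on_diff[OF Vc[OF \<omega>] Vc[OF \<omega>]]] by auto
      qed
    qed
    then have "uniform_limit {0..T} (\<lambda>n t. \<Sum>k<n. V (Suc k) t \<omega> - V k t \<omega>) (\<lambda>t. suminf (\<lambda>k. V (Suc k) t \<omega> - V k t \<omega>)) sequentially"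
      by (rule Weierstrass_m_test_ev) (auto intro: summable_geometric)
    moreover have "(\<lambda>n t. \<Sum>k<n. V (Suc k) t \<omega> - V k t \<omega>) = (\<lambda>n t. V n t \<omega> - V 0 t \<omega>)"
      by (intro ext) (rule sum_lessThan_telescope)
    ultimately have "uniform_limit {0..T} (\<lambda>n t. V n t \<omega> - V 0 t \<omega>) (\<lambda>t. suminf (\<lambda>k. V (Suc k) t \<omega> - V k t \<omega>)) sequentially"
      by simp
    then have "uniform_limit {0..T} (\<lambda>n t. V 0 t \<omega> + (V n t \<omega> - V 0 t \<omega>)) (\<lambda>t. V 0 t \<omega> + suminf (\<lambda>k. V (Suc k) t \<omega> - V k t \<omega>)) sequentially"
      by (intro uniform_limit_add uniform_limit_const)
    then have l: "uniform_limit {0..T} (\<lambda>n t. V n t \<omega>) (\<lambda>t. V 0 t \<omega> + suminf (\<lambda>k. V (Suc k) t \<omega> - V k t \<omega>)) sequentially"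
      by simp
    have eq: "N t \<omega> = V 0 t \<omega> + suminf (\<lambda>k. V (Suc k) t \<omega> - V k t \<omega>)" if "t \<in> {0..T}" for t
      using limI[OF tendsto_uniform_limitI[OF l that]] \<omega> by (simp add: N_def)
    show ?thesis by (rule iffD1[OF uniform_limit_cong' l]) (use eq in auto)
  qed
  have Ncont: "continuous_on {0..T} (\<lambda>t. N t \<omega>)" for \<omega>
  proof (cases "\<omega> \<in> G")
    case True
    show ?thesis
      by (rule uniform_limit_theorem[OF _ unif[OF True]]) (auto intro: always_eventually Vc[OF True])
  qed (simp add: N_def)
  have Nlim: "(\<lambda>k. V k t \<omega>) \<longlonglongrightarrow> N t \<omega>" if "\<omega> \<in> G" "0 \<le> t" "t \<le> T" for t \<omega>
    using tendsto_uniform_limitI[OF unif[OF that(1)]] that by simp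
  have Nm: "N t \<in> borel_measurable (F t)" if t: "0 \<le> t" "t \<le> T" for t
  proof (rule borel_measurable_LIMSEQ_metric)
    fix k
    have [measurable]: "V k t \<in> borel_measurable (F t)" using L2F_euler[OF t(1)] by (simp add: V_def L2F_def)
    note GF[measurable]
    show "(\<lambda>\<omega>. if \<omega> \<in> G then V k t \<omega> else 1) \<in> borel_measurable (F t)" by measurable
  next
    fix \<omega>
    show "(\<lambda>k. if \<omega> \<in> G then V k t \<omega> else 1) \<longlonglongrightarrow> N t \<omega>"
      using Nlim[OF _ t] by (cases "\<omega> \<in> G") (auto simp: N_def)
  qed
  have sqN: "sqint M (N t) \<and> sqnorm M (\<lambda>\<omega>. V k t \<omega> - N t \<omega>) \<le> (1/8) ^ k" if t: "0 \<le> t" "t \<le> T" for t k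
  proof -
    have "AE \<omega> in M. (\<lambda>l. V l t \<omega>) \<longlonglongrightarrow> N t \<omega>" using AEG by eventually_elim (rule Nlim[OF _ t])
    then show ?thesis
      using sqnorm_limit[of M "\<lambda>l. V l t" "V k t" k "(1/8) ^ k" "N t"] nk(2)[OF _ t] sqint_euler[OF t(1)]
        filt_measurable[OF Nm[OF t]] by (auto simp: V_def)
  qed
  have L2N: "L2F t (N t)" if "0 \<le> t" "t \<le> T" for t
    using Nm[OF that] sqN[OF that] by (simp add: L2F_def)
  have sqN_bound: "sqnorm M (N t) \<le> 2 * euler_bound + 2" if t: "0 \<le> t" "t \<le> T" for t
  proof -
    have "sqnorm M (\<lambda>\<omega>. V 0 t \<omega> + (N t \<omega> - V 0 t \<omega>)) \<le> 2 * sqnorm M (V 0 t) + 2 * sqnorm M (\<lambda>\<omega>. N t \<omega> - V 0 t \<omega>)"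
      using sqN[OF t] sqint_euler[OF t(1)] by (intro sqnorm_add_le sqint_diff) (auto simp: V_def)
    then show ?thesis
      using sqN[OF t, of 0] sqnorm_euler_le[OF nk0 t, of 0] by (simp add: V_def sqnorm_minus_commute[of M "N t"])
  qed
  let ?h = "\<lambda>u \<omega>. N u \<omega> *\<^sub>R lam u"
  have sqh: "sqint P (cutoff t ?h)" if t: "0 \<le> t" "t \<le> T" for t
  proof (rule sqint_P_I)
    show "cutoff t ?h \<in> borel_measurable P"
    proof (rule cutoff_measurable, rule continuous_process_measurable[OF t(1)])
      show "continuous_on {0..t} (\<lambda>s. N s \<omega> *\<^sub>R lam s)" for \<omega>
        by (intro continuous_on_scaleR continuous_on_subset[OF Ncont] continuous_on_subset[OF lam_cont]) (use t in auto)
      show "?h s \<in> borel_measurable M" if "0 \<le> s" "s \<le> t" for s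
        using filt_measurable[OF Nm[of s]] that t by auto
    qed
    show "0 \<le> t" by fact
    show "cutoff t ?h (u, \<omega>) = 0" if "u \<notin> {0..t}" for u \<omega> using that by (simp add: cutoff_def)
    fix u assume u: "0 \<le> u" "u \<le> t"
    have "(norm (lam u))\<^sup>2 * sqnorm M (N u) \<le> L\<^sup>2 * (2 * euler_bound + 2)"
      using u t by (intro mult_mono power_mono lam_bound sqN_bound) auto
    then show "sqint M (\<lambda>\<omega>. cutoff t ?h (u, \<omega>)) \<and> sqnorm M (\<lambda>\<omega>. cutoff t ?h (u, \<omega>)) \<le> L\<^sup>2 * (2 * euler_bound + 2)"
      using u sqN[of u] t by (auto simp: cutoff_def sqnorm_scale_vec intro: sqint_scale_vec)
  qed
  show ?thesis
  proof (rule that[of N])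
    fix t assume t: "0 \<le> t" "t \<le> T"
    show "ito (cutoff t ?h) (\<lambda>\<omega>. N t \<omega> - 1)"
    proof (rule ito_limit[where g="\<lambda>k. euler_integrand (nk k) t" and J="\<lambda>k \<omega>. V k t \<omega> - 1"])
      show "sqint P (cutoff t ?h)" by (rule sqh[OF t])
      show "sqint M (\<lambda>\<omega>. N t \<omega> - 1)" using sqN[OF t] by (intro sqint_diff sqint_const) auto
      show "ito (euler_integrand (nk k) t) (\<lambda>\<omega>. V k t \<omega> - 1)" for k
        unfolding V_def by (intro elementary_ito elementary_euler_integrand nk0 t)
      have "(\<lambda>k. sqnorm M (\<lambda>\<omega>. V k t \<omega> - N t \<omega>)) \<longlonglongrightarrow> 0"
        by (rule tendsto_sandwich[OF _ _ tendsto_const LIMSEQ_realpow_zero[of "1/8"]])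
          (use sqN[OF t] in \<open>auto intro!: always_eventually\<close>)
      then show "(\<lambda>k. sqnorm M (\<lambda>\<omega>. V k t \<omega> - 1 - (N t \<omega> - 1))) \<longlonglongrightarrow> 0" by simp
      show "(\<lambda>k. sqnorm P (\<lambda>z. euler_integrand (nk k) t z - cutoff t ?h z)) \<longlonglongrightarrow> 0"
      proof (rule order_tendstoI)
        fix e :: real assume e: "0 < e"
        then have e1: "0 < e / (8 * T)" using T by simp
        obtain N0 where N0: "\<And>n u. N0 \<le> n \<Longrightarrow> 0 < u \<Longrightarrow> u \<le> T \<Longrightarrow>
            sqnorm M (\<lambda>\<omega>. euler n (grid_below n u) \<omega> *\<^sub>R lam (grid_below n u) - euler n u \<omega> *\<^sub>R lam u) \<le> e / (8 * T)"
          using euler_frozen_error[OF e1] by blast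
        have "(\<lambda>k. 2 * L\<^sup>2 * T * (1/8) ^ k) \<longlonglongrightarrow> 2 * L\<^sup>2 * T * 0"
          by (intro tendsto_intros LIMSEQ_realpow_zero) auto
        then have "\<forall>\<^sub>F k in sequentially. 2 * L\<^sup>2 * T * (1/8) ^ k < e / 4"
          using e by (intro order_tendstoD(2)) auto
        then show "\<forall>\<^sub>F k in sequentially. sqnorm P (\<lambda>z. euler_integrand (nk k) t z - cutoff t ?h z) < e"
          using eventually_ge_at_top[of N0]
        proof eventually_elim
          case (elim k)
          let ?b = "2 * (e / (8 * T)) + 2 * (L\<^sup>2 * (1/8) ^ k)"
          have "sqnorm P (\<lambda>z. euler_integrand (nk k) t z - cutoff t ?h z) \<le> (t - 0) * ?b"
          proof (rule sqnorm_P_le)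
            show "sqint P (\<lambda>z. euler_integrand (nk k) t z - cutoff t ?h z)"
              by (intro sqint_diff sqint_euler_integrand sqh t nk0)
            show "euler_integrand (nk k) t (u, \<omega>) - cutoff t ?h (u, \<omega>) = 0" if "u \<notin> {0..t}" for u \<omega>
              using that euler_integrand_eval[OF nk0 t] by (auto simp: cutoff_def)
            fix u assume u: "0 < u" "u \<le> t"
            have uT: "u \<le> T" using u t by simp
            let ?a = "\<lambda>\<omega>. euler (nk k) (grid_below (nk k) u) \<omega> *\<^sub>R lam (grid_below (nk k) u)" and ?c = "\<lambda>\<omega>. euler (nk k) u \<omega> *\<^sub>R lam u"
            have "sqnorm M (\<lambda>\<omega>. euler_integrand (nk k) t (u, \<omega>) - cutoff t ?h (u, \<omega>)) = sqnorm M (\<lambda>\<omega>. ?a \<omega> - N u \<omega> *\<^sub>R lam u)"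
              using u euler_integrand_eval[OF nk0 t] by (simp add: cutoff_def)
            also have "\<dots> \<le> 2 * sqnorm M (\<lambda>\<omega>. ?a \<omega> - ?c \<omega>) + 2 * sqnorm M (\<lambda>\<omega>. ?c \<omega> - N u \<omega> *\<^sub>R lam u)"
              using u uT grid_below_bounds[OF nk0 u(1) uT] sqN[of u] by (intro sqnorm_triangle_le sqint_scale_vec sqint_euler) auto
            also have "sqnorm M (\<lambda>\<omega>. ?c \<omega> - N u \<omega> *\<^sub>R lam u) = (norm (lam u))\<^sup>2 * sqnorm M (\<lambda>\<omega>. V k u \<omega> - N u \<omega>)"
              by (simp add: scaleR_diff_left[symmetric] sqnorm_scale_vec V_def)
            also have "\<dots> \<le> L\<^sup>2 * (1/8) ^ k"
              using u uT sqN[of u k] by (intro mult_mono power_mono lam_bound) auto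
            finally show "sqnorm M (\<lambda>\<omega>. euler_integrand (nk k) t (u, \<omega>) - cutoff t ?h (u, \<omega>)) \<le> ?b"
              using N0[of "nk k" u] nk(1)[of k] elim(2) u uT by auto
          qed (use t in auto)
          also have "\<dots> \<le> T * ?b" using t e T by (intro mult_mono) auto
          also have "\<dots> = e / 4 + 2 * L\<^sup>2 * T * (1/8) ^ k" using T by (simp add: field_simps)
          also have "\<dots> < e" using elim(1) e by simp
          finally show ?case .
        qed
      next
        fix a :: real assume "a < 0"
        then show "\<forall>\<^sub>F k in sequentially. a < sqnorm P (\<lambda>z. euler_integrand (nk k) t z - cutoff t ?h z)"
          by (intro always_eventually allI) (rule less_le_trans[OF _ sqnorm_nonneg])
      qed
    qed
  qed (use Ncont L2N in auto)
qed

end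

text \<open>
  A continuous version of the stochastic exponential, to be used as a density.
\<close>
locale exp_mart = euler_scheme M W lam T L for M :: "'w measure" and W :: "real \<Rightarrow> 'w \<Rightarrow> real^'d" and lam T L +
  fixes N :: "real \<Rightarrow> 'w \<Rightarrow> real"
  assumes N_cont: "\<And>\<omega>. continuous_on {0..T} (\<lambda>t. N t \<omega>)"
    and L2F_N: "\<And>t. 0 \<le> t \<Longrightarrow> t \<le> T \<Longrightarrow> L2F t (N t)"
    and N_ito: "\<And>t. 0 \<le> t \<Longrightarrow> t \<le> T \<Longrightarrow> ito (cutoff t (\<lambda>u \<omega>. N u \<omega> *\<^sub>R lam u)) (\<lambda>\<omega>. N t \<omega> - 1)"
begin

abbreviation Nlam :: "real \<Rightarrow> 'w \<Rightarrow> real^'d" where "Nlam \<equiv> \<lambda>u \<omega>. N u \<omega> *\<^sub>R lam u"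

lemma sqint_N: "0 \<le> t \<Longrightarrow> t \<le> T \<Longrightarrow> sqint M (N t)"
  using L2F_N L2F_sqint by blast

lemma N_diff_ito:
  assumes "0 \<le> s" "s \<le> t" "t \<le> T"
  shows "ito (\<lambda>z. cutoff t Nlam z - cutoff s Nlam z) (\<lambda>\<omega>. N t \<omega> - N s \<omega>)"
  using ito_diff[OF N_ito[of t] N_ito[of s]] assms by simp

lemma N_martingale:
  assumes "0 \<le> s" "s \<le> t" "t \<le> T" "L2F s Z"
  shows "expectation (\<lambda>\<omega>. Z \<omega> * N t \<omega>) = expectation (\<lambda>\<omega>. Z \<omega> * N s \<omega>)"
proof -
  have "expectation (\<lambda>\<omega>. Z \<omega> * (N t \<omega> - N s \<omega>)) = 0"
    using assms(2) by (intro ito_orthogonal_past[OF N_diff_ito[OF assms(1-3)] assms(1,4)])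
      (auto simp: cutoff_def indicator_def)
  moreover have "integrable M (\<lambda>\<omega>. Z \<omega> * N t \<omega>)" "integrable M (\<lambda>\<omega>. Z \<omega> * N s \<omega>)"
    using assms by (auto intro!: sqint_mult sqint_N L2F_sqint[OF assms(4)])
  ultimately show ?thesis by (simp add: right_diff_distrib)
qed

lemma N_expectation:
  assumes "0 \<le> t" "t \<le> T" shows "expectation (N t) = 1"
  using ito_expectation[OF N_ito[OF assms] cutoff_AE_0] sqint_integrable[OF sqint_N[OF assms]]
  by (simp add: prob_space)

lemma N_0_AE: "AE \<omega> in M. N 0 \<omega> = 1"
proof -
  have i: "ito (cutoff 0 Nlam) (\<lambda>\<omega>. N 0 \<omega> - 1)" using T by (intro N_ito) auto
  have "AE z in P. cutoff 0 Nlam z = 0"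
    using AE_P_neq[of 0] by eventually_elim (auto simp: cutoff_def indicator_def)
  then have "sqnorm P (cutoff 0 Nlam) = sqnorm P (\<lambda>z. 0 :: real^'d)"
    using ito_sqint(1)[OF i] by (intro sqnorm_cong_AE) (auto simp: sqint_def)
  then have "sqnorm M (\<lambda>\<omega>. N 0 \<omega> - 1) = 0" unfolding ito_norm[OF i] by (simp add: sqnorm_def)
  then show ?thesis using sqnorm_zero_AE[OF ito_sqint(2)[OF i]] by simp
qed

definition N_bound :: real where "N_bound = 1 + sqnorm P (cutoff T Nlam)"

lemma N_bound_nonneg: "0 \<le> N_bound" by (simp add: N_bound_def add_nonneg_nonneg)

lemma sqnorm_N:
  assumes "0 \<le> t" "t \<le> T" shows "sqnorm M (N t) = 1 + sqnorm P (cutoff t Nlam)"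
proof -
  note i = N_ito[OF assms]
  have "expectation (\<lambda>\<omega>. N t \<omega> - 1) = 0" by (rule ito_expectation[OF i cutoff_AE_0])
  then have "expectation (\<lambda>\<omega>. (N t \<omega> - 1) \<bullet> (- 1)) = 0"
    by (simp only: inner_real_def mult_minus1_right Bochner_Integration.integral_minus)
  moreover have "sqnorm M (\<lambda>\<omega>. - 1 :: real) = 1" by (simp add: sqnorm_def prob_space)
  moreover have "sqnorm M (\<lambda>\<omega>. (N t \<omega> - 1) - (- 1)) = sqnorm M (\<lambda>\<omega>. N t \<omega> - 1) - 2 * expectation (\<lambda>\<omega>. (N t \<omega> - 1) \<bullet> (- 1)) + sqnorm M (\<lambda>\<omega>. - 1 :: real)"
    by (rule sqnorm_diff[OF ito_sqint(2)[OF i] sqint_const])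
  ultimately show ?thesis unfolding ito_norm[OF i] by simp
qed

lemma sqnorm_N_le:
  assumes "0 \<le> t" "t \<le> T" shows "sqnorm M (N t) \<le> N_bound"
proof -
  have "sqnorm P (cutoff t Nlam) \<le> sqnorm P (cutoff T Nlam)"
    using assms T by (intro sqnorm_mono ito_sqint(1)[OF N_ito]) (auto simp: cutoff_def indicator_def)
  then show ?thesis using sqnorm_N[OF assms] by (simp add: N_bound_def)
qed

lemma sqnorm_N_increment:
  assumes "0 \<le> s" "s \<le> t" "t \<le> T"
  shows "sqnorm M (\<lambda>\<omega>. N t \<omega> - N s \<omega>) \<le> (t - s) * (L\<^sup>2 * N_bound)"
  unfolding ito_norm[OF N_diff_ito[OF assms]]
proof (rule sqnorm_P_le[OF ito_sqint(1)[OF N_diff_ito[OF assms]] assms(2)])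
  fix u assume u: "s < u" "u \<le> t"
  have "(norm (lam u))\<^sup>2 * sqnorm M (N u) \<le> L\<^sup>2 * N_bound"
    using u assms by (intro mult_mono power_mono lam_bound sqnorm_N_le) auto
  then show "sqnorm M (\<lambda>\<omega>. cutoff t Nlam (u, \<omega>) - cutoff s Nlam (u, \<omega>)) \<le> L\<^sup>2 * N_bound"
    using u assms by (simp add: cutoff_def sqnorm_scale_vec)
qed (use assms in \<open>auto simp: cutoff_def indicator_def\<close>)

lemma weighted_N_measurable:
  fixes a :: "real \<Rightarrow> 'b::euclidean_space"
  assumes "0 \<le> t" "t \<le> T" "continuous_on {0..T} a"
  shows "(\<lambda>(s, \<omega>). N s \<omega> *\<^sub>R a s) \<in> borel_measurable (restrict_space borel {0..t} \<Otimes>\<^sub>M M)"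
proof (rule continuous_process_measurable[OF assms(1)])
  show "continuous_on {0..t} (\<lambda>s. N s \<omega> *\<^sub>R a s)" for \<omega>
    by (intro continuous_on_scaleR continuous_on_subset[OF N_cont] continuous_on_subset[OF assms(3)])
      (use assms in auto)
  show "(\<lambda>\<omega>. N s \<omega> *\<^sub>R a s) \<in> borel_measurable M" if "0 \<le> s" "s \<le> t" for s
    using sqint_N[of s] that assms by (auto simp: sqint_def)
qed

lemma L2_adapted_weighted_N:
  fixes a :: "real \<Rightarrow> 'b::euclidean_space"
  assumes "0 \<le> t" "t \<le> T" "continuous_on {0..T} a"
  shows "L2_adapted M W t (\<lambda>s \<omega>. N s \<omega> *\<^sub>R a s)"
proof (rule L2_adaptedI)
  show m: "(\<lambda>(s, \<omega>). N s \<omega> *\<^sub>R a s) \<in> borel_measurable (restrict_space borel {0..t} \<Otimes>\<^sub>M M)"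
    by (rule weighted_N_measurable[OF assms])
  show "(\<lambda>\<omega>. N s \<omega> *\<^sub>R a s) \<in> borel_measurable (F s)" if "0 \<le> s" "s \<le> t" for s
    using L2F_N[of s] that assms by (auto simp: L2F_def)
  obtain A where A: "\<And>s. 0 \<le> s \<Longrightarrow> s \<le> T \<Longrightarrow> norm (a s) \<le> A"
    using continuous_Icc_bound[OF assms(3)] by blast
  show "sqint P (cutoff t (\<lambda>s \<omega>. N s \<omega> *\<^sub>R a s))"
  proof (rule sqint_P_I[OF cutoff_measurable[OF m] assms(1)])
    fix u assume u: "0 \<le> u" "u \<le> t"
    have "(norm (a u))\<^sup>2 * sqnorm M (N u) \<le> A\<^sup>2 * N_bound"
      using u assms A[of u] by (intro mult_mono power_mono sqnorm_N_le) auto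
    then show "sqint M (\<lambda>\<omega>. cutoff t (\<lambda>s \<omega>. N s \<omega> *\<^sub>R a s) (u, \<omega>)) \<and> sqnorm M (\<lambda>\<omega>. cutoff t (\<lambda>s \<omega>. N s \<omega> *\<^sub>R a s) (u, \<omega>)) \<le> A\<^sup>2 * N_bound"
      using u assms sqint_N[of u] by (auto simp: cutoff_def sqnorm_scale_vec intro: sqint_scale_vec)
  qed (simp add: cutoff_def)
qed

text \<open>
  The isometry gives \<open>E N(t)\<^sup>2 = 1 + \<integral>\<^sub>0\<^sup>t |\<lambda>|\<^sup>2 E N\<^sup>2\<close>, and the exponential solves the same equation.
\<close>
lemma N_second_moment:
  assumes "0 \<le> t" "t \<le> T"
  shows "sqnorm M (N t) = exp (integral {0..t} (\<lambda>s. (norm (lam s))\<^sup>2))"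
proof (rule volterra_unique[where u="\<lambda>t. sqnorm M (N t)" and v="\<lambda>t. exp (integral {0..t} (\<lambda>s. (norm (lam s))\<^sup>2))"
      and a="\<lambda>s. (norm (lam s))\<^sup>2" and C="L\<^sup>2" and c=1 and T=T, OF _ _ _ _ _ _ assms])
  have lc: "continuous_on {0..T} (\<lambda>s. (norm (lam s))\<^sup>2)" by (intro continuous_intros lam_cont)
  have d: "((\<lambda>t. exp (integral {0..t} (\<lambda>s. (norm (lam s))\<^sup>2))) has_real_derivative
      (norm (lam s))\<^sup>2 * exp (integral {0..s} (\<lambda>s. (norm (lam s))\<^sup>2))) (at s within {0..T})" if "0 \<le> s" "s \<le> T" for s
    using integral_has_real_derivative[OF lc, of s] that
    by (auto intro!: derivative_eq_intros)
  have ec: "continuous_on {0..T} (\<lambda>t. exp (integral {0..t} (\<lambda>s. (norm (lam s))\<^sup>2)))"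
    by (rule DERIV_continuous_on[where D="\<lambda>s. (norm (lam s))\<^sup>2 * exp (integral {0..s} (\<lambda>s. (norm (lam s))\<^sup>2))"])
      (use d in auto)
  show "set_integrable lborel {0..T} (\<lambda>t. exp (integral {0..t} (\<lambda>s. (norm (lam s))\<^sup>2)))"
    by (rule set_integrable_continuous[OF ec])
  show "exp (integral {0..t} (\<lambda>s. (norm (lam s))\<^sup>2)) = 1 + (LINT s:{0..t}|lborel. (norm (lam s))\<^sup>2 * exp (integral {0..s} (\<lambda>s. (norm (lam s))\<^sup>2)))"
    if t: "0 \<le> t" "t \<le> T" for t
  proof -
    have "(LINT s:{0..t}|lborel. (norm (lam s))\<^sup>2 * exp (integral {0..s} (\<lambda>s. (norm (lam s))\<^sup>2)))
      = exp (integral {0..t} (\<lambda>s. (norm (lam s))\<^sup>2)) - exp (integral {0..0} (\<lambda>s. (norm (lam s))\<^sup>2))"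
      using t by (intro set_integral_FTC continuous_on_mult continuous_on_subset[OF lc] continuous_on_subset[OF ec]
          DERIV_subset[OF d]) auto
    then show ?thesis by simp
  qed
  show "set_borel_measurable lborel {0..T} (\<lambda>s. (norm (lam s))\<^sup>2)"
    using set_integrable_continuous[OF lc] by (auto simp: set_integrable_def set_borel_measurable_def)
  show "\<bar>(norm (lam t))\<^sup>2\<bar> \<le> L\<^sup>2" if "0 \<le> t" "t \<le> T" for t
    using lam_bound[OF that] by (simp add: power_mono)
  have sN: "sqint P (cutoff T (\<lambda>s \<omega>. N s \<omega> *\<^sub>R (1::real)))"
    using T by (intro L2_adapted_cutoff L2_adapted_weighted_N) auto
  have "integrable lborel (\<lambda>u. sqnorm M (\<lambda>\<omega>. cutoff T (\<lambda>s \<omega>. N s \<omega> *\<^sub>R (1::real)) (u, \<omega>)))"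
    by (rule sqint_sections(2)[OF sN])
  also have "(\<lambda>u. sqnorm M (\<lambda>\<omega>. cutoff T (\<lambda>s \<omega>. N s \<omega> *\<^sub>R (1::real)) (u, \<omega>))) = (\<lambda>u. indicator {0..T} u *\<^sub>R sqnorm M (N u))"
    by (auto simp: cutoff_def indicator_def sqnorm_def)
  finally show "set_integrable lborel {0..T} (\<lambda>t. sqnorm M (N t))" by (simp add: set_integrable_def)
  fix t assume t: "0 \<le> t" "t \<le> T"
  have "sqnorm P (cutoff t Nlam) = (LINT u|lborel. sqnorm M (\<lambda>\<omega>. cutoff t Nlam (u, \<omega>)))"
    by (rule sqint_sections(3)[OF ito_sqint(1)[OF N_ito[OF t]]])
  also have "(\<lambda>u. sqnorm M (\<lambda>\<omega>. cutoff t Nlam (u, \<omega>))) = (\<lambda>u. indicator {0..t} u *\<^sub>R ((norm (lam u))\<^sup>2 * sqnorm M (N u)))"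
  proof
    fix u
    show "sqnorm M (\<lambda>\<omega>. cutoff t Nlam (u, \<omega>)) = indicator {0..t} u *\<^sub>R ((norm (lam u))\<^sup>2 * sqnorm M (N u))"
      by (cases "u \<in> {0..t}") (simp_all add: cutoff_def sqnorm_scale_vec, simp add: sqnorm_def)
  qed
  finally show "sqnorm M (N t) = 1 + (LINT s:{0..t}|lborel. (norm (lam s))\<^sup>2 * sqnorm M (N s))"
    using sqnorm_N[OF t] by (simp add: set_lebesgue_integral_def)
qed

text \<open>
  Processes of the form \<open>N a\<close> are uniformly continuous in \<open>L\<^sup>2\<close>, so their values at the points of a fine
  grid give approximations by steps.
\<close>
lemma weighted_N_Riemann:
  fixes a :: "real \<Rightarrow> real^'d"
  assumes t: "0 \<le> t" "t \<le> T" and a: "continuous_on {0..T} a" and e: "0 < e"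
  shows "\<exists>k p \<xi>. p 0 = 0 \<and> p k = t \<and> (\<forall>i<k. p i \<le> p (Suc i)) \<and> (\<forall>i<k. L2F (p i) (\<xi> i))
      \<and> sqnorm P (\<lambda>z. (\<Sum>i<k. step (p i) (p (Suc i)) (\<xi> i) z) - cutoff t (\<lambda>s \<omega>. N s \<omega> *\<^sub>R a s) z) < e"
proof -
  have Vp: "0 < N_bound" unfolding N_bound_def by (intro add_pos_nonneg) auto
  obtain A where A: "\<And>s. 0 \<le> s \<Longrightarrow> s \<le> T \<Longrightarrow> norm (a s) \<le> A"
    using continuous_Icc_bound[OF a] by blast
  define e' where "e' = e / (4 * (T + 1))"
  have e': "0 < e'" using e T by (simp add: e'_def)
  define \<eta> where "\<eta> = sqrt (e' / N_bound)"
  have \<eta>: "0 < \<eta>" using e' Vp by (simp add: \<eta>_def)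
  have "uniformly_continuous_on {0..T} a" by (rule compact_uniformly_continuous[OF a]) auto
  then obtain d where d: "0 < d" "\<And>x y. x \<in> {0..T} \<Longrightarrow> y \<in> {0..T} \<Longrightarrow> dist y x < d \<Longrightarrow> dist (a y) (a x) < \<eta>"
    using \<eta> unfolding uniformly_continuous_on_def by metis
  obtain N1 where N1: "T / d < real N1" using reals_Archimedean2 by blast
  obtain N2 where N2: "A\<^sup>2 * (T * (L\<^sup>2 * N_bound)) / e' < real N2" using reals_Archimedean2 by blast
  define n where "n = Suc (max N1 N2)"
  have n0: "0 < n" and nn: "real N1 \<le> n" "real N2 \<le> n" by (auto simp: n_def)
  define p where "p i = real i * t / real n" for i
  have p: "p 0 = 0" "p n = t" "p i \<le> p (Suc i)" "p (Suc i) - p i \<le> T / n" for i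
  proof -
    have "p (Suc i) - p i = t / n" by (simp add: p_def field_simps add_divide_distrib)
    moreover have "0 \<le> t / n" "t / n \<le> T / n" using t n0 by (auto simp: divide_right_mono)
    ultimately show "p i \<le> p (Suc i)" "p (Suc i) - p i \<le> T / n" by auto
  qed (use n0 in \<open>auto simp: p_def\<close>)
  have pt: "0 \<le> p i" "i \<le> n \<Longrightarrow> p i \<le> t" for i
    using partition_mono[of n p i n] p t by (auto simp: p_def)
  let ?g = "\<lambda>s \<omega>. N s \<omega> *\<^sub>R a s"
  have Lg: "L2F (p i) (?g (p i))" if "i < n" for i
    using pt[of i] that t by (intro L2F_scaleR_const L2F_N) auto
  have Td: "T / n < d"
  proof -
    have "T / d < n" using N1 nn by linarith
    then show ?thesis using d(1) n0 by (simp add: divide_less_eq mult.commute)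
  qed
  have An: "A\<^sup>2 * ((T / n) * (L\<^sup>2 * N_bound)) \<le> e'"
  proof -
    have "A\<^sup>2 * (T * (L\<^sup>2 * N_bound)) / e' \<le> n" using N2 nn by linarith
    then have "A\<^sup>2 * (T * (L\<^sup>2 * N_bound)) \<le> n * e'" using e' by (simp add: divide_le_eq)
    then show ?thesis using n0 by (simp add: field_simps)
  qed
  have "sqnorm P (\<lambda>z. (\<Sum>i<n. step (p i) (p (Suc i)) (?g (p i)) z) - cutoff t ?g z) \<le> (t - 0) * (4 * e')"
  proof (rule sqnorm_P_le)
    show "sqint P (\<lambda>z. (\<Sum>i<n. step (p i) (p (Suc i)) (?g (p i)) z) - cutoff t ?g z)"
      using p Lg by (intro sqint_diff elementary_sqint(1)[OF elementary_partition] L2_adapted_cutoff L2_adapted_weighted_N t a) auto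
    show "(\<Sum>i<n. step (p i) (p (Suc i)) (?g (p i)) (u, \<omega>)) - cutoff t ?g (u, \<omega>) = 0" if "u \<notin> {0..t}" for u \<omega>
    proof -
      have "step (p i) (p (Suc i)) (?g (p i)) (u, \<omega>) = 0" if "i < n" for i
        using \<open>u \<notin> {0..t}\<close> pt(1)[of i] pt(2)[of "Suc i"] that by (auto simp: step_def indicator_def)
      then show ?thesis using that by (simp add: cutoff_def)
    qed
    fix u assume u: "0 < u" "u \<le> t"
    obtain i where i: "i < n" "p i < u" "u \<le> p (Suc i)" using partition_interval[of p u n] p u by auto
    let ?s = "p i"
    have s: "0 \<le> ?s" "?s \<le> u" "u - ?s \<le> T / n" "?s \<le> T" "u \<le> T" using pt(1)[of i] i p(4)[of i] t u by auto
    have "dist (a ?s) (a u) < \<eta>" using s Td u by (intro d(2)) (auto simp: dist_real_def)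
    then have "(norm (a ?s - a u))\<^sup>2 \<le> \<eta>\<^sup>2" by (intro power_mono) (auto simp: dist_norm)
    also have "\<eta>\<^sup>2 = e' / N_bound" using e' Vp by (simp add: \<eta>_def)
    finally have a1: "(norm (a ?s - a u))\<^sup>2 \<le> e' / N_bound" .
    have "sqnorm M (\<lambda>\<omega>. (\<Sum>i<n. step (p i) (p (Suc i)) (?g (p i)) (u, \<omega>)) - cutoff t ?g (u, \<omega>))
      = sqnorm M (\<lambda>\<omega>. N ?s \<omega> *\<^sub>R (a ?s - a u) + (N ?s \<omega> - N u \<omega>) *\<^sub>R a u)"
      using step_partition_eval[of n p i u "\<lambda>i. ?g (p i)"] p i u by (simp add: cutoff_def algebra_simps)
    also have "\<dots> \<le> 2 * sqnorm M (\<lambda>\<omega>. N ?s \<omega> *\<^sub>R (a ?s - a u)) + 2 * sqnorm M (\<lambda>\<omega>. (N ?s \<omega> - N u \<omega>) *\<^sub>R a u)"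
      using s u by (intro sqnorm_add_le sqint_scale_vec sqint_diff sqint_N) auto
    also have "\<dots> = 2 * ((norm (a ?s - a u))\<^sup>2 * sqnorm M (N ?s)) + 2 * ((norm (a u))\<^sup>2 * sqnorm M (\<lambda>\<omega>. N u \<omega> - N ?s \<omega>))"
      by (simp add: sqnorm_scale_vec sqnorm_minus_commute[of M "N u"])
    also have "\<dots> \<le> 2 * (e' / N_bound * N_bound) + 2 * (A\<^sup>2 * ((T / n) * (L\<^sup>2 * N_bound)))"
    proof -
      have "sqnorm M (\<lambda>\<omega>. N u \<omega> - N ?s \<omega>) \<le> (u - ?s) * (L\<^sup>2 * N_bound)"
        using s by (intro sqnorm_N_increment) auto
      also have "\<dots> \<le> (T / n) * (L\<^sup>2 * N_bound)" using s N_bound_nonneg by (intro mult_right_mono) auto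
      finally have 1: "sqnorm M (\<lambda>\<omega>. N u \<omega> - N ?s \<omega>) \<le> (T / n) * (L\<^sup>2 * N_bound)" .
      have "(norm (a u))\<^sup>2 * sqnorm M (\<lambda>\<omega>. N u \<omega> - N ?s \<omega>) \<le> A\<^sup>2 * ((T / n) * (L\<^sup>2 * N_bound))"
        using 1 A[of u] s u by (intro mult_mono power_mono) auto
      moreover have "(norm (a ?s - a u))\<^sup>2 * sqnorm M (N ?s) \<le> e' / N_bound * N_bound"
        using a1 s e' Vp by (intro mult_mono sqnorm_N_le) auto
      ultimately show ?thesis by linarith
    qed
    also have "\<dots> \<le> 4 * e'" using An Vp by simp
    finally show "sqnorm M (\<lambda>\<omega>. (\<Sum>i<n. step (p i) (p (Suc i)) (?g (p i)) (u, \<omega>)) - cutoff t ?g (u, \<omega>)) \<le> 4 * e'" .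
  qed (use t in auto)
  also have "\<dots> \<le> T * (4 * e')" using t e' by (intro mult_right_mono) auto
  also have "\<dots> < e" using e T by (simp add: e'_def field_simps)
  finally show ?thesis using p Lg by (intro exI[of _ n] exI[of _ p] exI[of _ "\<lambda>i. ?g (p i)"]) auto
qed

text \<open>
  Integration by parts for \<open>c N\<close>. For a step function in place of \<open>c\<close> the integral is the finite sum \<open>K n\<close>
  of multiples of increments of \<open>N\<close>. Abel summation turns it into boundary terms and a sum of
  increments of \<open>c\<close> against \<open>N\<close>, which converges on every path because \<open>N\<close> is continuous.
\<close>
lemma weighted_N_ito:
  assumes t: "0 \<le> t" "t \<le> T" and c': "continuous_on {0..T} c'"
    and c: "\<And>s. 0 \<le> s \<Longrightarrow> s \<le> T \<Longrightarrow> (c has_real_derivative c' s) (at s within {0..T})"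
  shows "ito (cutoff t (\<lambda>u \<omega>. N u \<omega> *\<^sub>R (c u *\<^sub>R lam u))) (\<lambda>\<omega>. c t * N t \<omega> - c 0 - (LINT s:{0..t}|lborel. c' s * N s \<omega>))"
proof -
  have cc: "continuous_on {0..T} c" by (rule DERIV_continuous_on[of _ c c']) (use c in auto)
  define p where "p n i = real i * t / real (Suc n)" for n i
  have p: "p n 0 = 0" "p n (Suc n) = t" "p n i \<le> p n (Suc i)" "p n (Suc i) - p n i = t / Suc n" for n i
  proof -
    have "real (Suc i) * t - real i * t = t" by (simp add: algebra_simps)
    then show *: "p n (Suc i) - p n i = t / Suc n" by (simp only: p_def diff_divide_distrib[symmetric])
    have "0 \<le> t / Suc n" using t by simp
    then show "p n i \<le> p n (Suc i)" using * by linarith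
    show "p n (Suc n) = t" unfolding p_def by (simp del: of_nat_Suc)
  qed (simp add: p_def)
  have pt: "0 \<le> p n i" "i \<le> Suc n \<Longrightarrow> p n i \<le> t" for n i
    using partition_mono[of "Suc n" "p n" i "Suc n"] p t by (auto simp: p_def)
  define f where "f n z = (\<Sum>i<Suc n. c (p n i) *\<^sub>R (cutoff (p n (Suc i)) Nlam z - cutoff (p n i) Nlam z))" for n z
  define K where "K n \<omega> = (\<Sum>i<Suc n. c (p n i) * (N (p n (Suc i)) \<omega> - N (p n i) \<omega>))" for n \<omega>
  let ?h = "\<lambda>u \<omega>. N u \<omega> *\<^sub>R (c u *\<^sub>R lam u)"
  have fK: "ito (f n) (K n)" for n
    unfolding f_def[abs_def] K_def[abs_def]
    using p(3) pt(1) t by (intro ito_sum ito_scaleR N_diff_ito) (auto intro: order_trans[OF pt(2)])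
  have sh: "sqint P (cutoff t ?h)"
    by (intro L2_adapted_cutoff L2_adapted_weighted_N t continuous_on_scaleR cc lam_cont)
  have uc: "uniformly_continuous_on {0..T} c" by (rule compact_uniformly_continuous[OF cc]) auto
  have f_eval: "f n (u, \<omega>) = c (p n i) *\<^sub>R Nlam u \<omega>" if i: "i < Suc n" "p n i < u" "u \<le> p n (Suc i)" for n u \<omega> i
  proof -
    have "c (p n j) *\<^sub>R (cutoff (p n (Suc j)) Nlam (u, \<omega>) - cutoff (p n j) Nlam (u, \<omega>))
       = step (p n j) (p n (Suc j)) (\<lambda>\<omega>. c (p n j) *\<^sub>R Nlam u \<omega>) (u, \<omega>)" for j
      using pt(1)[of n j] p(3)[of n j] by (auto simp: cutoff_def step_def indicator_def)
    then have "f n (u, \<omega>) = (\<Sum>j<Suc n. step (p n j) (p n (Suc j)) (\<lambda>\<omega>. c (p n j) *\<^sub>R Nlam u \<omega>) (u, \<omega>))"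
      unfolding f_def by (intro sum.cong) auto
    also have "\<dots> = c (p n i) *\<^sub>R Nlam u \<omega>"
      by (rule step_partition_eval[of "Suc n" "p n" i u "\<lambda>j \<omega>. c (p n j) *\<^sub>R Nlam u \<omega>"]) (use p i in auto)
    finally show ?thesis .
  qed
  have mesh: "\<forall>\<^sub>F n in sequentially. t / Suc n < d" if "0 < d" for d
  proof -
    have "(\<lambda>n. t * inverse (real (Suc n))) \<longlonglongrightarrow> t * 0" by (intro tendsto_intros LIMSEQ_inverse_real_of_nat)
    then show ?thesis using that by (intro order_tendstoD(2)[of _ 0]) (auto simp: divide_inverse)
  qed
  have fconv: "(\<lambda>n. sqnorm P (\<lambda>z. f n z - cutoff t ?h z)) \<longlonglongrightarrow> 0"
  proof (rule order_tendstoI)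
    fix e :: real assume e: "0 < e"
    define \<eta> where "\<eta> = sqrt (e / (2 * N_bound))"
    have Vp: "0 < N_bound" unfolding N_bound_def by (intro add_pos_nonneg) auto
    have \<eta>: "0 < \<eta>" using e Vp by (simp add: \<eta>_def)
    obtain d where d: "0 < d" "\<And>x y. x \<in> {0..T} \<Longrightarrow> y \<in> {0..T} \<Longrightarrow> dist y x < d \<Longrightarrow> dist (c y) (c x) < \<eta>"
      using \<eta> uc unfolding uniformly_continuous_on_def by metis
    show "\<forall>\<^sub>F n in sequentially. sqnorm P (\<lambda>z. f n z - cutoff t ?h z) < e"
      using mesh[OF d(1)]
    proof eventually_elim
      case (elim n)
      have "sqnorm P (\<lambda>z. f n z - cutoff t ?h z) \<le> sqnorm P (\<lambda>z. \<eta> *\<^sub>R cutoff T Nlam z)"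
      proof (rule sqnorm_mono)
        show "sqint P (\<lambda>z. f n z - cutoff t ?h z)" by (intro sqint_diff sh ito_sqint(1)[OF fK])
        show "sqint P (\<lambda>z. \<eta> *\<^sub>R cutoff T Nlam z)" using T by (intro sqint_scaleR ito_sqint(1)[OF N_ito]) auto
        show "AE z in P. norm (f n z - cutoff t ?h z) \<le> norm (\<eta> *\<^sub>R cutoff T Nlam z)"
          using AE_P_neq[of 0]
        proof eventually_elim
          fix z :: "real \<times> 'w" assume z0: "fst z \<noteq> 0"
          obtain u \<omega> where z: "z = (u, \<omega>)" by force
          show "norm (f n z - cutoff t ?h z) \<le> norm (\<eta> *\<^sub>R cutoff T Nlam z)"
          proof (cases "0 < u \<and> u \<le> t")
            case True
            then obtain i where i: "i < Suc n" "p n i < u" "u \<le> p n (Suc i)"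
              using partition_interval[of "p n" u "Suc n"] p by auto
            have "dist (c (p n i)) (c u) < \<eta>"
              using True i p(4)[of n i] pt(1)[of n i] t elim by (intro d(2)) (auto simp: dist_real_def)
            then have "\<bar>c (p n i) - c u\<bar> * norm (Nlam u \<omega>) \<le> \<eta> * norm (Nlam u \<omega>)"
              by (intro mult_right_mono) (auto simp: dist_real_def)
            moreover have "f n z - cutoff t ?h z = (c (p n i) - c u) *\<^sub>R Nlam u \<omega>"
              unfolding z f_eval[OF i] using True by (simp add: cutoff_def algebra_simps)
            moreover have "cutoff T Nlam z = Nlam u \<omega>" using True t by (simp add: z cutoff_def)
            ultimately show ?thesis using \<eta> by (simp add: abs_mult mult.assoc)
          next
            case False
            then have u: "u \<notin> {0..t}" using z0 z by auto
            have "cutoff (p n j) Nlam z = 0" if "j \<le> Suc n" for j using u pt(2)[of j n] that by (auto simp: z cutoff_def indicator_def)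
            then have "f n z = 0" by (simp add: f_def)
            then show ?thesis using u by (simp add: z cutoff_def)
          qed
        qed
      qed
      also have "\<dots> = e / (2 * N_bound) * sqnorm P (cutoff T Nlam)" unfolding sqnorm_scaleR using e Vp by (simp add: \<eta>_def)
      also have "\<dots> \<le> e / (2 * N_bound) * N_bound" using e Vp by (intro mult_left_mono) (auto simp: N_bound_def)
      also have "\<dots> < e" using e Vp by simp
      finally show ?case .
    qed
  next
    fix a :: real assume "a < 0"
    then show "\<forall>\<^sub>F n in sequentially. a < sqnorm P (\<lambda>z. f n z - cutoff t ?h z)"
      by (intro always_eventually allI) (rule less_le_trans[OF _ sqnorm_nonneg])
  qed
  obtain C where C: "\<And>s. 0 \<le> s \<Longrightarrow> s \<le> T \<Longrightarrow> \<bar>c' s\<bar> \<le> C"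
    using continuous_Icc_bound[OF c'] unfolding real_norm_def by blast
  have C0: "0 \<le> C" using C[of 0] T by simp
  let ?J = "\<lambda>\<omega>. c t * N t \<omega> - c 0 - (LINT s:{0..t}|lborel. c' s * N s \<omega>)"
  have Klim: "(\<lambda>n. K n \<omega>) \<longlonglongrightarrow> ?J \<omega>" if N0: "N 0 \<omega> = 1" for \<omega>
  proof -
    define G where "G s = integral {0..s} (\<lambda>s. c' s * N s \<omega>)" for s
    have cN: "continuous_on {0..T} (\<lambda>s. c' s * N s \<omega>)" by (intro continuous_on_mult c' N_cont)
    have G: "(G has_real_derivative c' s * N s \<omega>) (at s within {0..T})" if "0 \<le> s" "s \<le> T" for s
      unfolding G_def using integral_has_real_derivative[OF cN, of s] that by simp
    have Gt: "(LINT s:{0..t}|lborel. c' s * N s \<omega>) = G t - G 0"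
      using t by (intro set_integral_FTC continuous_on_subset[OF cN] DERIV_subset[OF G]) auto
    \<comment> \<open>the error of the Riemann sum that Abel summation produces\<close>
    define R where "R n = (\<Sum>i<Suc n. (c (p n (Suc i)) - c (p n i)) * N (p n (Suc i)) \<omega> - (G (p n (Suc i)) - G (p n i)))" for n
    have KR: "K n \<omega> = ?J \<omega> - R n" for n
    proof -
      have "K n \<omega> + R n = (\<Sum>i<Suc n. c (p n (Suc i)) * N (p n (Suc i)) \<omega> - c (p n i) * N (p n i) \<omega>) - (\<Sum>i<Suc n. G (p n (Suc i)) - G (p n i))"
        unfolding K_def R_def sum.distrib[symmetric] sum_subtractf[symmetric] by (intro sum.cong) (auto simp: algebra_simps)
      also have "\<dots> = (c (p n (Suc n)) * N (p n (Suc n)) \<omega> - c (p n 0) * N (p n 0) \<omega>) - (G (p n (Suc n)) - G (p n 0))"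
        using sum_lessThan_telescope[of "\<lambda>i. c (p n i) * N (p n i) \<omega>" "Suc n"]
          sum_lessThan_telescope[of "\<lambda>i. G (p n i)" "Suc n"] by simp
      finally show ?thesis by (simp add: p N0 Gt)
    qed
    have "uniformly_continuous_on {0..T} (\<lambda>s. N s \<omega>)" by (rule compact_uniformly_continuous[OF N_cont]) auto
    then have uN: "\<exists>d>0. \<forall>x\<in>{0..T}. \<forall>y\<in>{0..T}. dist y x < d \<longrightarrow> dist (N y \<omega>) (N x \<omega>) < e" if "0 < e" for e
      using that unfolding uniformly_continuous_on_def by blast
    have "R \<longlonglongrightarrow> 0"
    proof (rule tendstoI)
      fix e :: real assume e: "0 < e"
      define e' where "e' = e / ((C + 1) * (T + 1))"
      have e': "0 < e'" using e C0 T by (simp add: e'_def)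
      obtain d where d: "0 < d" "\<And>x y. x \<in> {0..T} \<Longrightarrow> y \<in> {0..T} \<Longrightarrow> dist y x < d \<Longrightarrow> dist (N y \<omega>) (N x \<omega>) < e'"
        using uN[OF e'] by blast
      show "\<forall>\<^sub>F n in sequentially. dist (R n) 0 < e"
        using mesh[OF d(1)]
      proof eventually_elim
        case (elim n)
        have each: "\<bar>(c (p n (Suc i)) - c (p n i)) * N (p n (Suc i)) \<omega> - (G (p n (Suc i)) - G (p n i))\<bar> \<le> C * e' * (p n (Suc i) - p n i)"
          if i: "i < Suc n" for i
        proof -
          \<comment> \<open>the mean value bound for \<open>c(s) N(q) - G(s)\<close>, whose derivative is \<open>c'(s) (N(q) - N(s))\<close>\<close>
          let ?q = "p n (Suc i)"
          have le: "0 \<le> p n i" "p n i \<le> ?q" "?q \<le> T" using pt[of n i] pt(2)[of "Suc i" n] p(3)[of n i] i t by auto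
          have "norm ((c ?q * N ?q \<omega> - G ?q) - (c (p n i) * N ?q \<omega> - G (p n i))) \<le> C * e' * norm (?q - p n i)"
          proof (rule field_differentiable_bound[where S="{p n i..?q}" and f="\<lambda>s. c s * N ?q \<omega> - G s" and f'="\<lambda>s. c' s * N ?q \<omega> - c' s * N s \<omega>"])
            fix s assume s: "s \<in> {p n i..?q}"
            show "((\<lambda>s. c s * N ?q \<omega> - G s) has_field_derivative c' s * N ?q \<omega> - c' s * N s \<omega>) (at s within {p n i..?q})"
              using s le by (intro DERIV_diff DERIV_cmult_right DERIV_subset[OF c] DERIV_subset[OF G]) auto
            have "dist (N ?q \<omega>) (N s \<omega>) < e'"
              using s le p(4)[of n i] elim by (intro d(2)) (auto simp: dist_real_def)
            then have "\<bar>c' s\<bar> * \<bar>N ?q \<omega> - N s \<omega>\<bar> \<le> C * e'"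
              using s le C[of s] C0 by (intro mult_mono) (auto simp: dist_real_def)
            then show "norm (c' s * N ?q \<omega> - c' s * N s \<omega>) \<le> C * e'" by (simp add: right_diff_distrib[symmetric] abs_mult)
          qed (use le in auto)
          then show ?thesis using le by (simp add: algebra_simps)
        qed
        have "\<bar>R n\<bar> \<le> (\<Sum>i<Suc n. C * e' * (p n (Suc i) - p n i))"
          unfolding R_def by (rule order_trans[OF sum_abs sum_mono]) (use each in auto)
        also have "\<dots> = C * e' * t"
          unfolding sum_distrib_left[symmetric] sum_lessThan_telescope by (simp add: p)
        also have "\<dots> \<le> C * e' * T" using t C0 e' by (intro mult_left_mono) auto
        also have "\<dots> < (C + 1) * e' * (T + 1)" using C0 e' T by (simp add: algebra_simps add_pos_pos) (smt (verit) mult_nonneg_nonneg mult_pos_pos)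
        also have "\<dots> = e" using C0 T by (simp add: e'_def)
        finally show ?case by simp
      qed
    qed
    then show ?thesis unfolding KR using tendsto_diff[OF tendsto_const, of R 0 _ "?J \<omega>"] by simp
  qed
  show ?thesis
  proof (rule ito_pointwise_limit[OF fK sh fconv])
    show "AE \<omega> in M. (\<lambda>n. K n \<omega>) \<longlonglongrightarrow> ?J \<omega>" using N_0_AE by eventually_elim (rule Klim)
    have "sqint P (cutoff t (\<lambda>s \<omega>. N s \<omega> *\<^sub>R c' s))" by (intro L2_adapted_cutoff L2_adapted_weighted_N t c')
    from time_integral(1)[OF this t(1)] have "sqint M (\<lambda>\<omega>. LINT s:{0..t}|lborel. c' s * N s \<omega>)"
      by (simp add: cutoff_def set_lebesgue_integral_def mult.commute)
    then show "?J \<in> borel_measurable M"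
      using sqint_N[OF t] by (auto simp: sqint_def)
  qed
qed

lemma weighted_N_has_ito:
  assumes t: "0 \<le> t" "t \<le> T" and c': "continuous_on {0..T} c'"
    and c: "\<And>s. 0 \<le> s \<Longrightarrow> s \<le> T \<Longrightarrow> (c has_real_derivative c' s) (at s within {0..T})"
  shows "has_ito_integral M W t (\<lambda>u \<omega>. N u \<omega> *\<^sub>R (c u *\<^sub>R lam u)) (\<lambda>\<omega>. c t * N t \<omega> - c 0 - (LINT s:{0..t}|lborel. c' s * N s \<omega>))"
proof -
  have cc: "continuous_on {0..T} c" by (rule DERIV_continuous_on[of _ c c']) (use c in auto)
  have a: "continuous_on {0..T} (\<lambda>u. c u *\<^sub>R lam u)" by (intro continuous_on_scaleR cc lam_cont)
  show ?thesis
    by (rule has_ito_integralI[OF L2_adapted_weighted_N[OF t a] weighted_N_ito[OF assms] weighted_N_Riemann[OF t a]])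
qed

end

section \<open>The market\<close>

locale market = brownian M W for M :: "'w measure" and W :: "real \<Rightarrow> 'w \<Rightarrow> real^'d" +
  fixes r :: "real \<Rightarrow> real" and b :: "real \<Rightarrow> real^'n" and \<sigma> :: "real \<Rightarrow> real^'d^'n" and x \<epsilon> :: real
  assumes x: "0 < x"
    and r_cont: "continuous_on {0..} r" and b_cont: "continuous_on {0..} b" and \<sigma>_cont: "continuous_on {0..} \<sigma>"
    and r_pos: "\<And>t. 0 \<le> t \<Longrightarrow> 0 < r t" and \<beta>_pos: "\<And>t i. 0 \<le> t \<Longrightarrow> 0 < excess r b t $ i"
    and \<epsilon>: "0 < \<epsilon>" and elliptic: "\<And>t. 0 \<le> t \<Longrightarrow> pos_def (cov \<sigma> t - mat \<epsilon>)"
begin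

definition \<beta> :: "real \<Rightarrow> real^'n" where "\<beta> = excess r b"
text \<open>
  The feedback strategies are random multiples of this portfolio, the solution of \<open>\<sigma> \<sigma>\<^sup>T v = \<beta>\<close>.
\<close>
definition direction :: "real \<Rightarrow> real^'n" where "direction t = excess r b t v* matrix_inv (cov \<sigma> t)"
text \<open>
  The market price of risk.
\<close>
definition risk_price :: "real \<Rightarrow> real^'d" where "risk_price t = direction t v* \<sigma> t"

lemma cov_coercive: assumes "0 \<le> t" shows "\<epsilon> * (norm v)\<^sup>2 \<le> v \<bullet> (cov \<sigma> t *v v)"
proof (cases "v = 0")
  case False
  have "mat \<epsilon> *v v = \<epsilon> *\<^sub>R v"
    by (simp add: vec_eq_iff matrix_vector_mult_def mat_def if_distrib[of "\<lambda>y. y * _"] cong: if_cong)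
  then have "v \<bullet> ((cov \<sigma> t - mat \<epsilon>) *v v) = v \<bullet> (cov \<sigma> t *v v) - \<epsilon> * (v \<bullet> v)"
    by (simp only: matrix_vector_mult_diff_rdistrib inner_diff_right inner_scaleR_right)
  moreover have "0 < v \<bullet> ((cov \<sigma> t - mat \<epsilon>) *v v)"
    using elliptic[OF assms] False unfolding pos_def_def by blast
  ultimately show ?thesis by (simp add: power2_norm_eq_inner)
qed simp

lemma cov_norm: assumes "0 \<le> t" shows "\<epsilon> * norm v \<le> norm (cov \<sigma> t *v v)"
proof (cases "v = 0")
  case False
  have "\<epsilon> * (norm v)\<^sup>2 \<le> norm v * norm (cov \<sigma> t *v v)"
    using cov_coercive[OF assms, of v] norm_cauchy_schwarz[of v "cov \<sigma> t *v v"] by linarith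
  then have "norm v * (\<epsilon> * norm v) \<le> norm v * norm (cov \<sigma> t *v v)"
    by (simp add: power2_eq_square mult_ac)
  then show ?thesis using False by simp
qed simp

lemma cov_sym: "transpose (cov \<sigma> t) = cov \<sigma> t"
  by (simp add: cov_def matrix_transpose_mul)

lemma cov_inverse: assumes "0 \<le> t" shows "matrix_inv (cov \<sigma> t) ** cov \<sigma> t = mat 1"
proof -
  have "\<forall>v. cov \<sigma> t *v v = 0 \<longrightarrow> v = 0"
  proof (intro allI impI)
    fix v assume "cov \<sigma> t *v v = 0"
    then have "\<epsilon> * norm v \<le> 0" using cov_norm[OF assms, of v] by simp
    then show "v = 0" using \<epsilon> by (simp add: mult_le_0_iff)
  qed
  then have "invertible (cov \<sigma> t)" using matrix_left_invertible_ker invertible_left_inverse by blast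
  then have "\<exists>A'. cov \<sigma> t ** A' = mat 1 \<and> A' ** cov \<sigma> t = mat 1" by (simp add: invertible_def)
  from someI_ex[OF this] show ?thesis by (simp add: matrix_inv_def)
qed

lemma cov_direction: assumes "0 \<le> t" shows "cov \<sigma> t *v direction t = \<beta> t"
proof -
  have "cov \<sigma> t *v direction t = transpose (cov \<sigma> t) *v direction t" by (simp add: cov_sym)
  also have "\<dots> = direction t v* cov \<sigma> t" by (rule transpose_matrix_vector)
  also have "\<dots> = \<beta> t" by (simp add: direction_def vector_matrix_mul_assoc cov_inverse[OF assms] \<beta>_def)
  finally show ?thesis .
qed

text \<open>
  The identity that makes drift and covariation cancel in \<open>wealth_density_pairing\<close>.
\<close>
lemma vector_sigma_risk_price: assumes "0 \<le> t" shows "(v v* \<sigma> t) \<bullet> risk_price t = v \<bullet> \<beta> t"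
proof -
  have "(v v* \<sigma> t) \<bullet> risk_price t = v \<bullet> (\<sigma> t *v (direction t v* \<sigma> t))" by (simp add: dot_lmul_matrix risk_price_def)
  also have "direction t v* \<sigma> t = transpose (\<sigma> t) *v direction t" by simp
  also have "\<sigma> t *v (transpose (\<sigma> t) *v direction t) = \<beta> t"
    unfolding matrix_vector_mul_assoc using cov_direction[OF assms] by (simp add: cov_def)
  finally show ?thesis .
qed

lemma phi_eq: "phi r b \<sigma> t = direction t \<bullet> \<beta> t"
  by (simp add: phi_def direction_def \<beta>_def)

lemma phi_eq_norm: assumes "0 \<le> t" shows "phi r b \<sigma> t = (norm (risk_price t))\<^sup>2"
  using vector_sigma_risk_price[OF assms, of "direction t"] by (simp add: phi_eq risk_price_def power2_norm_eq_inner)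

lemma phi_pos: assumes "0 \<le> t" shows "0 < phi r b \<sigma> t"
proof -
  have "\<beta> t \<noteq> 0" using \<beta>_pos[OF assms, of undefined] by (auto simp: \<beta>_def)
  then have "direction t \<noteq> 0" using cov_direction[OF assms] by auto
  then have "0 < \<epsilon> * (norm (direction t))\<^sup>2" using \<epsilon> by simp
  also have "\<dots> \<le> direction t \<bullet> \<beta> t" using cov_coercive[OF assms, of "direction t"] cov_direction[OF assms] by simp
  finally show ?thesis by (simp add: phi_eq)
qed

lemma \<beta>_cont: "continuous_on {0..} \<beta>"
proof -
  have "\<beta> = (\<lambda>t. \<chi> i. b t $ i - r t)" by (auto simp: \<beta>_def excess_def)
  then show ?thesis by (auto intro!: continuous_intros b_cont r_cont)
qed

lemma vector_matrix_cont:
  assumes "continuous_on S f" "continuous_on S A" shows "continuous_on S (\<lambda>t. f t v* (A t :: real^'k^'l))"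
  unfolding vector_matrix_mult_def using assms by (auto intro!: continuous_intros)

lemma matrix_vector_cont:
  assumes "continuous_on S f" "continuous_on S A" shows "continuous_on S (\<lambda>t. (A t :: real^'k^'l) *v f t)"
  unfolding matrix_vector_mult_def using assms by (auto intro!: continuous_intros)

text \<open>
  No formula for the inverse matrix is needed: by ellipticity,
  \<open>\<epsilon> |v(t) - v(s)| \<le> |\<beta>(t) - \<sigma>(t) \<sigma>(t)\<^sup>T v(s)|\<close> for the portfolio \<open>v\<close>, and the right side tends to \<open>0\<close>
  as \<open>t\<close> tends to \<open>s\<close>.
\<close>
lemma direction_cont: "continuous_on {0..} direction"
  unfolding continuous_on_def
proof
  fix s :: real assume s: "s \<in> {0..}"
  have "continuous_on {0..} (\<lambda>t. norm (\<beta> t - \<sigma> t *v (direction s v* \<sigma> t)) / \<epsilon>)"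
    using \<epsilon> by (intro continuous_intros \<beta>_cont matrix_vector_cont vector_matrix_cont \<sigma>_cont) auto
  then have "((\<lambda>t. norm (\<beta> t - \<sigma> t *v (direction s v* \<sigma> t)) / \<epsilon>) \<longlongrightarrow> norm (\<beta> s - \<sigma> s *v (direction s v* \<sigma> s)) / \<epsilon>) (at s within {0..})"
    using s by (auto simp: continuous_on_def)
  moreover have cov_eq: "\<sigma> t *v (w v* \<sigma> t) = cov \<sigma> t *v w" for t w
    by (simp add: cov_def matrix_vector_mul_assoc[symmetric])
  ultimately have lim: "((\<lambda>t. norm (\<beta> t - cov \<sigma> t *v direction s) / \<epsilon>) \<longlongrightarrow> 0) (at s within {0..})"
    using cov_direction[of s] s by simp
  have "((\<lambda>t. direction t - direction s) \<longlongrightarrow> 0) (at s within {0..})"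
  proof (rule Lim_null_comparison[OF _ lim])
    have "norm (direction t - direction s) \<le> norm (\<beta> t - cov \<sigma> t *v direction s) / \<epsilon>" if "0 \<le> t" for t
      using cov_norm[OF that, of "direction t - direction s"] \<epsilon> cov_direction[OF that]
      by (simp add: matrix_vector_mult_diff_distrib field_simps)
    then show "\<forall>\<^sub>F t in at s within {0..}. norm (direction t - direction s) \<le> norm (\<beta> t - cov \<sigma> t *v direction s) / \<epsilon>"
      by (auto simp: eventually_at_topological)
  qed
  then show "(direction \<longlongrightarrow> direction s) (at s within {0..})" by (simp add: LIM_zero_cancel)
qed

lemma risk_price_cont: "continuous_on {0..} risk_price"
  unfolding risk_price_def[abs_def] by (intro vector_matrix_cont direction_cont \<sigma>_cont)

lemma phi_cont: "continuous_on {0..} (phi r b \<sigma>)"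
  unfolding phi_eq[abs_def] by (intro continuous_intros direction_cont \<beta>_cont)

section \<open>The wealth equation\<close>

abbreviation ws :: "real \<Rightarrow> (real \<Rightarrow> 'w \<Rightarrow> real^'n) \<Rightarrow> (real \<Rightarrow> 'w \<Rightarrow> real) \<Rightarrow> bool" where
  "ws \<equiv> wealth_solution M W r b \<sigma> x"

definition drift :: "(real \<Rightarrow> 'w \<Rightarrow> real^'n) \<Rightarrow> (real \<Rightarrow> 'w \<Rightarrow> real) \<Rightarrow> real \<Rightarrow> 'w \<Rightarrow> real" where
  "drift \<pi> X s \<omega> = r s * X s \<omega> + excess r b s \<bullet> \<pi> s \<omega>"

definition vol :: "(real \<Rightarrow> 'w \<Rightarrow> real^'n) \<Rightarrow> real \<Rightarrow> 'w \<Rightarrow> real^'d" where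
  "vol \<pi> s \<omega> = \<pi> s \<omega> v* \<sigma> s"

lemma cutoff_fst_measurable:
  fixes a :: "real \<Rightarrow> 'b::euclidean_space"
  assumes "continuous_on {0..T} a"
  shows "(\<lambda>z. indicator {0..T} (fst z) *\<^sub>R a (fst z)) \<in> borel_measurable P"
proof -
  have "(\<lambda>s. indicator {0..T} s *\<^sub>R a s) \<in> borel_measurable borel"
    by (rule borel_measurable_continuous_on_indicator[OF _ assms]) simp
  from measurable_compose[OF _ this, of fst P] show ?thesis by (simp add: measurable_fst'')
qed

lemma sqint_drift:
  assumes "sqint P (cutoff T \<pi>)" "sqint P (cutoff T X)"
  shows "sqint P (cutoff T (drift \<pi> X))"
proof -
  have rc: "continuous_on {0..T} r" and bc: "continuous_on {0..T} (excess r b)"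
    using continuous_on_subset[OF r_cont] continuous_on_subset[OF \<beta>_cont] by (auto simp: \<beta>_def)
  obtain R where R: "\<And>s. 0 \<le> s \<Longrightarrow> s \<le> T \<Longrightarrow> norm (r s) \<le> R" using continuous_Icc_bound[OF rc] by blast
  obtain Q where Q: "\<And>s. 0 \<le> s \<Longrightarrow> s \<le> T \<Longrightarrow> norm (excess r b s) \<le> Q" using continuous_Icc_bound[OF bc] by blast
  let ?r = "\<lambda>z. indicator {0..T} (fst z) *\<^sub>R r (fst z)" and ?b = "\<lambda>z. indicator {0..T} (fst z) *\<^sub>R excess r b (fst z)"
  have 1: "sqint P (\<lambda>z. ?r z * cutoff T X z)"
  proof (rule sqint_bound[OF assms(2), where C=R])
    show "(\<lambda>z. ?r z * cutoff T X z) \<in> borel_measurable P"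
      by (intro borel_measurable_times cutoff_fst_measurable rc sqint_measurable assms)
    show "AE z in P. norm (?r z * cutoff T X z) \<le> R * norm (cutoff T X z)"
      using R by (intro AE_I2) (auto simp: cutoff_def indicator_def abs_mult intro!: mult_right_mono)
  qed
  have 2: "sqint P (\<lambda>z. ?b z \<bullet> cutoff T \<pi> z)"
  proof (rule sqint_bound[OF assms(1), where C=Q])
    show "(\<lambda>z. ?b z \<bullet> cutoff T \<pi> z) \<in> borel_measurable P"
      by (intro borel_measurable_inner cutoff_fst_measurable bc sqint_measurable assms)
    have "norm (?b z \<bullet> cutoff T \<pi> z) \<le> Q * norm (cutoff T \<pi> z)" for z
    proof -
      have "norm (?b z \<bullet> cutoff T \<pi> z) \<le> norm (?b z) * norm (cutoff T \<pi> z)" by (simp only: real_norm_def Cauchy_Schwarz_ineq2)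
      also have "\<dots> \<le> Q * norm (cutoff T \<pi> z)"
        using Q by (cases "fst z \<in> {0..T}") (auto simp: cutoff_def split_beta' intro!: mult_right_mono)
      finally show ?thesis .
    qed
    then show "AE z in P. norm (?b z \<bullet> cutoff T \<pi> z) \<le> Q * norm (cutoff T \<pi> z)" by simp
  qed
  have "(\<lambda>z. ?r z * cutoff T X z + ?b z \<bullet> cutoff T \<pi> z) = cutoff T (drift \<pi> X)"
    by (auto simp: cutoff_def drift_def indicator_def)
  then show ?thesis using sqint_add[OF 1 2] by simp
qed

lemma ws_mono:
  assumes "ws T \<pi> X" "S \<le> T" shows "ws S \<pi> X"
proof -
  have "AE \<omega> in M. continuous_on {0..T} (\<lambda>t. X t \<omega>)" using assms(1) by (simp add: wealth_solution_def)
  then have "AE \<omega> in M. continuous_on {0..S} (\<lambda>t. X t \<omega>)"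
    by eventually_elim (rule continuous_on_subset, use assms(2) in auto)
  then show ?thesis
    using assms L2_adapted_mono[OF _ assms(2), of \<pi>] L2_adapted_mono[OF _ assms(2), of X]
    unfolding wealth_solution_def by auto
qed

lemma ws_L2: assumes "ws T \<pi> X" "0 \<le> t" "t \<le> T"
  shows "sqint P (cutoff t \<pi>)" "sqint P (cutoff t X)" "sqint P (cutoff t (drift \<pi> X))"
proof -
  have "L2_adapted M W t \<pi>" "L2_adapted M W t X"
    using ws_mono[OF assms(1,3)] by (auto simp: wealth_solution_def)
  then show "sqint P (cutoff t \<pi>)" "sqint P (cutoff t X)" by (auto intro: L2_adapted_cutoff)
  then show "sqint P (cutoff t (drift \<pi> X))" by (rule sqint_drift)
qed

lemma ws_eq:
  assumes "ws T \<pi> X" "0 \<le> t" "t \<le> T"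
  obtains I where "ito (cutoff t (vol \<pi>)) I" "AE \<omega> in M. X t \<omega> = x + (LINT s|lborel. cutoff t (drift \<pi> X) (s, \<omega>)) + I \<omega>"
proof -
  obtain I where I: "has_ito_integral M W t (\<lambda>s \<omega>. \<pi> s \<omega> v* \<sigma> s) I"
    "AE \<omega> in M. X t \<omega> = x + (LINT s:{0..t}|lborel. r s * X s \<omega> + excess r b s \<bullet> \<pi> s \<omega>) + I \<omega>"
    using assms unfolding wealth_solution_def by (meson atLeastAtMost_iff)
  then show ?thesis
    using that[of I] has_ito_imp_ito[OF I(1)] by (simp add: vol_def[abs_def] cutoff_def set_lebesgue_integral_def drift_def)
qed

text \<open>
  Square integrability in time and outcome says nothing about a single time; that follows from the
  equation.
\<close>
lemma ws_L2F: assumes "ws T \<pi> X" "0 \<le> t" "t \<le> T" shows "L2F t (X t)"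
proof -
  obtain I where I: "ito (cutoff t (vol \<pi>)) I" "AE \<omega> in M. X t \<omega> = x + (LINT s|lborel. cutoff t (drift \<pi> X) (s, \<omega>)) + I \<omega>"
    using ws_eq[OF assms] by blast
  have m: "X t \<in> borel_measurable (F t)" using assms by (auto simp: wealth_solution_def L2_adapted_def)
  have "sqint M (\<lambda>\<omega>. x + (LINT s|lborel. cutoff t (drift \<pi> X) (s, \<omega>)) + I \<omega>)"
    using assms by (intro sqint_add sqint_const time_integral(1)[OF ws_L2(3)[OF assms]] ito_sqint(2)[OF I(1)]) (auto simp: cutoff_def)
  then have "sqint M (X t)"
    by (rule sqint_cong_AE[OF _ filt_measurable[OF m]]) (use I(2) in \<open>auto elim: AE_mp\<close>)
  then show ?thesis using m by (simp add: L2F_def)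
qed

lemma ws_mean:
  assumes "ws T \<pi> X" "0 \<le> t" "t \<le> T"
  shows "expectation (X t) = x + (LINT s:{0..t}|lborel. expectation (drift \<pi> X s))"
    "set_integrable lborel {0..t} (\<lambda>s. expectation (drift \<pi> X s))"
proof -
  obtain I where I: "ito (cutoff t (vol \<pi>)) I" "AE \<omega> in M. X t \<omega> = x + (LINT s|lborel. cutoff t (drift \<pi> X) (s, \<omega>)) + I \<omega>"
    using ws_eq[OF assms] by blast
  note ti = time_integral[OF ws_L2(3)[OF assms] assms(2)]
  have z: "cutoff t (drift \<pi> X) (u, \<omega>) = 0" if "u \<notin> {0..t}" for u \<omega> using that by (simp add: cutoff_def)
  have i1: "integrable M (\<lambda>\<omega>. LINT s|lborel. cutoff t (drift \<pi> X) (s, \<omega>))"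
    by (rule sqint_integrable[OF ti(1)]) (rule z)
  have i2: "integrable M I" by (rule sqint_integrable[OF ito_sqint(2)[OF I(1)]])
  have "expectation (X t) = expectation (\<lambda>\<omega>. x + (LINT s|lborel. cutoff t (drift \<pi> X) (s, \<omega>)) + I \<omega>)"
    by (rule integral_cong_AE) (use I(2) L2F_sqint[OF ws_L2F[OF assms]] i1 i2 in \<open>auto simp: sqint_def\<close>)
  also have "\<dots> = x + expectation (\<lambda>\<omega>. LINT s|lborel. cutoff t (drift \<pi> X) (s, \<omega>)) + expectation I"
    using i1 i2 by (simp add: prob_space)
  also have "expectation I = 0" by (rule ito_expectation[OF I(1) cutoff_AE_0])
  also have "expectation (\<lambda>\<omega>. LINT s|lborel. cutoff t (drift \<pi> X) (s, \<omega>)) = (LINT u|lborel. expectation (\<lambda>\<omega>. cutoff t (drift \<pi> X) (u, \<omega>)))"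
    using ti(3)[OF z sqint_const[of 1]] by simp
  also have eq: "(\<lambda>u. expectation (\<lambda>\<omega>. cutoff t (drift \<pi> X) (u, \<omega>))) = (\<lambda>u. indicator {0..t} u *\<^sub>R expectation (drift \<pi> X u))"
    by (auto simp: cutoff_def)
  finally show "expectation (X t) = x + (LINT s:{0..t}|lborel. expectation (drift \<pi> X s))"
    by (simp add: set_lebesgue_integral_def)
  show "set_integrable lborel {0..t} (\<lambda>s. expectation (drift \<pi> X s))"
    using ti(4)[OF z sqint_const[of 1]] unfolding set_integrable_def by (simp add: eq)
qed

text \<open>
  The stochastic integral has mean zero, so the mean is an indefinite integral.
\<close>
lemma ws_mean_continuous:
  assumes "ws T \<pi> X" "0 \<le> T" shows "continuous_on {0..T} (\<lambda>t. expectation (X t))"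
proof -
  note i = ws_mean(2)[OF assms(1) assms(2) order_refl]
  let ?f = "\<lambda>s. expectation (drift \<pi> X s)"
  have "continuous_on {0..T} (\<lambda>t. x + integral {0..t} ?f)"
    using set_borel_integral_eq_integral(1)[OF i] by (intro continuous_intros indefinite_integral_continuous_1)
  then show ?thesis
  proof (rule continuous_on_eq)
    fix t assume "t \<in> {0..T}"
    then have t: "0 \<le> t" "t \<le> T" by auto
    show "x + integral {0..t} ?f = expectation (X t)"
      using ws_mean(1)[OF assms(1) t] set_borel_integral_eq_integral(2)[OF ws_mean(2)[OF assms(1) t]] by simp
  qed
qed

lemma sqnorm_cutoff_integral:
  assumes "sqint P (cutoff T f)" shows "set_integrable lborel {0..T} (\<lambda>s. sqnorm M (f s))"
    "0 \<le> t \<Longrightarrow> t \<le> T \<Longrightarrow> sqint P (cutoff t f) \<Longrightarrow> sqnorm P (cutoff t f) = (LINT s:{0..t}|lborel. sqnorm M (f s))"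
proof -
  have eq: "(\<lambda>u. sqnorm M (\<lambda>\<omega>. cutoff t f (u, \<omega>))) = (\<lambda>u. indicator {0..t} u *\<^sub>R sqnorm M (f u))" for t
    by (auto simp: cutoff_def indicator_def sqnorm_def)
  show "set_integrable lborel {0..T} (\<lambda>s. sqnorm M (f s))"
    using sqint_sections(2)[OF assms] by (simp add: eq set_integrable_def)
  show "0 \<le> t \<Longrightarrow> t \<le> T \<Longrightarrow> sqint P (cutoff t f) \<Longrightarrow> sqnorm P (cutoff t f) = (LINT s:{0..t}|lborel. sqnorm M (f s))"
    using sqint_sections(3)[of "cutoff t f"] unfolding eq by (simp add: set_lebesgue_integral_def)
qed

text \<open>
  One statement covers both uses: \<open>w = 0\<close> for two wealth processes of the same strategy, and
  \<open>w = direction\<close> for two solutions of the closed-loop equation. In either case the differences of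
  drift and volatility are controlled by the difference \<open>Y\<close> of the wealth processes, and Gronwall applies to
  the second moment of \<open>Y\<close>.
\<close>
lemma ws_unique:
  assumes X: "ws T \<pi> X" and X': "ws T \<pi>' X'" and t: "0 \<le> t" "t \<le> T"
    and diff: "\<And>s \<omega>. 0 \<le> s \<Longrightarrow> s \<le> T \<Longrightarrow> \<omega> \<in> space M \<Longrightarrow> \<pi> s \<omega> - \<pi>' s \<omega> = (X' s \<omega> - X s \<omega>) *\<^sub>R w s"
    and bound: "\<And>s. 0 \<le> s \<Longrightarrow> s \<le> T \<Longrightarrow> \<bar>r s - excess r b s \<bullet> w s\<bar> \<le> C"
      "\<And>s. 0 \<le> s \<Longrightarrow> s \<le> T \<Longrightarrow> norm (w s v* \<sigma> s) \<le> C"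
  shows "AE \<omega> in M. X t \<omega> = X' t \<omega>"
proof -
  define Y where "Y s \<omega> = X s \<omega> - X' s \<omega>" for s \<omega>
  \<comment> \<open>one factor 2 for the square of a sum; \<open>T\<close> is the cost of Cauchy-Schwarz in time\<close>
  define K where "K = (2 * T + 2) * C\<^sup>2"
  have C0: "0 \<le> C" using bound(1)[OF t] by linarith
  have K0: "0 \<le> K" using t by (simp add: K_def)
  have cutY: "cutoff s Y = (\<lambda>z. cutoff s X z - cutoff s X' z)" for s by (auto simp: cutoff_def Y_def indicator_def)
  have sY: "sqint P (cutoff s Y)" if "0 \<le> s" "s \<le> T" for s
    unfolding cutY by (intro sqint_diff ws_L2(2)[OF X that] ws_L2(2)[OF X' that])
  have "sqnorm M (Y t) \<le> 0 * exp (K * t)"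
  proof (rule gronwall[OF _ K0 order_refl _ t])
    show "set_integrable lborel {0..T} (\<lambda>s. sqnorm M (Y s))"
      using t by (intro sqnorm_cutoff_integral(1) sY) auto
    fix t assume t: "0 \<le> t" "t \<le> T"
    obtain I where I: "ito (cutoff t (vol \<pi>)) I" "AE \<omega> in M. X t \<omega> = x + (LINT s|lborel. cutoff t (drift \<pi> X) (s, \<omega>)) + I \<omega>"
      using ws_eq[OF X t] by blast
    obtain I' where I': "ito (cutoff t (vol \<pi>')) I'" "AE \<omega> in M. X' t \<omega> = x + (LINT s|lborel. cutoff t (drift \<pi>' X') (s, \<omega>)) + I' \<omega>"
      using ws_eq[OF X' t] by blast
    let ?D = "\<lambda>z. cutoff t (drift \<pi> X) z - cutoff t (drift \<pi>' X') z"
    have sD: "sqint P ?D" by (intro sqint_diff ws_L2(3)[OF X t] ws_L2(3)[OF X' t])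
    have z: "cutoff t f (v, \<omega>) = 0" if "v \<notin> {0..t}" for v \<omega> and f :: "real \<Rightarrow> 'w \<Rightarrow> real" using that by (simp add: cutoff_def)
    have "AE \<omega> in M. integrable lborel (\<lambda>s. cutoff t (drift \<pi> X) (s, \<omega>))"
      "AE \<omega> in M. integrable lborel (\<lambda>s. cutoff t (drift \<pi>' X') (s, \<omega>))"
      using time_integral(5)[OF ws_L2(3)[OF X t] t(1)] time_integral(5)[OF ws_L2(3)[OF X' t] t(1)] z by auto
    with I(2) I'(2) have DI: "AE \<omega> in M. Y t \<omega> = (LINT s|lborel. ?D (s, \<omega>)) + (I \<omega> - I' \<omega>)"
      by eventually_elim (simp add: Y_def)
    note tD = time_integral[OF sD t(1)]
    have zD: "?D (v, \<omega>) = 0" if "v \<notin> {0..t}" for v \<omega> using that by (simp add: cutoff_def)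
    have iI: "ito (\<lambda>z. cutoff t (vol \<pi>) z - cutoff t (vol \<pi>') z) (\<lambda>\<omega>. I \<omega> - I' \<omega>)" by (rule ito_diff[OF I(1) I'(1)])
    have d2: "sqnorm P ?D \<le> sqnorm P (\<lambda>z. C *\<^sub>R cutoff t Y z)"
    proof (rule sqnorm_mono[OF sD sqint_scaleR[OF sY[OF t]] AE_I2])
      fix z assume "z \<in> space P"
      then obtain s \<omega> where zz: "z = (s, \<omega>)" "\<omega> \<in> space M" by (auto simp: space_pair_measure)
      show "norm (?D z) \<le> norm (C *\<^sub>R cutoff t Y z)"
      proof (cases "s \<in> {0..t}")
        case True
        then have s: "0 \<le> s" "s \<le> T" using t by auto
        have "drift \<pi> X s \<omega> - drift \<pi>' X' s \<omega> = r s * Y s \<omega> + excess r b s \<bullet> (\<pi> s \<omega> - \<pi>' s \<omega>)"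
          by (simp add: drift_def Y_def inner_diff algebra_simps)
        also have "\<dots> = (r s - excess r b s \<bullet> w s) * Y s \<omega>" unfolding diff[OF s zz(2)] by (simp add: Y_def algebra_simps)
        finally have "\<bar>drift \<pi> X s \<omega> - drift \<pi>' X' s \<omega>\<bar> = \<bar>r s - excess r b s \<bullet> w s\<bar> * \<bar>Y s \<omega>\<bar>" by (simp add: abs_mult)
        also have "\<dots> \<le> C * \<bar>Y s \<omega>\<bar>" by (intro mult_right_mono bound s) auto
        finally show ?thesis using True C0 by (simp add: cutoff_def zz abs_mult)
      qed (simp add: cutoff_def zz)
    qed
    \<comment> \<open>drift and volatility of \<open>Y\<close> are at most \<open>C |Y|\<close>\<close>
    have "sqnorm M (Y t) = sqnorm M (\<lambda>\<omega>. (LINT s|lborel. ?D (s, \<omega>)) + (I \<omega> - I' \<omega>))"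
      using L2F_sqint[OF ws_L2F[OF X t]] L2F_sqint[OF ws_L2F[OF X' t]] tD(1)[OF zD] ito_sqint(2)[OF iI]
      by (intro sqnorm_cong_AE DI) (auto simp: Y_def[abs_def] sqint_def)
    also have "\<dots> \<le> 2 * sqnorm M (\<lambda>\<omega>. LINT s|lborel. ?D (s, \<omega>)) + 2 * sqnorm M (\<lambda>\<omega>. I \<omega> - I' \<omega>)"
      by (intro sqnorm_add_le tD(1)[OF zD] ito_sqint(2)[OF iI])
    also have "sqnorm M (\<lambda>\<omega>. I \<omega> - I' \<omega>) = sqnorm P (\<lambda>z. cutoff t (vol \<pi>) z - cutoff t (vol \<pi>') z)" by (rule ito_norm[OF iI])
    also have "\<dots> \<le> sqnorm P (\<lambda>z. C *\<^sub>R cutoff t Y z)"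
    proof (rule sqnorm_mono[OF ito_sqint(1)[OF iI] sqint_scaleR[OF sY[OF t]] AE_I2])
      fix z assume "z \<in> space P"
      then obtain s \<omega> where zz: "z = (s, \<omega>)" "\<omega> \<in> space M" by (auto simp: space_pair_measure)
      show "norm (cutoff t (vol \<pi>) z - cutoff t (vol \<pi>') z) \<le> norm (C *\<^sub>R cutoff t Y z)"
      proof (cases "s \<in> {0..t}")
        case True
        then have s: "0 \<le> s" "s \<le> T" using t by auto
        have "vol \<pi> s \<omega> - vol \<pi>' s \<omega> = (X' s \<omega> - X s \<omega>) *\<^sub>R (w s v* \<sigma> s)"
          unfolding vol_def vector_matrix_mult_diff_distrib[symmetric] diff[OF s zz(2)] scaleR_vector_matrix_assoc ..
        then have "norm (vol \<pi> s \<omega> - vol \<pi>' s \<omega>) = \<bar>Y s \<omega>\<bar> * norm (w s v* \<sigma> s)" by (simp add: Y_def abs_minus_commute)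
        also have "\<dots> \<le> \<bar>Y s \<omega>\<bar> * C" by (intro mult_left_mono bound s) auto
        finally show ?thesis using True C0 by (simp add: cutoff_def zz abs_mult mult.commute)
      qed (simp add: cutoff_def zz)
    qed
    also have "\<dots> = C\<^sup>2 * sqnorm P (cutoff t Y)" by (rule sqnorm_scaleR)
    also have "sqnorm M (\<lambda>\<omega>. LINT s|lborel. ?D (s, \<omega>)) \<le> t * (C\<^sup>2 * sqnorm P (cutoff t Y))"
      using tD(2)[OF zD] mult_left_mono[OF d2 t(1)] unfolding sqnorm_scaleR by auto
    also have "2 * (t * (C\<^sup>2 * sqnorm P (cutoff t Y))) + 2 * (C\<^sup>2 * sqnorm P (cutoff t Y)) = (2 * t + 2) * C\<^sup>2 * sqnorm P (cutoff t Y)"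
      by (simp add: algebra_simps)
    also have "\<dots> \<le> K * sqnorm P (cutoff t Y)"
      unfolding K_def using t by (intro mult_right_mono) auto
    also have "sqnorm P (cutoff t Y) = (LINT s:{0..t}|lborel. sqnorm M (Y s))"
      using t by (intro sqnorm_cutoff_integral(2)[OF sY[of T]] sY) auto
    finally show "sqnorm M (Y t) \<le> 0 + K * (LINT s:{0..t}|lborel. sqnorm M (Y s))" by simp
  qed
  then have Yz: "sqnorm M (Y t) = 0" using sqnorm_nonneg[of M "Y t"] by simp
  have "sqint M (Y t)"
    unfolding Y_def[abs_def] by (intro sqint_diff L2F_sqint[OF ws_L2F[OF X t]] L2F_sqint[OF ws_L2F[OF X' t]])
  from sqnorm_zero_AE[OF this Yz] show ?thesis by eventually_elim (simp add: Y_def)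
qed

lemma ws_unique_same:
  assumes "ws T \<pi> X" "ws T \<pi> X'" "0 \<le> t" "t \<le> T"
  shows "AE \<omega> in M. X t \<omega> = X' t \<omega>"
proof -
  obtain R where R: "\<And>s. 0 \<le> s \<Longrightarrow> s \<le> T \<Longrightarrow> norm (r s) \<le> R"
    using continuous_Icc_bound[OF continuous_on_subset[OF r_cont]] by (metis atLeastAtMost_iff atLeast_iff subsetI)
  have "0 \<le> R" using R[OF assms(3,4)] norm_ge_zero[of "r t"] by linarith
  then show ?thesis using R by (intro ws_unique[OF assms, where w="\<lambda>s. 0" and C=R]) auto
qed

end

section \<open>Pricing with the density and the variance bound\<close>

context market
begin

abbreviation Phi :: "real \<Rightarrow> real" where "Phi t \<equiv> integral {0..t} (phi r b \<sigma>)"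

lemma r_cont_Icc: "continuous_on {0..T} r"
  using continuous_on_subset[OF r_cont] by auto

lemma phi_cont_Icc: "continuous_on {0..T} (phi r b \<sigma>)"
  using continuous_on_subset[OF phi_cont] by auto

lemma accum_has_derivative:
  "0 \<le> s \<Longrightarrow> s \<le> T \<Longrightarrow> (accum r has_real_derivative r s * accum r s) (at s within {0..T})"
  using exp_integral_has_derivative[OF r_cont_Icc] by (simp add: accum_def[abs_def])

lemma accum_pos: "0 < accum r t" by (simp add: accum_def)

lemma accum_cont: "continuous_on {0..T} (accum r)"
  by (rule DERIV_continuous_on) (use accum_has_derivative in auto)

lemma accum_0 [simp]: "accum r 0 = 1" by (simp add: accum_def)

lemma exp_mart_exists:
  assumes "0 < T" obtains L N where "exp_mart M W (\<lambda>t. - risk_price t) T L N"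
proof -
  have c: "continuous_on {0..T} (\<lambda>t. - risk_price t)"
    by (intro continuous_intros continuous_on_subset[OF risk_price_cont]) auto
  obtain L where L: "\<And>s. 0 \<le> s \<Longrightarrow> s \<le> T \<Longrightarrow> norm (- risk_price s) \<le> L" using continuous_Icc_bound[OF c] by blast
  interpret E: euler_scheme M W "\<lambda>t. - risk_price t" T L
    by unfold_locales (use assms c L in auto)
  obtain N where N: "\<And>\<omega>. continuous_on {0..T} (\<lambda>t. N t \<omega>)"
    "\<And>t. 0 \<le> t \<Longrightarrow> t \<le> T \<Longrightarrow> L2F t (N t)"
    "\<And>t. 0 \<le> t \<Longrightarrow> t \<le> T \<Longrightarrow> ito (cutoff t (\<lambda>u \<omega>. N u \<omega> *\<^sub>R (- risk_price u))) (\<lambda>\<omega>. N t \<omega> - 1)"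
    using E.exp_martingale_exists by blast
  have "exp_mart M W (\<lambda>t. - risk_price t) T L N"
    by unfold_locales (use N in auto)
  then show ?thesis by (rule that)
qed

lemma density_second_moment:
  assumes "exp_mart M W (\<lambda>t. - risk_price t) T L N" "0 \<le> t" "t \<le> T"
  shows "sqnorm M (N t) = exp (Phi t)"
proof -
  interpret E: exp_mart M W "\<lambda>t. - risk_price t" T L N by fact
  have "integral {0..t} (\<lambda>s. (norm (- risk_price s))\<^sup>2) = Phi t"
    by (rule integral_cong) (simp add: phi_eq_norm)
  then show ?thesis using E.N_second_moment[OF assms(2,3)] by simp
qed

text \<open>
  Expand \<open>X(t)\<close> by its equation. In the drift term \<open>N(t)\<close> may be replaced by \<open>N(s)\<close> by the martingale
  property, and the stochastic integral is paired with the one in \<open>N(t) - 1\<close> by the isometry. The terms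
  with \<open>\<pi>\<close> cancel, and \<open>m(t) = E(N(t) X(t))\<close> satisfies the integral equation of \<open>x A(t)\<close>.
\<close>
lemma wealth_density_pairing:
  assumes em: "exp_mart M W (\<lambda>t. - risk_price t) T L N" and X: "ws T \<pi> X" and t: "0 \<le> t" "t \<le> T"
  shows "expectation (\<lambda>\<omega>. N t \<omega> * X t \<omega>) = x * accum r t"
proof -
  interpret E: exp_mart M W "\<lambda>t. - risk_price t" T L N by fact
  have T0: "0 \<le> T" using E.T by simp
  define m where "m s = expectation (\<lambda>\<omega>. N s \<omega> * X s \<omega>)" for s
  have sN: "sqint P (cutoff T N)"
    using L2_adapted_cutoff[OF E.L2_adapted_weighted_N[OF T0 order_refl, of "\<lambda>_. 1::real"]] by simp
  have mi: "set_integrable lborel {0..T} m"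
  proof -
    have "integrable lborel (\<lambda>u. expectation (\<lambda>\<omega>. cutoff T N (u, \<omega>) * cutoff T X (u, \<omega>)))"
      by (rule P.integrable_fst'[OF sqint_mult[OF sN ws_L2(2)[OF X T0 order_refl]]])
    also have "(\<lambda>u. expectation (\<lambda>\<omega>. cutoff T N (u, \<omega>) * cutoff T X (u, \<omega>))) = (\<lambda>u. indicator {0..T} u *\<^sub>R m u)"
      by (auto simp: cutoff_def indicator_def m_def)
    finally show ?thesis by (simp add: set_integrable_def)
  qed
  obtain R where R: "\<And>s. 0 \<le> s \<Longrightarrow> s \<le> T \<Longrightarrow> norm (r s) \<le> R" using continuous_Icc_bound[OF r_cont_Icc] by blast
  have rm: "set_borel_measurable lborel {0..T} r"
    using set_integrable_continuous[OF r_cont_Icc] by (auto simp: set_integrable_def set_borel_measurable_def)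
  have "m t = x * accum r t"
  proof (rule volterra_unique[where u=m and v="\<lambda>t. x * accum r t" and a=r and c=x and C=R and T=T, OF mi _ rm _ _ _ t])
    show "set_integrable lborel {0..T} (\<lambda>t. x * accum r t)"
      by (intro set_integrable_continuous continuous_intros accum_cont)
    show "x * accum r t = x + (LINT s:{0..t}|lborel. r s * (x * accum r s))" if t: "0 \<le> t" "t \<le> T" for t
    proof -
      have "(LINT s:{0..t}|lborel. r s * (x * accum r s)) = x * accum r t - x * accum r 0"
      proof (rule set_integral_FTC[OF t(1)])
        show "continuous_on {0..t} (\<lambda>s. r s * (x * accum r s))"
          by (intro continuous_intros r_cont_Icc accum_cont)
        show "((\<lambda>t. x * accum r t) has_real_derivative r s * (x * accum r s)) (at s within {0..t})"
          if "0 \<le> s" "s \<le> t" for s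
          using DERIV_cmult[OF accum_has_derivative[OF that], of x] by (simp add: mult_ac)
      qed
      then show ?thesis by simp
    qed
    show "\<bar>r s\<bar> \<le> R" if "0 \<le> s" "s \<le> T" for s using R[OF that] by simp
    fix t assume t: "0 \<le> t" "t \<le> T"
    obtain I where I: "ito (cutoff t (vol \<pi>)) I" "AE \<omega> in M. X t \<omega> = x + (LINT s|lborel. cutoff t (drift \<pi> X) (s, \<omega>)) + I \<omega>"
      using ws_eq[OF X t] by blast
    have sNt: "sqint M (N t)" by (rule E.sqint_N[OF t])
    have sXt: "sqint M (X t)" using ws_L2F[OF X t] L2F_sqint by blast
    note ti = time_integral[OF ws_L2(3)[OF X t] t(1)]
    have z: "cutoff t (drift \<pi> X) (v, \<omega>) = 0" if "v \<notin> {0..t}" for v \<omega> using that by (simp add: cutoff_def)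
    have sJ: "sqint M (\<lambda>\<omega>. LINT s|lborel. cutoff t (drift \<pi> X) (s, \<omega>))" by (rule ti(1)) (rule z)
    have sI: "sqint M I" by (rule ito_sqint(2)[OF I(1)])
    let ?A = "\<lambda>u. expectation (\<lambda>\<omega>. N t \<omega> * cutoff t (drift \<pi> X) (u, \<omega>))"
    let ?B = "\<lambda>u. expectation (\<lambda>\<omega>. cutoff t E.Nlam (u, \<omega>) \<bullet> cutoff t (vol \<pi>) (u, \<omega>))"
    have iA: "integrable lborel ?A" by (rule ti(4)[OF _ sNt]) (rule z)
    have iP: "integrable P (\<lambda>z. cutoff t E.Nlam z \<bullet> cutoff t (vol \<pi>) z)"
      by (rule sqint_inner[OF ito_sqint(1)[OF E.N_ito[OF t]] ito_sqint(1)[OF I(1)]])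
    have iB: "integrable lborel ?B" by (rule P.integrable_fst'[OF iP])
    have "m t = expectation (\<lambda>\<omega>. x * N t \<omega> + N t \<omega> * (LINT s|lborel. cutoff t (drift \<pi> X) (s, \<omega>)) + N t \<omega> * I \<omega>)"
      unfolding m_def
    proof (rule integral_cong_AE)
      show "AE \<omega> in M. N t \<omega> * X t \<omega> = x * N t \<omega> + N t \<omega> * (LINT s|lborel. cutoff t (drift \<pi> X) (s, \<omega>)) + N t \<omega> * I \<omega>"
        using I(2) by eventually_elim (simp add: algebra_simps)
    qed (use sNt sXt sJ sI in \<open>auto simp: sqint_def\<close>)
    also have "\<dots> = x * expectation (N t) + expectation (\<lambda>\<omega>. N t \<omega> * (LINT s|lborel. cutoff t (drift \<pi> X) (s, \<omega>))) + expectation (\<lambda>\<omega>. N t \<omega> * I \<omega>)"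
      using sqint_integrable[OF sNt] sqint_mult[OF sNt sJ] sqint_mult[OF sNt sI] by simp
    also have "expectation (\<lambda>\<omega>. N t \<omega> * (LINT s|lborel. cutoff t (drift \<pi> X) (s, \<omega>))) = (LINT u|lborel. ?A u)"
      by (rule ti(3)[OF _ sNt]) (rule z)
    also have "expectation (\<lambda>\<omega>. N t \<omega> * I \<omega>) = (LINT u|lborel. ?B u)"
    proof -
      have "expectation (\<lambda>\<omega>. N t \<omega> * I \<omega>) = expectation (\<lambda>\<omega>. (N t \<omega> - 1) * I \<omega> + I \<omega>)"
        by (simp add: algebra_simps)
      also have "\<dots> = expectation (\<lambda>\<omega>. (N t \<omega> - 1) * I \<omega>) + expectation I"
        using sqint_mult[OF ito_sqint(2)[OF E.N_ito[OF t]] sI] sqint_integrable[OF sI] by simp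
      also have "expectation I = 0" by (rule ito_expectation[OF I(1) cutoff_AE_0])
      also have "expectation (\<lambda>\<omega>. (N t \<omega> - 1) * I \<omega>) = (\<integral>z. cutoff t E.Nlam z \<bullet> cutoff t (vol \<pi>) z \<partial>P)"
        by (rule ito_isometry[OF E.N_ito[OF t] I(1)])
      also have "\<dots> = (LINT u|lborel. ?B u)" by (rule P.integral_fst'[OF iP, symmetric])
      finally show ?thesis by simp
    qed
    also have "x * expectation (N t) + (LINT u|lborel. ?A u) + (LINT u|lborel. ?B u) = x + (LINT u|lborel. ?A u + ?B u)"
      using iA iB E.N_expectation[OF t] by simp
    also have "(LINT u|lborel. ?A u + ?B u) = (LINT s:{0..t}|lborel. r s * m s)"
      unfolding set_lebesgue_integral_def
    proof (rule integral_cong_AE)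
      have "(\<lambda>u. (indicator {0..T} u *\<^sub>R r u) * (indicator {0..t} u *\<^sub>R (indicator {0..T} u *\<^sub>R m u))) \<in> borel_measurable lborel"
        using rm mi unfolding set_borel_measurable_def set_integrable_def by auto
      also have "(\<lambda>u. (indicator {0..T} u *\<^sub>R r u) * (indicator {0..t} u *\<^sub>R (indicator {0..T} u *\<^sub>R m u))) = (\<lambda>u. indicator {0..t} u *\<^sub>R (r u * m u))"
        using t by (auto simp: indicator_def)
      finally show "(\<lambda>u. indicator {0..t} u *\<^sub>R (r u * m u)) \<in> borel_measurable lborel" .
      show "AE u in lborel. ?A u + ?B u = indicator {0..t} u *\<^sub>R (r u * m u)"
        using sqint_sections(1)[OF ws_L2(3)[OF X t]] sqint_sections(1)[OF ws_L2(2)[OF X t]]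
      proof eventually_elim
        fix u assume sD: "sqint M (\<lambda>\<omega>. cutoff t (drift \<pi> X) (u, \<omega>))" and sX: "sqint M (\<lambda>\<omega>. cutoff t X (u, \<omega>))"
        show "?A u + ?B u = indicator {0..t} u *\<^sub>R (r u * m u)"
        proof (cases "u \<in> {0..t}")
          case True
          then have u: "0 \<le> u" "u \<le> t" "u \<le> T" using t by auto
          have sD': "sqint M (drift \<pi> X u)" and sX': "sqint M (X u)" using sD sX True by (auto simp: cutoff_def)
          have "X u \<in> borel_measurable (F u)" "\<pi> u \<in> borel_measurable (F u)"
            using X u by (auto simp: wealth_solution_def L2_adapted_def)
          then have "drift \<pi> X u \<in> borel_measurable (F u)" unfolding drift_def[abs_def] by measurable
          then have LD: "L2F u (drift \<pi> X u)" using sD' by (simp add: L2F_def)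
          have sNu: "sqint M (N u)" by (rule E.sqint_N[OF u(1,3)])
          have "?A u = expectation (\<lambda>\<omega>. drift \<pi> X u \<omega> * N t \<omega>)" using True by (simp add: cutoff_def mult.commute)
          also have "\<dots> = expectation (\<lambda>\<omega>. drift \<pi> X u \<omega> * N u \<omega>)" by (rule E.N_martingale[OF u(1,2) t(2) LD])
          finally have A: "?A u = expectation (\<lambda>\<omega>. N u \<omega> * drift \<pi> X u \<omega>)" by (simp add: mult.commute)
          \<comment> \<open>the covariation term, \<open>(\<pi> \<sigma>) \<lambda> = - \<beta> \<pi>\<close>\<close>
          have NB: "cutoff t E.Nlam (u, \<omega>) \<bullet> cutoff t (vol \<pi>) (u, \<omega>) = N u \<omega> * (r u * X u \<omega> - drift \<pi> X u \<omega>)" for \<omega>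
            using vector_sigma_risk_price[OF u(1), of "\<pi> u \<omega>"] True
            by (simp add: cutoff_def vol_def drift_def \<beta>_def inner_commute)
          have B: "?B u = expectation (\<lambda>\<omega>. r u * (N u \<omega> * X u \<omega>) - N u \<omega> * drift \<pi> X u \<omega>)"
            unfolding NB by (simp add: right_diff_distrib mult.left_commute)
          have "?A u + ?B u = r u * m u"
            unfolding A B m_def using sqint_mult[OF sNu sD'] sqint_mult[OF sNu sX'] by simp
          then show ?thesis using True by simp
        qed (simp add: cutoff_def)
      qed
    qed (use iA iB in auto)
    finally show "m t = x + (LINT s:{0..t}|lborel. r s * m s)" .
  qed
  then show ?thesis by (simp add: m_def)
qed

text \<open>
  Cauchy-Schwarz for the covariance of \<open>X(T)\<close> and \<open>N(T)\<close>, which is \<open>x A(T) - E X(T)\<close>.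
\<close>
lemma variance_lower_bound:
  assumes "0 < T" and X: "ws T \<pi> X"
  shows "(expectation (X T) - x * accum r T)\<^sup>2 \<le> variance (X T) * (exp (Phi T) - 1)"
proof -
  obtain L N where em: "exp_mart M W (\<lambda>t. - risk_price t) T L N" using exp_mart_exists[OF assms(1)] by blast
  interpret E: exp_mart M W "\<lambda>t. - risk_price t" T L N by fact
  have T: "0 \<le> T" "T \<le> T" using assms by auto
  have sX: "sqint M (X T)" using ws_L2F[OF X T] L2F_sqint by blast
  have sN: "sqint M (N T)" by (rule E.sqint_N[OF T])
  let ?e = "expectation (X T)"
  have s1: "sqint M (\<lambda>\<omega>. X T \<omega> - ?e)" and s2: "sqint M (\<lambda>\<omega>. N T \<omega> - 1)"
    using sX sN by (auto intro!: sqint_diff sqint_const)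
  have iN: "integrable M (N T)" and iX: "integrable M (X T)" and iNX: "integrable M (\<lambda>\<omega>. N T \<omega> * X T \<omega>)"
    using sqint_integrable[OF sN] sqint_integrable[OF sX] sqint_mult[OF sN sX] by auto
  have "expectation (\<lambda>\<omega>. (X T \<omega> - ?e) \<bullet> (N T \<omega> - 1)) = expectation (\<lambda>\<omega>. N T \<omega> * X T \<omega> - X T \<omega> - ?e * N T \<omega> + ?e)"
    by (simp add: algebra_simps)
  also have "\<dots> = x * accum r T - ?e"
    using iN iX iNX wealth_density_pairing[OF em X T] E.N_expectation[OF T] by (simp add: prob_space)
  finally have cov: "expectation (\<lambda>\<omega>. (X T \<omega> - ?e) \<bullet> (N T \<omega> - 1)) = x * accum r T - ?e" .
  have "sqnorm M (\<lambda>\<omega>. N T \<omega> - 1) = sqnorm M (N T) - 2 * expectation (\<lambda>\<omega>. N T \<omega> \<bullet> 1) + sqnorm M (\<lambda>\<omega>. 1 :: real)"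
    by (rule sqnorm_diff[OF sN sqint_const])
  then have "sqnorm M (\<lambda>\<omega>. N T \<omega> - 1) = exp (Phi T) - 1"
    using E.N_expectation[OF T] density_second_moment[OF em T] by (simp add: sqnorm_def prob_space)
  moreover have "sqnorm M (\<lambda>\<omega>. X T \<omega> - ?e) = variance (X T)" by (simp add: sqnorm_def)
  moreover have "(?e - x * accum r T)\<^sup>2 = (x * accum r T - ?e)\<^sup>2" by (rule power2_commute)
  ultimately show ?thesis using integral_Cauchy_Schwarz[OF s1 s2] cov by simp
qed

lemma ws_cong_variance:
  assumes "ws T \<pi> X" "ws T \<pi> X'" "0 \<le> T"
  shows "expectation (X T) = expectation (X' T)" "variance (X T) = variance (X' T)"
proof -
  have ae: "AE \<omega> in M. X T \<omega> = X' T \<omega>" by (rule ws_unique_same[OF assms order_refl])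
  have m: "X T \<in> borel_measurable M" "X' T \<in> borel_measurable M"
    using ws_L2F[OF assms(1,3)] ws_L2F[OF assms(2,3)] by (auto simp: L2F_def sqint_def)
  show e: "expectation (X T) = expectation (X' T)" by (rule integral_cong_AE[OF m ae])
  show "variance (X T) = variance (X' T)"
    unfolding e by (rule integral_cong_AE) (use m ae in \<open>auto elim: AE_mp\<close>)
qed

section \<open>The closed-loop equation\<close>

definition closed_loop :: "real \<Rightarrow> real \<Rightarrow> (real \<Rightarrow> 'w \<Rightarrow> real^'n) \<Rightarrow> (real \<Rightarrow> 'w \<Rightarrow> real) \<Rightarrow> bool" where
  "closed_loop \<tau> \<gamma> \<pi> X \<longleftrightarrow> ws \<tau> \<pi> X \<and>
     (\<forall>t\<in>{0..\<tau>}. \<forall>\<omega>\<in>space M. \<pi> t \<omega> = (\<gamma> * exp (- integral {t..\<tau>} r) - X t \<omega>) *\<^sub>R direction t)"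

text \<open>
  The amount by which the initial capital falls short of the initial value of \<open>target\<close>.
\<close>
definition shortfall :: "real \<Rightarrow> real \<Rightarrow> real" where "shortfall \<tau> \<gamma> = \<gamma> / accum r \<tau> - x"
text \<open>
  The value at time \<open>t\<close> of the amount \<open>\<gamma>\<close> at time \<open>\<tau>\<close>, discounted with the rate \<open>r\<close>.
\<close>
definition target :: "real \<Rightarrow> real \<Rightarrow> real \<Rightarrow> real" where "target \<tau> \<gamma> t = \<gamma> / accum r \<tau> * accum r t"
text \<open>
  The distance of the wealth from \<open>target\<close> solves \<open>dY = (r - \<phi>) Y dt + Y \<lambda> dW\<close> with \<open>\<lambda>\<close> as for \<open>N\<close>. Hence
  \<open>Y / N\<close> is deterministic and solves \<open>c' = (r - \<phi>) c\<close>; the sign is that of \<open>X - target\<close>.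
\<close>
definition density_coeff :: "real \<Rightarrow> real \<Rightarrow> real \<Rightarrow> real" where "density_coeff \<tau> \<gamma> t = - shortfall \<tau> \<gamma> * (accum r t * exp (- Phi t))"

lemma target_eq: assumes "0 \<le> t" "t \<le> \<tau>" shows "\<gamma> * exp (- integral {t..\<tau>} r) = target \<tau> \<gamma> t"
proof -
  have "integral {0..t} r + integral {t..\<tau>} r = integral {0..\<tau>} r"
    using assms by (intro Henstock_Kurzweil_Integration.integral_combine integrable_continuous_real r_cont_Icc) auto
  then have "accum r \<tau> = accum r t * exp (integral {t..\<tau>} r)" by (simp add: accum_def flip: exp_add)
  then show ?thesis using accum_pos[of t] by (simp add: target_def exp_minus field_simps)
qed

lemma density_coeff_has_derivative:
  assumes "0 \<le> s" "s \<le> T"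
  shows "(density_coeff \<tau> \<gamma> has_real_derivative (r s - phi r b \<sigma> s) * density_coeff \<tau> \<gamma> s) (at s within {0..T})"
proof -
  have "((\<lambda>t. exp (- Phi t)) has_real_derivative - (phi r b \<sigma> s) * exp (- Phi s)) (at s within {0..T})"
    using integral_has_real_derivative[OF phi_cont_Icc, of s] assms by (auto intro!: derivative_eq_intros)
  from DERIV_cmult[OF DERIV_mult[OF accum_has_derivative[OF assms] this], of "- shortfall \<tau> \<gamma>"]
  show ?thesis by (simp add: density_coeff_def[abs_def] algebra_simps)
qed

lemma target_has_derivative:
  assumes "0 \<le> s" "s \<le> T"
  shows "(target \<tau> \<gamma> has_real_derivative r s * target \<tau> \<gamma> s) (at s within {0..T})"
  using DERIV_cmult[OF accum_has_derivative[OF assms], of "\<gamma> / accum r \<tau>"] by (simp add: target_def[abs_def] algebra_simps)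

lemma closed_loop_solution:
  assumes em: "exp_mart M W (\<lambda>t. - risk_price t) \<tau> L N"
  shows "closed_loop \<tau> \<gamma> (\<lambda>t \<omega>. N t \<omega> *\<^sub>R (- (density_coeff \<tau> \<gamma> t *\<^sub>R direction t))) (\<lambda>t \<omega>. target \<tau> \<gamma> t + density_coeff \<tau> \<gamma> t * N t \<omega>)" (is "closed_loop _ _ ?\<pi> ?X")
proof -
  interpret E: exp_mart M W "\<lambda>t. - risk_price t" \<tau> L N by fact
  have \<tau>: "0 \<le> \<tau>" using E.T by simp
  let ?c = "density_coeff \<tau> \<gamma>" and ?G = "target \<tau> \<gamma>"
  have cc: "continuous_on {0..\<tau>} ?c" by (rule DERIV_continuous_on) (use density_coeff_has_derivative in auto)
  have Gc: "continuous_on {0..\<tau>} ?G" by (rule DERIV_continuous_on) (use target_has_derivative in auto)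
  have uc: "continuous_on {0..\<tau>} direction" by (rule continuous_on_subset[OF direction_cont]) auto
  have \<pi>: "L2_adapted M W \<tau> ?\<pi>"
    by (intro E.L2_adapted_weighted_N \<tau> order_refl continuous_intros cc uc)
  have Xc: "continuous_on {0..\<tau>} (\<lambda>t. ?X t \<omega>)" for \<omega>
    by (intro continuous_intros cc Gc E.N_cont)
  have XF: "?X t \<in> borel_measurable (F t)" if "0 \<le> t" "t \<le> \<tau>" for t
  proof -
    have [measurable]: "N t \<in> borel_measurable (F t)" using E.L2F_N[OF that] by (simp add: L2F_def)
    show ?thesis by measurable
  qed
  have X: "L2_adapted M W \<tau> ?X"
  proof (rule L2_adaptedI[OF continuous_process_measurable[OF \<tau> Xc] XF])
    show "?X t \<in> borel_measurable M" if "0 \<le> t" "t \<le> \<tau>" for t using filt_measurable[OF XF[OF that]] .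
    obtain C where C: "\<And>s. 0 \<le> s \<Longrightarrow> s \<le> \<tau> \<Longrightarrow> norm (?G s) \<le> C" using continuous_Icc_bound[OF Gc] by blast
    have 1: "sqint P (cutoff \<tau> (\<lambda>t \<omega>. N t \<omega> *\<^sub>R ?c t))"
      by (intro L2_adapted_cutoff E.L2_adapted_weighted_N \<tau> order_refl cc)
    have 2: "sqint P (\<lambda>z. indicator {0..\<tau>} (fst z) *\<^sub>R ?G (fst z))"
      by (rule sqint_bound[OF sqint_P_lift(1)[OF sqint_const[of "1::real"] \<tau>] cutoff_fst_measurable[OF Gc], where C=C])
        (use C in \<open>auto intro!: AE_I2 simp: indicator_def\<close>)
    have "(\<lambda>z. indicator {0..\<tau>} (fst z) *\<^sub>R ?G (fst z) + cutoff \<tau> (\<lambda>t \<omega>. N t \<omega> *\<^sub>R ?c t) z) = cutoff \<tau> ?X"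
      by (auto simp: cutoff_def indicator_def)
    then show "sqint P (cutoff \<tau> ?X)" using sqint_add[OF 2 1] by simp
  qed auto
  have c': "continuous_on {0..\<tau>} (\<lambda>s. (r s - phi r b \<sigma> s) * ?c s)"
    by (intro continuous_intros r_cont_Icc phi_cont_Icc cc)
  have sde: "\<exists>I. has_ito_integral M W t (\<lambda>s \<omega>. ?\<pi> s \<omega> v* \<sigma> s) I \<and>
        (AE \<omega> in M. ?X t \<omega> = x + (LINT s:{0..t}|lborel. r s * ?X s \<omega> + excess r b s \<bullet> ?\<pi> s \<omega>) + I \<omega>)"
    if t: "t \<in> {0..\<tau>}" for t
  proof -
    have t: "0 \<le> t" "t \<le> \<tau>" using that by auto
    let ?I = "\<lambda>\<omega>. ?c t * N t \<omega> - ?c 0 - (LINT s:{0..t}|lborel. (r s - phi r b \<sigma> s) * ?c s * N s \<omega>)"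
    have "has_ito_integral M W t (\<lambda>s \<omega>. N s \<omega> *\<^sub>R (?c s *\<^sub>R (- risk_price s))) ?I"
      by (rule E.weighted_N_has_ito[OF t c' density_coeff_has_derivative])
    moreover have "?\<pi> s \<omega> v* \<sigma> s = N s \<omega> *\<^sub>R (?c s *\<^sub>R (- risk_price s))" for s \<omega>
    proof -
      have "?\<pi> s \<omega> = (- (N s \<omega> * ?c s)) *\<^sub>R direction s" by simp
      then show ?thesis unfolding risk_price_def by (simp only: scaleR_vector_matrix_assoc) simp
    qed
    ultimately have ito: "has_ito_integral M W t (\<lambda>s \<omega>. ?\<pi> s \<omega> v* \<sigma> s) ?I" by simp
    have "?X t \<omega> = x + (LINT s:{0..t}|lborel. r s * ?X s \<omega> + excess r b s \<bullet> ?\<pi> s \<omega>) + ?I \<omega>" for \<omega>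
    proof -
      have sub: "{0..t} \<subseteq> {0..\<tau>}" using t by auto
      have i1: "set_integrable lborel {0..t} (\<lambda>s. r s * ?G s)"
        by (intro set_integrable_continuous continuous_intros r_cont_Icc continuous_on_subset[OF Gc sub])
      have i2: "set_integrable lborel {0..t} (\<lambda>s. (r s - phi r b \<sigma> s) * ?c s * N s \<omega>)"
        by (intro set_integrable_continuous continuous_on_mult continuous_on_subset[OF c' sub] continuous_on_subset[OF E.N_cont sub])
      have "r s * ?X s \<omega> + excess r b s \<bullet> ?\<pi> s \<omega> = r s * ?G s + (r s - phi r b \<sigma> s) * ?c s * N s \<omega>" for s
        by (simp add: phi_eq \<beta>_def inner_commute algebra_simps)
      then have "(LINT s:{0..t}|lborel. r s * ?X s \<omega> + excess r b s \<bullet> ?\<pi> s \<omega>)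
        = (LINT s:{0..t}|lborel. r s * ?G s) + (LINT s:{0..t}|lborel. (r s - phi r b \<sigma> s) * ?c s * N s \<omega>)"
        using set_integral_add(2)[OF i1 i2] by simp
      also have "(LINT s:{0..t}|lborel. r s * ?G s) = ?G t - ?G 0"
        by (rule set_integral_FTC[OF t(1)])
          (use target_has_derivative in \<open>auto intro!: continuous_intros r_cont_Icc continuous_on_subset[OF Gc sub]\<close>)
      finally show ?thesis by (simp add: target_def density_coeff_def shortfall_def)
    qed
    then show ?thesis using ito by (intro exI[of _ ?I]) simp
  qed
  have "ws \<tau> ?\<pi> ?X" unfolding wealth_solution_def using \<pi> X Xc sde by simp
  moreover have "?\<pi> t \<omega> = (\<gamma> * exp (- integral {t..\<tau>} r) - ?X t \<omega>) *\<^sub>R direction t" if "t \<in> {0..\<tau>}" for t \<omega>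
    using that by (simp add: target_eq)
  ultimately show ?thesis by (simp add: closed_loop_def)
qed

lemma closed_loop_exists: assumes "0 < \<tau>" shows "\<exists>\<pi> X. closed_loop \<tau> \<gamma> \<pi> X"
proof -
  obtain L N where "exp_mart M W (\<lambda>t. - risk_price t) \<tau> L N" using exp_mart_exists[OF assms] by blast
  from closed_loop_solution[OF this] show ?thesis by (intro exI)
qed

text \<open>
  Every solution agrees with the one of \<open>closed_loop_solution\<close>, which is affine in \<open>N\<close>.
\<close>
lemma closed_loop_moments:
  assumes \<tau>: "0 < \<tau>" and cl: "closed_loop \<tau> \<gamma> \<pi> X" and t: "0 \<le> t" "t \<le> \<tau>"
  shows "expectation (X t) = target \<tau> \<gamma> t + density_coeff \<tau> \<gamma> t"
    "variance (X t) = (density_coeff \<tau> \<gamma> t)\<^sup>2 * (exp (Phi t) - 1)"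
proof -
  obtain L N where em: "exp_mart M W (\<lambda>t. - risk_price t) \<tau> L N" using exp_mart_exists[OF \<tau>] by blast
  interpret E: exp_mart M W "\<lambda>t. - risk_price t" \<tau> L N by fact
  let ?\<pi> = "\<lambda>t \<omega>. N t \<omega> *\<^sub>R (- (density_coeff \<tau> \<gamma> t *\<^sub>R direction t))" and ?X = "\<lambda>t \<omega>. target \<tau> \<gamma> t + density_coeff \<tau> \<gamma> t * N t \<omega>"
  have cl': "closed_loop \<tau> \<gamma> ?\<pi> ?X" by (rule closed_loop_solution[OF em])
  have X: "ws \<tau> \<pi> X" and X': "ws \<tau> ?\<pi> ?X" using cl cl' by (auto simp: closed_loop_def)
  have c1: "continuous_on {0..\<tau>} (\<lambda>s. r s - phi r b \<sigma> s)" by (intro continuous_intros r_cont_Icc phi_cont_Icc)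
  have c2: "continuous_on {0..\<tau>} risk_price" by (rule continuous_on_subset[OF risk_price_cont]) auto
  obtain C1 where C1: "\<And>s. 0 \<le> s \<Longrightarrow> s \<le> \<tau> \<Longrightarrow> norm (r s - phi r b \<sigma> s) \<le> C1" using continuous_Icc_bound[OF c1] by blast
  obtain C2 where C2: "\<And>s. 0 \<le> s \<Longrightarrow> s \<le> \<tau> \<Longrightarrow> norm (risk_price s) \<le> C2" using continuous_Icc_bound[OF c2] by blast
  have ae: "AE \<omega> in M. X t \<omega> = ?X t \<omega>"
  proof (rule ws_unique[OF X X' t, where w=direction and C="max C1 C2"])
    fix s \<omega> assume s: "0 \<le> s" "s \<le> \<tau>" and w: "\<omega> \<in> space M"
    have "\<pi> s \<omega> = (\<gamma> * exp (- integral {s..\<tau>} r) - X s \<omega>) *\<^sub>R direction s" "?\<pi> s \<omega> = (\<gamma> * exp (- integral {s..\<tau>} r) - ?X s \<omega>) *\<^sub>R direction s"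
      using cl cl' s w unfolding closed_loop_def by (blast intro: atLeastAtMost_iff[THEN iffD2])+
    then show "\<pi> s \<omega> - ?\<pi> s \<omega> = (?X s \<omega> - X s \<omega>) *\<^sub>R direction s"
      by (simp only: scaleR_diff_left[symmetric]) simp
  next
    fix s assume s: "0 \<le> s" "s \<le> \<tau>"
    show "\<bar>r s - excess r b s \<bullet> direction s\<bar> \<le> max C1 C2" using C1[OF s] by (simp add: phi_eq \<beta>_def inner_commute le_max_iff_disj)
    show "norm (direction s v* \<sigma> s) \<le> max C1 C2" using C2[OF s] by (simp add: risk_price_def le_max_iff_disj)
  qed
  have sN: "sqint M (N t)" by (rule E.sqint_N[OF t])
  have m: "X t \<in> borel_measurable M" "?X t \<in> borel_measurable M"
    using ws_L2F[OF X t] sN by (auto simp: L2F_def sqint_def)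
  have "expectation (X t) = expectation (?X t)" by (rule integral_cong_AE[OF m ae])
  also have "\<dots> = target \<tau> \<gamma> t + density_coeff \<tau> \<gamma> t"
    using sqint_integrable[OF sN] E.N_expectation[OF t] by (simp add: prob_space)
  finally show e: "expectation (X t) = target \<tau> \<gamma> t + density_coeff \<tau> \<gamma> t" .
  have "variance (X t) = expectation (\<lambda>\<omega>. (density_coeff \<tau> \<gamma> t)\<^sup>2 * (N t \<omega> - 1)\<^sup>2)"
  proof (rule integral_cong_AE)
    show "AE \<omega> in M. (X t \<omega> - expectation (X t))\<^sup>2 = (density_coeff \<tau> \<gamma> t)\<^sup>2 * (N t \<omega> - 1)\<^sup>2"
      using ae by eventually_elim (simp add: e power2_eq_square algebra_simps)
  qed (use m sN in \<open>auto simp: sqint_def\<close>)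
  also have "\<dots> = (density_coeff \<tau> \<gamma> t)\<^sup>2 * sqnorm M (\<lambda>\<omega>. N t \<omega> - 1)" by (simp add: sqnorm_def)
  also have "sqnorm M (\<lambda>\<omega>. N t \<omega> - 1) = sqnorm M (N t) - 2 * expectation (\<lambda>\<omega>. N t \<omega> \<bullet> 1) + sqnorm M (\<lambda>\<omega>. 1 :: real)"
    by (rule sqnorm_diff[OF sN sqint_const])
  also have "\<dots> = exp (Phi t) - 1"
    using E.N_expectation[OF t] density_second_moment[OF em t] by (simp add: sqnorm_def prob_space)
  finally show "variance (X t) = (density_coeff \<tau> \<gamma> t)\<^sup>2 * (exp (Phi t) - 1)" .
qed

end

section \<open>The variance of the mean-variance strategies as a function of the horizon\<close>

locale varying = market M W r b \<sigma> x \<epsilon> for M :: "'w measure" and W :: "real \<Rightarrow> 'w \<Rightarrow> real^'d"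
  and r :: "real \<Rightarrow> real" and b :: "real \<Rightarrow> real^'n" and \<sigma> :: "real \<Rightarrow> real^'d^'n" and x \<epsilon> :: real +
  fixes h h' :: "real \<Rightarrow> real"
  assumes h_mono: "mono_on {0..} h"
    and h_deriv: "\<And>t. 0 \<le> t \<Longrightarrow> (h has_real_derivative h' t) (at t within {0..})"
    and h_0: "1 < h 0" and h_gt: "\<And>t. 0 \<le> t \<Longrightarrow> accum r t < h t"
begin

definition gap :: "real \<Rightarrow> real" where "gap t = x * h t - x * accum r t"

text \<open>
  The least variance of the wealth at time \<open>t\<close> among strategies whose mean is \<open>x h(t)\<close>.
\<close>
definition opt_var :: "real \<Rightarrow> real" where "opt_var t = (gap t)\<^sup>2 / (exp (Phi t) - 1)"

lemma gap_pos: "0 \<le> t \<Longrightarrow> 0 < gap t"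
  using h_gt[of t] x by (simp add: gap_def)

lemma accum_DERIV: "0 < s \<Longrightarrow> (accum r has_real_derivative r s * accum r s) (at s)"
  using accum_has_derivative[of s "s + 1"] by (simp add: at_within_Icc_at)

lemma Phi_DERIV: "0 < s \<Longrightarrow> ((\<lambda>t. Phi t) has_real_derivative phi r b \<sigma> s) (at s)"
  using integral_has_real_derivative[OF phi_cont_Icc, of s "s + 1"] by (simp add: at_within_Icc_at)

lemma Phi_cont: "continuous_on {0..T} (\<lambda>t. Phi t)"
  by (rule indefinite_integral_continuous_1) (rule integrable_continuous_real[OF phi_cont_Icc])

lemma h_DERIV: assumes "0 < s" shows "(h has_real_derivative h' s) (at s)"
proof -
  have "at s within {0..} = at s"
    by (rule at_within_open_subset[of _ "{0<..}"]) (use assms in auto)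
  then show ?thesis using h_deriv[of s] assms by simp
qed

lemma h_cont: "continuous_on {0..} h"
  by (rule DERIV_continuous_on) (use h_deriv in auto)

lemma gap_DERIV: "0 < s \<Longrightarrow> (gap has_real_derivative x * (h' s - r s * accum r s)) (at s)"
  unfolding gap_def[abs_def]
  by (auto intro!: derivative_eq_intros h_DERIV accum_DERIV simp: algebra_simps)

lemma gap_cont: "continuous_on {0..T} gap"
  unfolding gap_def[abs_def] by (intro continuous_intros accum_cont continuous_on_subset[OF h_cont]) auto

lemma theta_gap: "0 \<le> s \<Longrightarrow> 2 * (x * (h' s - r s * accum r s)) / gap s = theta r h h' s"
proof -
  have "2 * (x * (h' s - r s * accum r s)) / gap s = (x * (2 * h' s - 2 * r s * accum r s)) / (x * (h s - accum r s))"
    by (simp add: gap_def algebra_simps)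
  also have "\<dots> = theta r h h' s" using x by (simp add: theta_def)
  finally show ?thesis .
qed

lemma Phi_strict_mono: assumes "0 \<le> s" "s < t" shows "Phi s < Phi t"
proof (rule DERIV_pos_imp_increasing_open[OF assms(2)])
  fix y assume "s < y" "y < t"
  then show "\<exists>z. ((\<lambda>t. Phi t) has_real_derivative z) (at y) \<and> 0 < z"
    using Phi_DERIV[of y] phi_pos[of y] assms by auto
qed (use assms in \<open>auto intro: continuous_on_subset[OF Phi_cont[of t]]\<close>)

lemma Phi_pos: "0 < t \<Longrightarrow> 0 < Phi t"
  using Phi_strict_mono[of 0 t] by simp

lemma accum_strict_mono: assumes "0 \<le> s" "s < t" shows "accum r s < accum r t"
proof (rule DERIV_pos_imp_increasing_open[OF assms(2)])
  fix y assume "s < y" "y < t"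
  then show "\<exists>z. (accum r has_real_derivative z) (at y) \<and> 0 < z"
    using accum_DERIV[of y] r_pos[of y] accum_pos[of y] assms by (auto intro!: exI[of _ "r y * accum r y"])
qed (use assms in \<open>auto intro: continuous_on_subset[OF accum_cont[of t]]\<close>)

lemma opt_var_pos: "0 < t \<Longrightarrow> 0 < opt_var t"
  using gap_pos[of t] Phi_pos[of t] by (simp add: opt_var_def)

lemma opt_var_cont: "0 < a \<Longrightarrow> continuous_on {a..T} opt_var"
  unfolding opt_var_def[abs_def]
proof (intro continuous_intros)
  assume a: "0 < a"
  show "continuous_on {a..T} gap" "continuous_on {a..T} (\<lambda>t. Phi t)"
    using a by (auto intro: continuous_on_subset[OF gap_cont[of T]] continuous_on_subset[OF Phi_cont[of T]])
  show "\<forall>t\<in>{a..T}. exp (Phi t) - 1 \<noteq> 0"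
  proof
    fix t assume "t \<in> {a..T}"
    then show "exp (Phi t) - 1 \<noteq> 0" using a Phi_pos[of t] by simp
  qed
qed

text \<open>
  The derivative of \<open>log v\<close> is \<open>\<theta> - \<phi> e\<^bsup>\<Phi>\<^esup> / (e\<^bsup>\<Phi>\<^esup> - 1)\<close>, which is less than \<open>\<theta> - \<phi>\<close>.
\<close>
lemma opt_var_strict_antimono:
  assumes \<theta>: "\<And>s. 0 \<le> s \<Longrightarrow> theta r h h' s \<le> phi r b \<sigma> s" and st: "0 < s" "s < t"
  shows "opt_var t < opt_var s"
proof -
  let ?f = "\<lambda>t. 2 * ln (gap t) - ln (exp (Phi t) - 1)"
  have opt_var: "opt_var t = exp (?f t)" if "0 < t" for t
  proof -
    have "exp (?f t) = exp (ln (gap t)) ^ 2 / exp (ln (exp (Phi t) - 1))"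
      by (simp add: exp_diff exp_double)
    then show ?thesis using gap_pos[of t] Phi_pos[of t] that by (simp add: opt_var_def)
  qed
  have "?f t < ?f s"
  proof (rule DERIV_neg_imp_decreasing_open[OF st(2)])
    fix y assume y: "s < y" "y < t"
    then have y0: "0 < y" using st by simp
    have e: "0 < exp (Phi y) - 1" using Phi_pos[OF y0] by simp
    have "(?f has_real_derivative 2 * (x * (h' y - r y * accum r y)) / gap y - phi r b \<sigma> y * exp (Phi y) / (exp (Phi y) - 1)) (at y)"
      using gap_pos[of y] y0 e by (auto intro!: derivative_eq_intros gap_DERIV Phi_DERIV simp: mult_ac)
    moreover have "theta r h h' y - phi r b \<sigma> y * exp (Phi y) / (exp (Phi y) - 1) < 0"
    proof -
      have "phi r b \<sigma> y * (exp (Phi y) - 1) < phi r b \<sigma> y * exp (Phi y)" using phi_pos[of y] y0 by simp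
      then have "phi r b \<sigma> y < phi r b \<sigma> y * exp (Phi y) / (exp (Phi y) - 1)" using e by (simp only: less_divide_eq if_True)
      then show ?thesis using \<theta>[of y] y0 by simp
    qed
    ultimately show "\<exists>z. (?f has_real_derivative z) (at y) \<and> z < 0"
      using theta_gap[of y] y0 by auto
  next
    have "gap t \<noteq> 0" "exp (Phi t) - 1 \<noteq> 0" if "0 < t" for t using gap_pos[of t] Phi_pos[OF that] that by auto
    then show "continuous_on {s..t} ?f"
      using st by (intro continuous_intros continuous_on_subset[OF gap_cont[of t]] continuous_on_subset[OF Phi_cont[of t]]) auto
  qed
  then show ?thesis using opt_var st by simp
qed

text \<open>
  Near \<open>0\<close> the numerator of \<open>v\<close> stays away from \<open>0\<close> and the denominator tends to \<open>0\<close>. For large \<open>t\<close>, \<open>v\<close> exceeds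
  \<open>gap\<^sup>2 e\<^bsup>-\<Phi>\<^esup>\<close>, whose logarithm has derivative \<open>\<theta> - \<phi> > \<delta>\<close>. So values below \<open>v(1)\<close> occur only on a compact
  interval.
\<close>
lemma opt_var_attains_min:
  assumes "0 < \<delta>" and \<theta>: "\<And>s. 0 \<le> s \<Longrightarrow> phi r b \<sigma> s + \<delta> < theta r h h' s"
  shows "\<exists>t>0. \<forall>s>0. opt_var t \<le> opt_var s"
proof -
  obtain a where a: "0 < a" "a < 1" "\<And>t. 0 < t \<Longrightarrow> t < a \<Longrightarrow> opt_var 1 < opt_var t"
  proof -
    have "\<exists>y\<in>{0..1}. \<forall>t\<in>{0..1}. gap y \<le> gap t"
      by (rule continuous_attains_inf) (use gap_cont in auto)
    then obtain y where y: "y \<in> {0..1}" "\<And>t. t \<in> {0..1} \<Longrightarrow> gap y \<le> gap t" by blast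
    have g0: "0 < gap y" using gap_pos[of y] y by auto
    \<comment> \<open>the size of the denominator below which \<open>v\<close> exceeds \<open>v(1)\<close>\<close>
    define k where "k = (gap y)\<^sup>2 / (opt_var 1 + 1)"
    have k: "0 < k" using g0 opt_var_pos[of 1] by (simp add: k_def)
    have "continuous_on {0..1} (\<lambda>t. exp (Phi t) - 1)" by (intro continuous_intros Phi_cont)
    then obtain d where d: "0 < d" "\<And>t. t \<in> {0..1} \<Longrightarrow> dist t 0 < d \<Longrightarrow> dist (exp (Phi t) - 1) (exp (Phi 0) - 1) < k"
      using k unfolding continuous_on_iff by (metis atLeastAtMost_iff order_refl zero_le_one)
    show ?thesis
    proof (rule that[of "min d (1/2)"])
      fix t assume t: "0 < t" "t < min d (1/2)"
      then have e: "0 < exp (Phi t) - 1" "exp (Phi t) - 1 < k"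
        using d(2)[of t] Phi_pos[of t] by (auto simp: dist_real_def)
      have "opt_var 1 + 1 = (gap y)\<^sup>2 / k" using g0 opt_var_pos[of 1] by (simp add: k_def)
      also have "\<dots> \<le> (gap t)\<^sup>2 / (exp (Phi t) - 1)"
        using e g0 y(2)[of t] t k by (intro frac_le power_mono) auto
      finally show "opt_var 1 < opt_var t" by (simp add: opt_var_def)
    qed (use d in auto)
  qed
  \<comment> \<open>a linear lower bound for the exponential suffices at infinity\<close>
  obtain b1 where b1: "1 < b1" "\<And>t. b1 < t \<Longrightarrow> opt_var 1 < opt_var t"
  proof -
    let ?f = "\<lambda>t. 2 * ln (gap t) - Phi t - \<delta> * t"
    have mono: "?f 0 < ?f t" if t: "0 < t" for t
    proof (rule DERIV_pos_imp_increasing_open[OF t])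
      fix y assume y: "0 < y" "y < t"
      have "(?f has_real_derivative 2 * (x * (h' y - r y * accum r y)) / gap y - phi r b \<sigma> y - \<delta>) (at y)"
        using gap_pos[of y] y by (auto intro!: derivative_eq_intros gap_DERIV Phi_DERIV)
      then show "\<exists>z. (?f has_real_derivative z) (at y) \<and> 0 < z"
        using theta_gap[of y] \<theta>[of y] y by (intro exI[of _ "theta r h h' y - phi r b \<sigma> y - \<delta>"]) auto
    next
      have "gap t \<noteq> 0" if "0 \<le> t" for t using gap_pos[OF that] by simp
      then show "continuous_on {0..t} ?f" by (intro continuous_intros gap_cont Phi_cont) auto
    qed
    define k where "k = exp (?f 0)"
    have k: "0 < k" by (simp add: k_def)
    have low: "k * (\<delta> * t) \<le> opt_var t" if t: "0 < t" for t
    proof -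
      have "k * (\<delta> * t) \<le> k * exp (\<delta> * t)" 
      proof -
        have "\<delta> * t \<le> exp (\<delta> * t)" using exp_ge_add_one_self[of "\<delta> * t"] by linarith
        then show ?thesis using k by simp
      qed
      also have "\<dots> = exp (?f 0 + \<delta> * t)" by (simp add: k_def exp_add)
      also have "\<dots> \<le> exp (2 * ln (gap t) - Phi t)" using mono[OF t] by simp
      also have "\<dots> = (gap t)\<^sup>2 / exp (Phi t)" using gap_pos[of t] t by (simp add: exp_diff exp_double)
      also have "\<dots> \<le> opt_var t" unfolding opt_var_def using Phi_pos[OF t] by (intro divide_left_mono) auto
      finally show ?thesis .
    qed
    show ?thesis
    proof (rule that[of "max 2 (opt_var 1 / (k * \<delta>))"])
      fix t assume t: "max 2 (opt_var 1 / (k * \<delta>)) < t"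
      then have "opt_var 1 < k * \<delta> * t" using k assms(1) by (simp add: divide_less_eq mult.commute)
      then show "opt_var 1 < opt_var t" using low[of t] t by (simp add: mult.assoc)
    qed simp
  qed
  have "\<exists>t\<in>{a..b1}. \<forall>s\<in>{a..b1}. opt_var t \<le> opt_var s"
    by (rule continuous_attains_inf) (use a b1 opt_var_cont[OF a(1)] in auto)
  then obtain t where t: "t \<in> {a..b1}" "\<And>s. s \<in> {a..b1} \<Longrightarrow> opt_var t \<le> opt_var s" by blast
  have "opt_var t \<le> opt_var s" if "0 < s" for s
  proof -
    have "opt_var t \<le> opt_var 1" using t(2)[of 1] a b1 by auto
    then show ?thesis using t(2)[of s] a(3)[OF that] b1(2)[of s] by (cases "s < a"; cases "b1 < s") auto
  qed
  then show ?thesis using t a by (intro exI[of _ t]) auto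
qed

section \<open>The varying terminal time model\<close>

abbreviation \<gamma> :: "real \<Rightarrow> real" where "\<gamma> \<equiv> gamma r b \<sigma> x h"
abbreviation fs :: "real \<Rightarrow> (real \<Rightarrow> 'w \<Rightarrow> real^'n) \<Rightarrow> (real \<Rightarrow> 'w \<Rightarrow> real) \<Rightarrow> bool" where
  "fs \<equiv> feedback_solution M W r b \<sigma> x h"

lemma feedback_iff: "fs \<tau> \<pi> X \<longleftrightarrow> closed_loop \<tau> (\<gamma> \<tau>) \<pi> X"
  by (simp add: feedback_solution_def closed_loop_def direction_def)

lemma feedback_exists: "0 < \<tau> \<Longrightarrow> \<exists>\<pi> X. fs \<tau> \<pi> X"
  unfolding feedback_iff by (rule closed_loop_exists)

lemma mu_eq: "mu r b \<sigma> x h \<tau> = (exp (Phi \<tau>) - 1) / gap \<tau>"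
  by (simp add: mu_def gap_def)

lemma shortfall_eq: "0 < \<tau> \<Longrightarrow> shortfall \<tau> (\<gamma> \<tau>) = gap \<tau> * exp (Phi \<tau>) / ((exp (Phi \<tau>) - 1) * accum r \<tau>)"
  using accum_pos[of \<tau>] Phi_pos[of \<tau>] by (simp add: shortfall_def gamma_def mu_eq add_divide_distrib)

lemma shortfall_pos: "0 < \<tau> \<Longrightarrow> 0 < shortfall \<tau> (\<gamma> \<tau>)"
  using shortfall_eq[of \<tau>] gap_pos[of \<tau>] Phi_pos[of \<tau>] accum_pos[of \<tau>] by simp

lemma density_coeff_final: assumes "0 < \<tau>" shows "density_coeff \<tau> (\<gamma> \<tau>) \<tau> = - (gap \<tau> / (exp (Phi \<tau>) - 1))"
  using shortfall_eq[OF assms] accum_pos[of \<tau>] by (simp add: density_coeff_def exp_minus)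

lemma feedback_variance:
  assumes "0 < \<tau>" "fs \<tau> \<pi> X" shows "variance (X \<tau>) = opt_var \<tau>"
proof -
  have "0 < exp (Phi \<tau>) - 1" using Phi_pos[OF assms(1)] by simp
  then show ?thesis
    using closed_loop_moments(2)[OF assms(1) assms(2)[unfolded feedback_iff], of \<tau>] assms(1)
    by (simp add: density_coeff_final[OF assms(1)] opt_var_def power_divide power2_eq_square)
qed

text \<open>
  Both factors increase with \<open>t\<close>, which is visible in this form.
\<close>
lemma feedback_mean:
  assumes "0 < \<tau>" "fs \<tau> \<pi> X" "0 \<le> t" "t \<le> \<tau>"
  shows "expectation (X t) = accum r t * (x + shortfall \<tau> (\<gamma> \<tau>) * (1 - exp (- Phi t)))"
  using closed_loop_moments(1)[OF assms(1) assms(2)[unfolded feedback_iff] assms(3,4)]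
  by (simp add: target_def density_coeff_def shortfall_def algebra_simps)

lemma feedback_mean_final:
  assumes "0 < \<tau>" "fs \<tau> \<pi> X" shows "expectation (X \<tau>) = x * h \<tau>"
proof -
  have e: "exp (Phi \<tau>) - 1 \<noteq> 0" using Phi_pos[OF assms(1)] by simp
  have "expectation (X \<tau>) = target \<tau> (\<gamma> \<tau>) \<tau> + density_coeff \<tau> (\<gamma> \<tau>) \<tau>"
    using closed_loop_moments(1)[OF assms(1) assms(2)[unfolded feedback_iff], of \<tau>] assms(1) by simp
  also have "\<dots> = \<gamma> \<tau> - gap \<tau> / (exp (Phi \<tau>) - 1)"
    using accum_pos[of \<tau>] by (simp add: target_def density_coeff_final[OF assms(1)])
  also have "\<gamma> \<tau> = gap \<tau> * exp (Phi \<tau>) / (exp (Phi \<tau>) - 1) + x * accum r \<tau>"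
    by (simp add: gamma_def mu_eq)
  also have "gap \<tau> * exp (Phi \<tau>) / (exp (Phi \<tau>) - 1) + x * accum r \<tau> - gap \<tau> / (exp (Phi \<tau>) - 1)
      = gap \<tau> * (exp (Phi \<tau>) - 1) / (exp (Phi \<tau>) - 1) + x * accum r \<tau>"
    by (simp add: diff_divide_distrib right_diff_distrib)
  also have "\<dots> = x * h \<tau>" using e by (simp add: gap_def)
  finally show ?thesis .
qed

lemma feedback_mean_less:
  assumes "0 < \<tau>" "fs \<tau> \<pi> X" "0 \<le> t" "t < \<tau>" shows "expectation (X t) < x * h \<tau>"
proof -
  let ?f = "\<lambda>t. x + shortfall \<tau> (\<gamma> \<tau>) * (1 - exp (- Phi t))"
  have Y: "0 < shortfall \<tau> (\<gamma> \<tau>)" by (rule shortfall_pos[OF assms(1)])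
  have "0 \<le> Phi t" using Phi_pos[of t] assms by (cases "t = 0") auto
  then have "0 < ?f t" using x Y by (intro add_pos_nonneg mult_nonneg_nonneg) auto
  moreover have "?f t < ?f \<tau>" using Phi_strict_mono[OF assms(3,4)] Y by simp
  ultimately have "accum r t * ?f t < accum r \<tau> * ?f \<tau>"
    using accum_strict_mono[OF assms(3,4)] accum_pos[of t] by (intro mult_strict_mono) auto
  then show ?thesis
    using feedback_mean[OF assms(1,2), of t] feedback_mean[OF assms(1,2), of \<tau>] feedback_mean_final[OF assms(1,2)] assms(3,4)
    by simp
qed

abbreviation hit :: "real \<Rightarrow> (real \<Rightarrow> 'w \<Rightarrow> real^'n) \<Rightarrow> ereal" where "hit \<equiv> hitting_time M W r b \<sigma> x h"

lemma feedback_hitting: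
  assumes "0 < \<tau>" "fs \<tau> \<pi> X" shows "hit \<tau> \<pi> = ereal \<tau>"
proof -
  have X: "ws \<tau> \<pi> X" using assms(2) by (simp add: feedback_solution_def)
  have "{t \<in> {0..\<tau>}. \<exists>X. ws t \<pi> X \<and> expectation (X t) \<ge> x * h \<tau>} = {\<tau>}"
  proof (intro set_eqI iffI)
    fix t assume "t \<in> {t \<in> {0..\<tau>}. \<exists>X. ws t \<pi> X \<and> expectation (X t) \<ge> x * h \<tau>}"
    then obtain X1 where t: "0 \<le> t" "t \<le> \<tau>" "ws t \<pi> X1" "x * h \<tau> \<le> expectation (X1 t)" by auto
    have "expectation (X1 t) = expectation (X t)" by (rule ws_cong_variance(1)[OF t(3) ws_mono[OF X t(2)] t(1)])
    then show "t \<in> {\<tau>}" using feedback_mean_less[OF assms t(1)] t by force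
  next
    fix t assume "t \<in> {\<tau>}"
    then show "t \<in> {t \<in> {0..\<tau>}. \<exists>X. ws t \<pi> X \<and> expectation (X t) \<ge> x * h \<tau>}"
      using X feedback_mean_final[OF assms] assms(1) by auto
  qed
  then show ?thesis by (simp add: hitting_time_def)
qed

lemma cost_eq:
  assumes "hit \<tau> \<pi> = ereal T" "0 \<le> T" "ws T \<pi> X"
  shows "cost M W r b \<sigma> x h \<tau> \<pi> = variance (X T)"
  unfolding cost_def Let_def assms(1) real_of_ereal.simps
proof (rule the_equality)
  show "\<exists>X'. ws T \<pi> X' \<and> variance (X T) = variance (X' T)" using assms(3) by blast
  fix v assume "\<exists>X'. ws T \<pi> X' \<and> v = variance (X' T)"
  then show "v = variance (X T)" using ws_cong_variance(2)[OF assms(3) _ assms(2)] by auto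
qed

lemma feedback_cost:
  assumes "0 < \<tau>" "fs \<tau> \<pi> X"
  shows "cost M W r b \<sigma> x h \<tau> \<pi> = variance (X \<tau>)" "admissible M W r b \<sigma> x h \<tau> \<pi>"
proof -
  have X: "ws \<tau> \<pi> X" using assms(2) by (simp add: feedback_solution_def)
  show "cost M W r b \<sigma> x h \<tau> \<pi> = variance (X \<tau>)"
    by (rule cost_eq[OF feedback_hitting[OF assms] _ X]) (use assms in auto)
  show "admissible M W r b \<sigma> x h \<tau> \<pi>"
    using X by (simp add: admissible_def feedback_hitting[OF assms] wealth_solution_def)
qed

text \<open>
  The set of times at which the mean has reached \<open>x h(\<tau>)\<close> is nonempty, and continuity of the mean from
  one solution \<open>X\<close> shows that its infimum belongs to it. All solutions agree, so \<open>X\<close> decides membership up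
  to \<open>t0\<close>. The infimum is not \<open>0\<close> because \<open>x < x h(0)\<close>.
\<close>
lemma admissible_cost_lower_bound:
  assumes \<tau>: "0 < \<tau>" and ad: "admissible M W r b \<sigma> x h \<tau> \<pi>"
  obtains T where "0 < T" "T \<le> \<tau>" "hit \<tau> \<pi> = ereal T" "opt_var T \<le> cost M W r b \<sigma> x h \<tau> \<pi>"
proof -
  define S where "S = {t \<in> {0..\<tau>}. \<exists>X. ws t \<pi> X \<and> expectation (X t) \<ge> x * h \<tau>}"
  have hS: "hit \<tau> \<pi> = Inf (ereal ` S)" by (simp add: hitting_time_def S_def)
  have ne: "S \<noteq> {}"
  proof
    assume "S = {}"
    then have "hit \<tau> \<pi> = \<infinity>" by (simp add: hS top_ereal_def)
    then show False using ad by (simp add: admissible_def)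
  qed
  have bdd: "bdd_below S" by (rule bdd_belowI[of _ 0]) (auto simp: S_def)
  define T where "T = Inf S"
  have hT: "hit \<tau> \<pi> = ereal T" using ereal_Inf'[OF bdd ne] by (simp add: hS T_def)
  obtain t0 where t0: "t0 \<in> S" using ne by blast
  then obtain X where X: "ws t0 \<pi> X" by (auto simp: S_def)
  have t00: "0 \<le> t0" "t0 \<le> \<tau>" using t0 by (auto simp: S_def)
  have T0: "0 \<le> T" unfolding T_def by (rule cInf_greatest[OF ne]) (auto simp: S_def)
  have Tt0: "T \<le> t0" unfolding T_def by (rule cInf_lower[OF t0 bdd])
  have inS: "x * h \<tau> \<le> expectation (X t)" if tS: "t \<in> S" "t \<le> t0" for t
  proof -
    obtain X1 where t: "0 \<le> t" "ws t \<pi> X1" "x * h \<tau> \<le> expectation (X1 t)" using tS(1) unfolding S_def by auto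
    then show ?thesis using ws_cong_variance(1)[OF t(2) ws_mono[OF X tS(2)] t(1)] by simp
  qed
  have ET: "x * h \<tau> \<le> expectation (X T)"
  proof (rule ccontr)
    assume "\<not> x * h \<tau> \<le> expectation (X T)"
    then have "0 < x * h \<tau> - expectation (X T)" by simp
    moreover have "T \<in> {0..t0}" using T0 Tt0 by simp
    ultimately obtain d where d: "0 < d" "\<And>t. t \<in> {0..t0} \<Longrightarrow> dist t T < d \<Longrightarrow> dist (expectation (X t)) (expectation (X T)) < x * h \<tau> - expectation (X T)"
      using ws_mean_continuous[OF X t00(1)] unfolding continuous_on_iff by meson
    have "Inf S < T + d" using d(1) by (simp add: T_def)
    then obtain t where t: "t \<in> S" "t < T + d" using cInf_lessD[OF ne] by blast
    have tT: "T \<le> t" unfolding T_def by (rule cInf_lower[OF t(1) bdd])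
    \<comment> \<open>beyond \<open>t0\<close> the solution \<open>X\<close> says nothing, but then \<open>t0\<close> itself is near \<open>T\<close>\<close>
    define q where "q = min t t0"
    have "q \<in> S" "q \<le> t0" "T \<le> q" "q < T + d" using t t0 tT Tt0 by (auto simp: q_def min_def)
    then show False using d(2)[of q] inS[of q] T0 by (auto simp: dist_real_def)
  qed
  have hm: "h T \<le> h \<tau>" if "T \<le> \<tau>" using h_mono T0 that by (auto simp: mono_on_def)
  have T\<tau>: "T \<le> \<tau>" using Tt0 t00 by simp
  have XT: "ws T \<pi> X" by (rule ws_mono[OF X Tt0])
  have Tpos: "0 < T"
  proof (rule ccontr)
    assume "\<not> 0 < T"
    then have "T = 0" using T0 by simp
    have "(LINT s:{0..0::real}|lborel. expectation (drift \<pi> X s)) = 0"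
      by (simp add: set_lebesgue_integral_def integral_eq_zero_AE[OF AE_mp[OF AE_lborel_singleton[of 0] AE_I2]])
    then have "expectation (X T) = x"
      using ws_mean(1)[OF XT, of 0] \<open>T = 0\<close> by simp
    moreover have "h 0 \<le> h \<tau>" using h_mono \<tau> by (auto simp: mono_on_def)
    then have "x * 1 < x * h \<tau>" using x h_0 by (intro mult_strict_left_mono) auto
    ultimately show False using ET by simp
  qed
  have e: "0 < exp (Phi T) - 1" using Phi_pos[OF Tpos] by simp
  have "gap T \<le> expectation (X T) - x * accum r T"
  proof -
    have "x * h T \<le> x * h \<tau>" using hm[OF T\<tau>] x by simp
    then show ?thesis using ET unfolding gap_def by linarith
  qed
  then have "(gap T)\<^sup>2 \<le> (expectation (X T) - x * accum r T)\<^sup>2" using gap_pos[OF T0] by (intro power_mono) auto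
  also have "\<dots> \<le> variance (X T) * (exp (Phi T) - 1)" by (rule variance_lower_bound[OF Tpos XT])
  finally have "opt_var T \<le> variance (X T)" unfolding opt_var_def using e by (simp only: divide_le_eq if_True)
  then show ?thesis using that[OF Tpos T\<tau> hT] cost_eq[OF hT T0 XT] by simp
qed

lemma minimal_feedback_optimal:
  assumes "0 < \<tau>" "fs \<tau> \<pi> X" "\<And>s. 0 < s \<Longrightarrow> opt_var \<tau> \<le> opt_var s"
  shows "optimal_strategy M W r b \<sigma> x h \<pi> \<tau>"
  unfolding optimal_strategy_def
proof (intro conjI allI impI)
  fix \<tau>' \<pi>' assume "0 < \<tau>'" "admissible M W r b \<sigma> x h \<tau>' \<pi>'"
  then obtain T where "0 < T" "opt_var T \<le> cost M W r b \<sigma> x h \<tau>' \<pi>'" by (rule admissible_cost_lower_bound)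
  then show "cost M W r b \<sigma> x h \<tau> \<pi> \<le> cost M W r b \<sigma> x h \<tau>' \<pi>'"
    using assms(3)[of T] feedback_cost(1)[OF assms(1,2)] feedback_variance[OF assms(1,2)] by simp
qed (use assms feedback_hitting[OF assms(1,2)] feedback_cost(2)[OF assms(1,2)] in auto)

text \<open>
  An optimal pair is stopped at its own \<open>\<tau>\<close> and costs at least \<open>v(\<tau>)\<close>, but the feedback strategy for \<open>\<tau> + 1\<close>
  costs less.
\<close>
lemma no_optimal_if_decreasing:
  assumes dec: "\<And>s t. 0 < s \<Longrightarrow> s < t \<Longrightarrow> opt_var t < opt_var s"
  shows "\<not> optimal_strategy M W r b \<sigma> x h \<pi> \<tau>"
proof
  assume o: "optimal_strategy M W r b \<sigma> x h \<pi> \<tau>"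
  then have \<tau>: "0 < \<tau>" "admissible M W r b \<sigma> x h \<tau> \<pi>" "hit \<tau> \<pi> = ereal \<tau>"
    "\<And>\<tau>' \<pi>'. 0 < \<tau>' \<Longrightarrow> admissible M W r b \<sigma> x h \<tau>' \<pi>' \<Longrightarrow> cost M W r b \<sigma> x h \<tau> \<pi> \<le> cost M W r b \<sigma> x h \<tau>' \<pi>'"
    by (auto simp: optimal_strategy_def)
  obtain T where T: "0 < T" "hit \<tau> \<pi> = ereal T" "opt_var T \<le> cost M W r b \<sigma> x h \<tau> \<pi>"
    using admissible_cost_lower_bound[OF \<tau>(1,2)] by blast
  have "T = \<tau>" using T(2) \<tau>(3) by simp
  have s: "0 < \<tau> + 1" using \<tau>(1) by simp
  obtain \<pi>' X' where fs: "fs (\<tau> + 1) \<pi>' X'" using feedback_exists[OF s] by blast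
  have "cost M W r b \<sigma> x h \<tau> \<pi> \<le> opt_var (\<tau> + 1)"
    using \<tau>(4)[OF s feedback_cost(2)[OF s fs]] feedback_cost(1)[OF s fs] feedback_variance[OF s fs] by simp
  then show False using dec[of \<tau> "\<tau> + 1"] T(3) \<tau>(1) \<open>T = \<tau>\<close> by simp
qed

end

theorem theorem3p2:
  fixes M :: "'w measure"
    and W :: "real \<Rightarrow> 'w \<Rightarrow> real^'d"
    and r :: "real \<Rightarrow> real"
    and b :: "real \<Rightarrow> real^'n"
    and \<sigma> :: "real \<Rightarrow> real^'d^'n"
    and h h' :: "real \<Rightarrow> real"
    and x \<epsilon> :: real
  assumes prob: "prob_space M" "complete_measure M"
    and BM: "brownian_motion M W"
    and x: "x > 0"
    and H1: "continuous_on {0..} r" "bounded (r ` {0..})"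
            "continuous_on {0..} b" "bounded (b ` {0..})"
            "continuous_on {0..} \<sigma>" "bounded (\<sigma> ` {0..})"
    and H2: "\<forall>t\<ge>0. r t > 0" "\<forall>t\<ge>0. \<forall>i. excess r b t $ i > 0"
            "\<epsilon> > 0" "\<forall>t\<ge>0. pos_def (cov \<sigma> t - mat \<epsilon>)"
    and H3: "mono_on {0..} h" "\<forall>t\<ge>0. (h has_real_derivative h' t) (at t within {0..})"
            "h 0 > 1" "\<forall>t\<ge>0. h t > accum r t"
  shows "(\<forall>\<tau>>0. \<exists>\<pi> X. feedback_solution M W r b \<sigma> x h \<tau> \<pi> X) \<and>
    (\<forall>\<pi> X. (\<forall>\<tau>>0. feedback_solution M W r b \<sigma> x h \<tau> (\<pi> \<tau>) (X \<tau>)) \<longrightarrow>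
      ((\<exists>\<delta>>0. \<forall>s\<ge>0. theta r h h' s > phi r b \<sigma> s + \<delta>) \<longrightarrow>
         (\<exists>\<tau>'>0. \<forall>\<tau>>0. prob_space.variance M (X \<tau>' \<tau>') \<le> prob_space.variance M (X \<tau> \<tau>)) \<and>
         (\<forall>\<tau>'>0. (\<forall>\<tau>>0. prob_space.variance M (X \<tau>' \<tau>') \<le> prob_space.variance M (X \<tau> \<tau>)) \<longrightarrow>
            optimal_strategy M W r b \<sigma> x h (\<pi> \<tau>') \<tau>')) \<and>
      ((\<forall>s\<ge>0. theta r h h' s \<le> phi r b \<sigma> s) \<longrightarrow>
         (\<forall>\<tau>>0. cost M W r b \<sigma> x h \<tau> (\<pi> \<tau>) = prob_space.variance M (X \<tau> \<tau>)) \<and>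
         strict_antimono_on {0<..} (\<lambda>\<tau>. prob_space.variance M (X \<tau> \<tau>)) \<and>
         \<not> (\<exists>\<pi>' \<tau>'. optimal_strategy M W r b \<sigma> x h \<pi>' \<tau>')))"
proof -
  interpret prob_space M by (rule prob)
  interpret varying M W r b \<sigma> x \<epsilon> h h'
    by unfold_locales
      (assumption | rule prob BM x H1(1,3,5) H2(3) H3(1,3) H2(1,2,4)[rule_format] H3(2,4)[rule_format])+
  show ?thesis
  proof (intro conjI allI impI)
    fix \<tau> :: real assume "0 < \<tau>"
    then show "\<exists>\<pi> X. fs \<tau> \<pi> X" by (rule feedback_exists)
  next
    fix \<pi> X assume fs: "\<forall>\<tau>>0. fs \<tau> (\<pi> \<tau>) (X \<tau>)" and "\<exists>\<delta>>0. \<forall>s\<ge>0. theta r h h' s > phi r b \<sigma> s + \<delta>"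
    then obtain \<delta> where \<delta>: "0 < \<delta>" "\<And>s. 0 \<le> s \<Longrightarrow> phi r b \<sigma> s + \<delta> < theta r h h' s" by blast
    show "\<exists>\<tau>'>0. \<forall>\<tau>>0. variance (X \<tau>' \<tau>') \<le> variance (X \<tau> \<tau>)"
      using opt_var_attains_min[OF \<delta>] feedback_variance fs by metis
  next
    fix \<pi> X and \<tau>' :: real
    assume fs: "\<forall>\<tau>>0. fs \<tau> (\<pi> \<tau>) (X \<tau>)" and \<tau>': "0 < \<tau>'"
      and min: "\<forall>\<tau>>0. variance (X \<tau>' \<tau>') \<le> variance (X \<tau> \<tau>)"
    have "opt_var \<tau>' \<le> opt_var s" if "0 < s" for s
      using min[rule_format, OF that] feedback_variance[OF \<tau>' fs[rule_format, OF \<tau>']]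
        feedback_variance[OF that fs[rule_format, OF that]] by simp
    then show "optimal_strategy M W r b \<sigma> x h (\<pi> \<tau>') \<tau>'"
      using minimal_feedback_optimal[OF \<tau>'] fs \<tau>' by blast
  next
    fix \<pi> X and \<tau> :: real assume "\<forall>\<tau>>0. fs \<tau> (\<pi> \<tau>) (X \<tau>)" "0 < \<tau>"
    then show "cost M W r b \<sigma> x h \<tau> (\<pi> \<tau>) = variance (X \<tau> \<tau>)" using feedback_cost(1) by blast
  next
    fix \<pi> X assume fs: "\<forall>\<tau>>0. fs \<tau> (\<pi> \<tau>) (X \<tau>)" and \<theta>: "\<forall>s\<ge>0. theta r h h' s \<le> phi r b \<sigma> s"
    have dec: "opt_var t < opt_var s" if "0 < s" "s < t" for s t using opt_var_strict_antimono[OF _ that] \<theta> by blast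
    have var: "variance (X \<tau> \<tau>) = opt_var \<tau>" if "0 < \<tau>" for \<tau> using feedback_variance[OF that] fs that by blast
    show "strict_antimono_on {0<..} (\<lambda>\<tau>. variance (X \<tau> \<tau>))"
      by (rule monotone_onI) (use dec var in auto)
  next
    fix \<pi> X assume "\<forall>s\<ge>0. theta r h h' s \<le> phi r b \<sigma> s"
    then have "opt_var t < opt_var s" if "0 < s" "s < t" for s t using opt_var_strict_antimono[OF _ that] by blast
    then show "\<not> (\<exists>\<pi>' \<tau>'. optimal_strategy M W r b \<sigma> x h \<pi>' \<tau>')"
      using no_optimal_if_decreasing by blast
  qed
qed

end
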